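(* Let $\mathcal O$ be a $W_0$-conjugacy class of $\tilde W_0$. Then $\mathcal O$ is nice if and only if it is weakly elliptic, i.e. for every $\tilde w\in\mathcal O$, $\mathrm{supp}(\tilde w)$ is a union of connected components of the Coxeter (Dynkin) diagram of $S_0$ and $\tilde w$ commutes with every element of $S_0-\mathrm{supp}(\tilde w)$.
   Context: $(W_0,S_0)$ is a finite Coxeter group with length $\ell$, $\Omega'$ a group acting on $W_0$ by automorphisms preserving $S_0$, $\tilde W_0=W_0\rtimes\Omega'$, $\ell(w\sigma)=\ell(w)$. For $w\in W_0$, $\mathrm{supp}(w)$ is the set of simple reflections in a reduced expression of $w$; $\mathrm{supp}(w\sigma)=\bigcup_n\sigma^n(\mathrm{supp}(w))$. For $w,w'\in\tilde W_0$, $s\in S_0$, write $w\xrightarrow{s}w'$ if $w'=sws$ and $\ell(w')\le\ell(w)$. For $\tilde w$ of minimal length in its $W_0$-conjugacy class, a path from $\tilde w$ is a sequence $(s_1,\dots,s_r)$ in $S_0$ with $\tilde w\xrightarrow{s_1}s_1\tilde ws_1\xrightarrow{s_2}\cdots\xrightarrow{s_r}s_r\cdots s_1\tilde ws_1\cdots s_r$; let $W_{\tilde w}=\{x\in W_0:\ell(x^{-1}\tilde wx)=\ell(\tilde w)\}$. A $W_0$-conjugacy class $\mathcal O$ is nice if for some (equivalently any) minimal length $\tilde w\in\mathcal O$, every $x\in W_{\tilde w}$ equals $s_1\cdots s_r$ for some path $(s_1,\dots,s_r)$ from $\tilde w$. *)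

theory Defs
  imports "HOL-Algebra.Group"
begin

text \<open>Setting. The group tilde W0 = W0 semidirect Omega' is modelled as an ambient group G
(HOL-Algebra) containing W (the Coxeter group W0), its set S of simple reflections (S0),
and a subgroup Om (Omega') such that every element of G is uniquely w * sigma with
w in W, sigma in Om, and conjugation by Om preserves S (internal semidirect product).\<close>

definition cox_prod :: "('g, 'b) monoid_scheme \<Rightarrow> 'g list \<Rightarrow> 'g" where
  "cox_prod G ss = foldr (\<lambda>a b. a \<otimes>\<^bsub>G\<^esub> b) ss \<one>\<^bsub>G\<^esub>"

definition cox_lenW :: "('g, 'b) monoid_scheme \<Rightarrow> 'g set \<Rightarrow> 'g \<Rightarrow> nat" where
  "cox_lenW G S w = (LEAST n. \<exists>ss. set ss \<subseteq> S \<and> length ss = n \<and> w = cox_prod G ss)"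

text \<open>Coxeter system (W,S), W a subgroup of G: S a generating set of involutions
satisfying the exchange condition (Bjoerner-Brenti, Thm 1.5.1 characterisation).\<close>
definition coxeter_system :: "('g, 'b) monoid_scheme \<Rightarrow> 'g set \<Rightarrow> 'g set \<Rightarrow> bool" where
  "coxeter_system G W S \<longleftrightarrow>
     subgroup W G \<and> S \<subseteq> W \<and>
     (\<forall>s\<in>S. s \<noteq> \<one>\<^bsub>G\<^esub> \<and> s \<otimes>\<^bsub>G\<^esub> s = \<one>\<^bsub>G\<^esub>) \<and>
     (\<forall>w\<in>W. \<exists>ss. set ss \<subseteq> S \<and> w = cox_prod G ss) \<and>
     (\<forall>s\<in>S. \<forall>ss. set ss \<subseteq> S \<longrightarrow> length ss = cox_lenW G S (cox_prod G ss) \<longrightarrow>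
        cox_lenW G S (s \<otimes>\<^bsub>G\<^esub> cox_prod G ss) \<le> cox_lenW G S (cox_prod G ss) \<longrightarrow>
        (\<exists>i < length ss. s \<otimes>\<^bsub>G\<^esub> cox_prod G ss = cox_prod G (take i ss @ drop (Suc i) ss)))"

definition cox_setting :: "('g, 'b) monoid_scheme \<Rightarrow> 'g set \<Rightarrow> 'g set \<Rightarrow> 'g set \<Rightarrow> bool" where
  "cox_setting G W S Om \<longleftrightarrow>
     group G \<and> coxeter_system G W S \<and> finite W \<and> subgroup Om G \<and>
     (\<forall>\<sigma>\<in>Om. \<forall>s\<in>S. \<sigma> \<otimes>\<^bsub>G\<^esub> s \<otimes>\<^bsub>G\<^esub> inv\<^bsub>G\<^esub> \<sigma> \<in> S) \<and>
     W \<inter> Om = {\<one>\<^bsub>G\<^esub>} \<and>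
     (\<forall>g\<in>carrier G. \<exists>w\<in>W. \<exists>\<sigma>\<in>Om. g = w \<otimes>\<^bsub>G\<^esub> \<sigma>)"

definition cox_len :: "('g, 'b) monoid_scheme \<Rightarrow> 'g set \<Rightarrow> 'g set \<Rightarrow> 'g \<Rightarrow> nat" where
  "cox_len G S Om x =
     (LEAST n. \<exists>ss \<sigma>. set ss \<subseteq> S \<and> \<sigma> \<in> Om \<and> length ss = n \<and> x = cox_prod G ss \<otimes>\<^bsub>G\<^esub> \<sigma>)"

definition cox_suppW :: "('g, 'b) monoid_scheme \<Rightarrow> 'g set \<Rightarrow> 'g \<Rightarrow> 'g set" where
  "cox_suppW G S w = {s. \<exists>ss. set ss \<subseteq> S \<and> w = cox_prod G ss \<and>
                          length ss = cox_lenW G S w \<and> s \<in> set ss}"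

definition cox_supp :: "('g, 'b) monoid_scheme \<Rightarrow> 'g set \<Rightarrow> 'g set \<Rightarrow> 'g set \<Rightarrow> 'g \<Rightarrow> 'g set" where
  "cox_supp G W S Om x = {t. \<exists>w \<sigma> (n::nat) s. w \<in> W \<and> \<sigma> \<in> Om \<and> x = w \<otimes>\<^bsub>G\<^esub> \<sigma> \<and>
       s \<in> cox_suppW G S w \<and>
       t = (\<sigma> [^]\<^bsub>G\<^esub> n) \<otimes>\<^bsub>G\<^esub> s \<otimes>\<^bsub>G\<^esub> inv\<^bsub>G\<^esub> (\<sigma> [^]\<^bsub>G\<^esub> n)}"

definition cox_conj_class :: "('g, 'b) monoid_scheme \<Rightarrow> 'g set \<Rightarrow> 'g \<Rightarrow> 'g set" where
  "cox_conj_class G W w = {x \<otimes>\<^bsub>G\<^esub> w \<otimes>\<^bsub>G\<^esub> inv\<^bsub>G\<^esub> x | x. x \<in> W}"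

definition cox_min_length :: "('g, 'b) monoid_scheme \<Rightarrow> 'g set \<Rightarrow> 'g set \<Rightarrow> 'g set \<Rightarrow> 'g \<Rightarrow> bool" where
  "cox_min_length G W S Om w \<longleftrightarrow>
     (\<forall>y \<in> cox_conj_class G W w. cox_len G S Om w \<le> cox_len G S Om y)"

fun cox_path :: "('g, 'b) monoid_scheme \<Rightarrow> 'g set \<Rightarrow> 'g set \<Rightarrow> 'g \<Rightarrow> 'g list \<Rightarrow> bool" where
  "cox_path G S Om w [] = True"
| "cox_path G S Om w (s # ss) =
     (s \<in> S \<and> cox_len G S Om (s \<otimes>\<^bsub>G\<^esub> w \<otimes>\<^bsub>G\<^esub> s) \<le> cox_len G S Om w \<and>
      cox_path G S Om (s \<otimes>\<^bsub>G\<^esub> w \<otimes>\<^bsub>G\<^esub> s) ss)"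

definition cox_Wstab :: "('g, 'b) monoid_scheme \<Rightarrow> 'g set \<Rightarrow> 'g set \<Rightarrow> 'g set \<Rightarrow> 'g \<Rightarrow> 'g set" where
  "cox_Wstab G W S Om w =
     {x \<in> W. cox_len G S Om (inv\<^bsub>G\<^esub> x \<otimes>\<^bsub>G\<^esub> w \<otimes>\<^bsub>G\<^esub> x) = cox_len G S Om w}"

definition cox_nice :: "('g, 'b) monoid_scheme \<Rightarrow> 'g set \<Rightarrow> 'g set \<Rightarrow> 'g set \<Rightarrow> 'g set \<Rightarrow> bool" where
  "cox_nice G W S Om Cl \<longleftrightarrow>
     (\<exists>w \<in> Cl. cox_min_length G W S Om w \<and>
        (\<forall>x \<in> cox_Wstab G W S Om w. \<exists>ss. cox_path G S Om w ss \<and> x = cox_prod G ss))"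

text \<open>J is a union of connected components of the Coxeter diagram of S:
no edge (s,t with st <> ts, i.e. m(s,t) >= 3) joins J to S - J.\<close>
definition cox_union_components :: "('g, 'b) monoid_scheme \<Rightarrow> 'g set \<Rightarrow> 'g set \<Rightarrow> bool" where
  "cox_union_components G S J \<longleftrightarrow> J \<subseteq> S \<and>
     (\<forall>s\<in>J. \<forall>t\<in>S - J. s \<otimes>\<^bsub>G\<^esub> t = t \<otimes>\<^bsub>G\<^esub> s)"

definition cox_weakly_elliptic :: "('g, 'b) monoid_scheme \<Rightarrow> 'g set \<Rightarrow> 'g set \<Rightarrow> 'g set \<Rightarrow> 'g set \<Rightarrow> bool" where
  "cox_weakly_elliptic G W S Om Cl \<longleftrightarrow>
     (\<forall>w \<in> Cl. cox_union_components G S (cox_supp G W S Om w) \<and>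
        (\<forall>s \<in> S - cox_supp G W S Om w. w \<otimes>\<^bsub>G\<^esub> s = s \<otimes>\<^bsub>G\<^esub> w))"

end

theory Submission
  imports Defs "HOL-Analysis.Analysis" "HOL-Algebra.Multiplicative_Group"
begin

text \<open>
  View \<open>x\<close> in \<open>W\<close> as the chamber \<open>x C\<close> of the reflection arrangement, and let an element \<open>w\<close> of the
  class act as an isometry. The length of \<open>x\<inverse> w x\<close> is the displacement \<open>d (x C, w x C)\<close>, and paths from
  \<open>w\<close> are galleries along which the displacement does not increase. So the class is nice iff the
  chambers of minimal displacement are connected by galleries.

  If \<open>w\<close> has no nonzero fixed vector, connectedness holds for every finite arrangement preserved by
  \<open>w\<close> (He and Nie's geometric argument). Put \<open>T = w + w\<inverse>\<close>. Crossing a wall with normal \<open>\<alpha>\<close> at a point \<open>p\<close>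
  can increase the displacement only if \<open>(T p, \<alpha>) < 0\<close>, so moving towards larger values of the Rayleigh
  quotient of \<open>T\<close> never increases it, and every chamber reaches one whose closure contains a given top
  eigenvector \<open>q\<close> of \<open>T\<close>. Among the chambers at \<open>q\<close> the displacement differs by a constant from that
  of the smaller arrangement of hyperplanes containing \<open>q\<close> and \<open>w q\<close>, and induction applies.

  Conversely, let \<open>J\<close> be a support of minimal size in the class. Along a path a letter outside
  \<open>J\<close> must commute with everything involved. Conjugation by the longest element preserves length, so
  if the class is nice, the longest element is a product of such letters and letters of \<open>J\<close>; as its
  support is \<open>S\<close>, the class is weakly elliptic.
\<close>

subsection \<open>Isometries preserving a hyperplane arrangement\<close>

text \<open>The geometric argument needs an isometry without fixed vectors, and a weakly elliptic
  class supplies one: all its members have the same support \<open>J\<close>, so inside the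
  parabolic subgroup of \<open>J\<close> no conjugate lies in a smaller sigma-stable parabolic,
  whereas a fixed vector, moved into the dominant chamber, would produce such a conjugate. Letters
  outside \<open>J\<close> only give moves that leave the element unchanged. Fixed vectors are the
  obstacle at one point. Having reached a top eigenvector \<open>p\<close>, one travels to the
  target \<open>q\<close> along a ray, and the local arrangements on the way are smaller only if the
  ray avoids the origin. If \<open>p\<close> is opposite to \<open>q\<close>, the way leads through
  \<open>w p\<close>, which must be neither \<open>p\<close> nor \<open>- p\<close>; the second case
  is \<open>w = -1\<close>, where every gallery is allowed. On the group side only the exchange
  condition is given. The reflection representation, its well-definedness (Matsumoto's argument) and
  the signs of roots are therefore derived from it. An invariant inner product comes from recording
  all translates of a vector, which avoids discussing the definiteness of the form defined by the
  cosines.\<close>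

lemma lex_perturbation:
  fixes a b :: "'v::real_inner"
  assumes "finite \<Phi>" "0 < \<delta>"
  obtains \<epsilon> where "0 < \<epsilon>" "\<epsilon> < \<delta>" and "\<And>\<alpha>. \<alpha> \<in> \<Phi> \<Longrightarrow>
    0 < (a + \<epsilon> *\<^sub>R b) \<bullet> \<alpha> \<longleftrightarrow> 0 < a \<bullet> \<alpha> \<or> a \<bullet> \<alpha> = 0 \<and> 0 < b \<bullet> \<alpha>"
    and "\<And>\<alpha>. \<alpha> \<in> \<Phi> \<Longrightarrow>
    (a + \<epsilon> *\<^sub>R b) \<bullet> \<alpha> < 0 \<longleftrightarrow> a \<bullet> \<alpha> < 0 \<or> a \<bullet> \<alpha> = 0 \<and> b \<bullet> \<alpha> < 0"
proof -
  have "\<forall>\<alpha>\<in>\<Phi>. \<forall>\<^sub>F \<epsilon> in at_right 0.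
    (0 < (a + \<epsilon> *\<^sub>R b) \<bullet> \<alpha> \<longleftrightarrow> 0 < a \<bullet> \<alpha> \<or> a \<bullet> \<alpha> = 0 \<and> 0 < b \<bullet> \<alpha>) \<and>
    ((a + \<epsilon> *\<^sub>R b) \<bullet> \<alpha> < 0 \<longleftrightarrow> a \<bullet> \<alpha> < 0 \<or> a \<bullet> \<alpha> = 0 \<and> b \<bullet> \<alpha> < 0)"
  proof
    fix \<alpha> assume "\<alpha> \<in> \<Phi>"
    have lim: "((\<lambda>\<epsilon>. (a + \<epsilon> *\<^sub>R b) \<bullet> \<alpha>) \<longlongrightarrow> (a + 0 *\<^sub>R b) \<bullet> \<alpha>) (at_right 0)"
      by (intro tendsto_intros)
    consider "0 < a \<bullet> \<alpha>" | "a \<bullet> \<alpha> < 0" | "a \<bullet> \<alpha> = 0" by linarith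
    then show "\<forall>\<^sub>F \<epsilon> in at_right 0.
      (0 < (a + \<epsilon> *\<^sub>R b) \<bullet> \<alpha> \<longleftrightarrow> 0 < a \<bullet> \<alpha> \<or> a \<bullet> \<alpha> = 0 \<and> 0 < b \<bullet> \<alpha>) \<and>
      ((a + \<epsilon> *\<^sub>R b) \<bullet> \<alpha> < 0 \<longleftrightarrow> a \<bullet> \<alpha> < 0 \<or> a \<bullet> \<alpha> = 0 \<and> b \<bullet> \<alpha> < 0)"
    proof cases
      case 1
      with order_tendstoD(1)[OF lim, of 0] show ?thesis
        by (auto elim!: eventually_mono)
    next
      case 2
      with order_tendstoD(2)[OF lim, of 0] show ?thesis
        by (auto elim!: eventually_mono)
    next
      case 3
      show ?thesis
        using eventually_at_right_less[of "0::real"]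
        by eventually_elim
          (use 3 in \<open>auto simp: inner_add_left zero_less_mult_iff mult_less_0_iff\<close>)
    qed
  qed
  then have "\<forall>\<^sub>F \<epsilon> in at_right 0. \<forall>\<alpha>\<in>\<Phi>.
    (0 < (a + \<epsilon> *\<^sub>R b) \<bullet> \<alpha> \<longleftrightarrow> 0 < a \<bullet> \<alpha> \<or> a \<bullet> \<alpha> = 0 \<and> 0 < b \<bullet> \<alpha>) \<and>
    ((a + \<epsilon> *\<^sub>R b) \<bullet> \<alpha> < 0 \<longleftrightarrow> a \<bullet> \<alpha> < 0 \<or> a \<bullet> \<alpha> = 0 \<and> b \<bullet> \<alpha> < 0)"
    by (simp only: eventually_ball_finite_distrib[OF assms(1)])
  then obtain e where e: "e > 0" "\<And>\<epsilon>. 0 < \<epsilon> \<Longrightarrow> \<epsilon> < e \<Longrightarrow> \<forall>\<alpha>\<in>\<Phi>.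
    (0 < (a + \<epsilon> *\<^sub>R b) \<bullet> \<alpha> \<longleftrightarrow> 0 < a \<bullet> \<alpha> \<or> a \<bullet> \<alpha> = 0 \<and> 0 < b \<bullet> \<alpha>) \<and>
    ((a + \<epsilon> *\<^sub>R b) \<bullet> \<alpha> < 0 \<longleftrightarrow> a \<bullet> \<alpha> < 0 \<or> a \<bullet> \<alpha> = 0 \<and> b \<bullet> \<alpha> < 0)"
    unfolding eventually_at_right_field by blast
  define \<epsilon> where "\<epsilon> = min e \<delta> / 2"
  have \<epsilon>: "0 < \<epsilon>" "\<epsilon> < e" "\<epsilon> < \<delta>" using e(1) assms(2) by (auto simp: \<epsilon>_def)
  show ?thesis using that[OF \<epsilon>(1,3)] e(2)[OF \<epsilon>(1,2)] by auto
qed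

text \<open>A vector that avoids the earlier hyperplanes is pushed off the new one by a small
  multiple of its normal \<open>\<gamma>\<close>, since
  \<open>\<gamma> \<bullet> \<gamma> > 0\<close>; smallness preserves the signs already
  achieved.\<close>

lemma generic_vector:
  fixes \<Gamma> :: "'v::real_inner set"
  assumes "finite \<Gamma>" "0 \<notin> \<Gamma>"
  shows "\<exists>u. \<forall>\<gamma>\<in>\<Gamma>. u \<bullet> \<gamma> \<noteq> 0"
  using assms
proof (induction rule: finite_induct)
  case (insert \<gamma> \<Gamma>)
  then obtain u where u: "\<forall>\<gamma>\<in>\<Gamma>. u \<bullet> \<gamma> \<noteq> 0" by auto
  obtain \<epsilon> where e: "0 < \<epsilon>" "\<epsilon> < 1" "\<And>\<alpha>. \<alpha> \<in> insert \<gamma> \<Gamma> \<Longrightarrow>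
    0 < (u + \<epsilon> *\<^sub>R \<gamma>) \<bullet> \<alpha> \<longleftrightarrow> 0 < u \<bullet> \<alpha> \<or> u \<bullet> \<alpha> = 0 \<and> 0 < \<gamma> \<bullet> \<alpha>"
    "\<And>\<alpha>. \<alpha> \<in> insert \<gamma> \<Gamma> \<Longrightarrow>
    (u + \<epsilon> *\<^sub>R \<gamma>) \<bullet> \<alpha> < 0 \<longleftrightarrow> u \<bullet> \<alpha> < 0 \<or> u \<bullet> \<alpha> = 0 \<and> \<gamma> \<bullet> \<alpha> < 0"
    using lex_perturbation[of "insert \<gamma> \<Gamma>" 1 u \<gamma>] insert.hyps by auto
  have g: "\<gamma> \<bullet> \<gamma> > 0" using insert.prems by simp
  have "(u + \<epsilon> *\<^sub>R \<gamma>) \<bullet> \<alpha> \<noteq> 0" if a: "\<alpha> \<in> insert \<gamma> \<Gamma>" for \<alpha>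
  proof
    assume "(u + \<epsilon> *\<^sub>R \<gamma>) \<bullet> \<alpha> = 0"
    with e(3,4)[OF a] have "u \<bullet> \<alpha> = 0" "\<gamma> \<bullet> \<alpha> = 0" by linarith+
    with u a g show False by auto
  qed
  then show ?case by blast
qed auto

lemma finite_real_gap:
  fixes a :: real
  assumes "finite A" "\<And>b. b \<in> A \<Longrightarrow> a < b"
  shows "\<exists>r>a. \<forall>b\<in>A. r < b"
proof (cases "A = {}")
  case True
  then show ?thesis by (auto intro: exI[of _ "a + 1"])
next
  case False
  then have "a < Min A" using assms by simp
  then obtain r where "a < r" "r < Min A" using dense by blast
  then show ?thesis using assms(1) False by auto
qed

section \<open>Chambers and galleries of a hyperplane arrangement\<close>

definition regular :: "'v::real_inner set \<Rightarrow> 'v \<Rightarrow> bool" where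
  "regular \<Phi> c \<longleftrightarrow> (\<forall>\<alpha>\<in>\<Phi>. c \<bullet> \<alpha> \<noteq> 0)"

text \<open>Normals come in opposite pairs. Taking the one that is positive at \<open>d\<close>
  selects one normal per separating hyperplane, so the cardinality is the gallery distance.\<close>

definition sep :: "'v::real_inner set \<Rightarrow> 'v \<Rightarrow> 'v \<Rightarrow> 'v set" where
  "sep \<Phi> c d = {\<alpha>\<in>\<Phi>. c \<bullet> \<alpha> < 0 \<and> 0 < d \<bullet> \<alpha>}"

text \<open>Chambers are represented by regular points. With normals closed under negation this says
  that \<open>p\<close> lies in the closure of the chamber of \<open>c\<close>: no hyperplane
  separates the two strictly.\<close>

definition in_closure :: "'v::real_inner set \<Rightarrow> 'v \<Rightarrow> 'v \<Rightarrow> bool" where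
  "in_closure \<Phi> c p \<longleftrightarrow> (\<forall>\<alpha>\<in>\<Phi>. 0 < p \<bullet> \<alpha> \<longrightarrow> 0 < c \<bullet> \<alpha>)"

definition same_side :: "'v::real_inner set \<Rightarrow> 'v \<Rightarrow> 'v \<Rightarrow> bool" where
  "same_side \<Phi> c d \<longleftrightarrow> (\<forall>\<alpha>\<in>\<Phi>. 0 < c \<bullet> \<alpha> \<longleftrightarrow> 0 < d \<bullet> \<alpha>)"

text \<open>The trace of lying on a minimal gallery from \<open>c\<close> to \<open>d\<close>: such
  a gallery never leaves a half-space that contains both ends.\<close>

definition interposed :: "'v::real_inner set \<Rightarrow> 'v \<Rightarrow> 'v \<Rightarrow> 'v \<Rightarrow> bool" where
  "interposed \<Phi> c d x \<longleftrightarrow> (\<forall>\<alpha>\<in>\<Phi>. 0 < c \<bullet> \<alpha> \<and> 0 < d \<bullet> \<alpha> \<longrightarrow> 0 < x \<bullet> \<alpha>)"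

text \<open>The last clause leaves exactly two normals per hyperplane, so that counting normals
  counts hyperplanes.\<close>

definition symmetric_arrangement :: "'v::real_inner set \<Rightarrow> bool" where
  "symmetric_arrangement \<Phi> \<longleftrightarrow> finite \<Phi> \<and> 0 \<notin> \<Phi> \<and> (\<forall>\<alpha>\<in>\<Phi>. - \<alpha> \<in> \<Phi>) \<and>
     (\<forall>\<alpha>\<in>\<Phi>. \<forall>\<beta>\<in>\<Phi>. \<forall>k. \<alpha> = k *\<^sub>R \<beta> \<longrightarrow> \<alpha> = \<beta> \<or> \<alpha> = - \<beta>)"

lemma same_sideI:
  assumes "symmetric_arrangement \<Phi>" "regular \<Phi> c" "regular \<Phi> d" "sep \<Phi> c d = {}"
  shows "same_side \<Phi> c d"
  unfolding same_side_def
proof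
  fix \<alpha> assume a: "\<alpha> \<in> \<Phi>"
  then have "- \<alpha> \<in> \<Phi>" using assms(1) unfolding symmetric_arrangement_def by blast
  moreover have "\<alpha> \<notin> sep \<Phi> c d" "- \<alpha> \<notin> sep \<Phi> c d" using assms(4) by auto
  ultimately show "0 < c \<bullet> \<alpha> \<longleftrightarrow> 0 < d \<bullet> \<alpha>"
    using a assms(2,3) unfolding sep_def regular_def by (auto simp: less_le)
qed

text \<open>Walk along the segment from \<open>c\<close> to \<open>d\<close>. Several hyperplanes
  could be met at the same moment, so the start is first replaced by a generic point
  \<open>c'\<close> of the same chamber; then they are met one at a time, and \<open>y\<close> is a
  point just behind the first one.\<close>

lemma first_crossing:
  assumes arr: "symmetric_arrangement \<Phi>" and c: "regular \<Phi> c" and d: "regular \<Phi> d"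
    and ne: "sep \<Phi> c d \<noteq> {}"
  obtains c' y \<alpha> where "regular \<Phi> c'" "same_side \<Phi> c c'" "regular \<Phi> y"
    "\<alpha> \<in> sep \<Phi> c d" "sep \<Phi> c' y = {\<alpha>}" "sep \<Phi> y d = sep \<Phi> c d - {\<alpha>}"
    "interposed \<Phi> c d y"
proof -
  have fin: "finite \<Phi>" and sym: "\<And>\<alpha>. \<alpha> \<in> \<Phi> \<Longrightarrow> - \<alpha> \<in> \<Phi>"
    and par: "\<And>\<alpha> \<beta> k. \<alpha> \<in> \<Phi> \<Longrightarrow> \<beta> \<in> \<Phi> \<Longrightarrow> \<alpha> = k *\<^sub>R \<beta> \<Longrightarrow> \<alpha> = \<beta> \<or> \<alpha> = - \<beta>"
    using arr unfolding symmetric_arrangement_def by blast+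
  \<comment> \<open>The product of \<open>c'\<close> with \<open>g (\<alpha>, \<beta>)\<close>
    vanishes exactly when the hyperplanes of \<open>\<alpha>\<close> and \<open>\<beta>\<close> are
    met at the same parameter.\<close>
  define g where "g = (\<lambda>(\<alpha>,\<beta>). (d \<bullet> \<beta>) *\<^sub>R \<alpha> - (d \<bullet> \<alpha>) *\<^sub>R \<beta>)"
  define \<Gamma> where "\<Gamma> = g ` {(\<alpha>,\<beta>). \<alpha> \<in> \<Phi> \<and> \<beta> \<in> \<Phi> \<and> \<alpha> \<noteq> \<beta> \<and> \<alpha> \<noteq> - \<beta>}"
  have "finite \<Gamma>" unfolding \<Gamma>_def
    by (rule finite_imageI, rule finite_subset[of _ "\<Phi> \<times> \<Phi>"]) (use fin in auto)
  moreover have "0 \<notin> \<Gamma>"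
  proof
    assume "0 \<in> \<Gamma>"
    then obtain \<alpha> \<beta> where ab: "\<alpha> \<in> \<Phi>" "\<beta> \<in> \<Phi>" "\<alpha> \<noteq> \<beta>" "\<alpha> \<noteq> - \<beta>"
      and "(d \<bullet> \<beta>) *\<^sub>R \<alpha> = (d \<bullet> \<alpha>) *\<^sub>R \<beta>" by (auto simp: \<Gamma>_def g_def)
    then have "(1 / (d \<bullet> \<beta>)) *\<^sub>R ((d \<bullet> \<beta>) *\<^sub>R \<alpha>) = (1 / (d \<bullet> \<beta>)) *\<^sub>R ((d \<bullet> \<alpha>) *\<^sub>R \<beta>)" by simp
    then have "\<alpha> = (d \<bullet> \<alpha> / (d \<bullet> \<beta>)) *\<^sub>R \<beta>"
      using d ab unfolding regular_def by simp
    with par ab show False by blast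
  qed
  ultimately obtain u where u: "\<forall>\<gamma>\<in>\<Gamma>. u \<bullet> \<gamma> \<noteq> 0" using generic_vector by blast
  obtain \<epsilon> where e: "0 < \<epsilon>" "\<epsilon> < 1" "\<And>\<alpha>. \<alpha> \<in> \<Phi> \<union> \<Gamma> \<Longrightarrow>
    0 < (c + \<epsilon> *\<^sub>R u) \<bullet> \<alpha> \<longleftrightarrow> 0 < c \<bullet> \<alpha> \<or> c \<bullet> \<alpha> = 0 \<and> 0 < u \<bullet> \<alpha>"
    "\<And>\<alpha>. \<alpha> \<in> \<Phi> \<union> \<Gamma> \<Longrightarrow>
    (c + \<epsilon> *\<^sub>R u) \<bullet> \<alpha> < 0 \<longleftrightarrow> c \<bullet> \<alpha> < 0 \<or> c \<bullet> \<alpha> = 0 \<and> u \<bullet> \<alpha> < 0"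
    using lex_perturbation[of "\<Phi> \<union> \<Gamma>" 1 c u] fin \<open>finite \<Gamma>\<close> by auto
  define c' where "c' = c + \<epsilon> *\<^sub>R u"
  have c'\<Phi>: "0 < c' \<bullet> \<alpha> \<longleftrightarrow> 0 < c \<bullet> \<alpha>" "c' \<bullet> \<alpha> < 0 \<longleftrightarrow> c \<bullet> \<alpha> < 0" if "\<alpha> \<in> \<Phi>" for \<alpha>
    using e(3,4)[of \<alpha>] that c unfolding c'_def regular_def by auto
  have c'\<Gamma>: "c' \<bullet> \<gamma> \<noteq> 0" if "\<gamma> \<in> \<Gamma>" for \<gamma>
  proof
    assume "c' \<bullet> \<gamma> = 0"
    with e(3,4)[of \<gamma>] that have "c \<bullet> \<gamma> = 0" "u \<bullet> \<gamma> = 0" unfolding c'_def by (auto simp: not_less)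
    with u that show False by auto
  qed
  have regc': "regular \<Phi> c'"
    unfolding regular_def
  proof
    fix \<alpha> assume "\<alpha> \<in> \<Phi>"
    then show "c' \<bullet> \<alpha> \<noteq> 0" using c'\<Phi>[of \<alpha>] c unfolding regular_def by (auto simp: neq_iff)
  qed
  have sepeq: "sep \<Phi> c' d = sep \<Phi> c d" unfolding sep_def using c'\<Phi> by auto
  define r where "r \<alpha> = - (c' \<bullet> \<alpha>) / (d \<bullet> \<alpha>)" for \<alpha>
  have finsep: "finite (sep \<Phi> c d)" unfolding sep_def using fin by simp
  define \<alpha> where "\<alpha> = arg_min_on r (sep \<Phi> c d)"
  have \<alpha>: "\<alpha> \<in> sep \<Phi> c d" using finsep ne unfolding \<alpha>_def by (rule arg_min_if_finite(1))
  have le: "r \<alpha> \<le> r \<beta>" if "\<beta> \<in> sep \<Phi> c d" for \<beta>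
    unfolding \<alpha>_def by (rule arg_min_least[OF finsep ne that])
  have lt: "r \<alpha> < r \<beta>" if b: "\<beta> \<in> sep \<Phi> c d - {\<alpha>}" for \<beta>
  proof (rule ccontr)
    assume "\<not> r \<alpha> < r \<beta>"
    then have "r \<alpha> = r \<beta>" using le[of \<beta>] b by auto
    moreover have pos: "0 < d \<bullet> \<alpha>" "0 < d \<bullet> \<beta>" "\<alpha> \<in> \<Phi>" "\<beta> \<in> \<Phi>" "\<alpha> \<noteq> \<beta>" using \<alpha> b unfolding sep_def by auto
    ultimately have "c' \<bullet> g (\<alpha>,\<beta>) = 0"
      unfolding r_def g_def by (simp add: inner_diff_right field_simps)
    moreover have "\<alpha> \<noteq> - \<beta>" using pos by auto
    ultimately show False using c'\<Gamma> pos unfolding \<Gamma>_def by blast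
  qed
  have "\<exists>q>r \<alpha>. \<forall>b\<in>r ` (sep \<Phi> c d - {\<alpha>}). q < b"
    by (rule finite_real_gap) (use finsep lt in auto)
  then obtain q where q: "r \<alpha> < q" "\<And>\<beta>. \<beta> \<in> sep \<Phi> c d - {\<alpha>} \<Longrightarrow> q < r \<beta>" by auto
  have "0 < r \<alpha>" using \<alpha> c'\<Phi> unfolding r_def sep_def by (simp add: divide_neg_pos)
  then have q0: "q > 0" using q by linarith
  define y where "y = c' + q *\<^sub>R d"
  have y_sep: "0 < y \<bullet> \<beta> \<longleftrightarrow> \<beta> = \<alpha>" "y \<bullet> \<beta> < 0 \<longleftrightarrow> \<beta> \<noteq> \<alpha>" if b: "\<beta> \<in> sep \<Phi> c d" for \<beta>
  proof -
    have dp: "0 < d \<bullet> \<beta>" using b unfolding sep_def by auto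
    then have eq: "y \<bullet> \<beta> = (q - r \<beta>) * (d \<bullet> \<beta>)" unfolding y_def r_def by (simp add: inner_add_left field_simps)
    show "0 < y \<bullet> \<beta> \<longleftrightarrow> \<beta> = \<alpha>" using q b dp unfolding eq by (force simp: zero_less_mult_iff)
    show "y \<bullet> \<beta> < 0 \<longleftrightarrow> \<beta> \<noteq> \<alpha>" using q b dp unfolding eq by (force simp: mult_less_0_iff)
  qed
  have y_pos: "0 < y \<bullet> \<beta>" if "\<beta> \<in> \<Phi>" "0 < c \<bullet> \<beta>" "0 < d \<bullet> \<beta>" for \<beta>
    using that q0 c'\<Phi> unfolding y_def by (simp add: inner_add_left add_pos_pos)
  have y_neg: "y \<bullet> \<beta> < 0" if "\<beta> \<in> \<Phi>" "c \<bullet> \<beta> < 0" "d \<bullet> \<beta> < 0" for \<beta>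
    using y_pos[of "-\<beta>"] that sym by auto
  have y_sep': "0 < y \<bullet> \<beta> \<longleftrightarrow> \<beta> \<noteq> - \<alpha>" "y \<bullet> \<beta> < 0 \<longleftrightarrow> \<beta> = - \<alpha>" if b: "\<beta> \<in> \<Phi>" "0 < c \<bullet> \<beta>" "d \<bullet> \<beta> < 0" for \<beta>
  proof -
    have "- \<beta> \<in> sep \<Phi> c d" using b sym unfolding sep_def by auto
    from y_sep[OF this] show "0 < y \<bullet> \<beta> \<longleftrightarrow> \<beta> \<noteq> - \<alpha>" "y \<bullet> \<beta> < 0 \<longleftrightarrow> \<beta> = - \<alpha>" by auto
  qed
  have cases: "(c \<bullet> \<beta> < 0 \<and> d \<bullet> \<beta> < 0) \<or> (0 < c \<bullet> \<beta> \<and> 0 < d \<bullet> \<beta>) \<or> \<beta> \<in> sep \<Phi> c d \<or> (0 < c \<bullet> \<beta> \<and> d \<bullet> \<beta> < 0)"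
    if "\<beta> \<in> \<Phi>" for \<beta> using that c d unfolding regular_def sep_def by (auto simp: not_less less_le)
  have regy: "regular \<Phi> y"
    unfolding regular_def using cases y_sep y_pos y_neg y_sep' by (metis less_irrefl)
  have a\<Phi>: "\<alpha> \<in> \<Phi>" "c \<bullet> \<alpha> < 0" "0 < d \<bullet> \<alpha>" using \<alpha> unfolding sep_def by auto
  have "sep \<Phi> c' y = {\<alpha>}"
  proof (intro equalityI subsetI)
    fix \<beta> assume "\<beta> \<in> sep \<Phi> c' y"
    then have b: "\<beta> \<in> \<Phi>" "c \<bullet> \<beta> < 0" "0 < y \<bullet> \<beta>" unfolding sep_def using c'\<Phi> by auto
    then show "\<beta> \<in> {\<alpha>}" using cases[OF b(1)] y_sep y_neg by force
  next
    fix \<beta> assume "\<beta> \<in> {\<alpha>}"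
    then show "\<beta> \<in> sep \<Phi> c' y" using \<alpha> y_sep[OF \<alpha>] a\<Phi> c'\<Phi> unfolding sep_def by auto
  qed
  moreover have "sep \<Phi> y d = sep \<Phi> c d - {\<alpha>}"
  proof (intro equalityI subsetI)
    fix \<beta> assume "\<beta> \<in> sep \<Phi> y d"
    then have b: "\<beta> \<in> \<Phi>" "y \<bullet> \<beta> < 0" "0 < d \<bullet> \<beta>" unfolding sep_def by auto
    then show "\<beta> \<in> sep \<Phi> c d - {\<alpha>}" using cases[OF b(1)] y_sep y_pos by force
  next
    fix \<beta> assume "\<beta> \<in> sep \<Phi> c d - {\<alpha>}"
    then show "\<beta> \<in> sep \<Phi> y d" using y_sep unfolding sep_def by auto
  qed
  moreover have "interposed \<Phi> c d y" unfolding interposed_def using y_pos by auto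
  moreover have "same_side \<Phi> c c'" unfolding same_side_def using c'\<Phi> by auto
  ultimately show ?thesis using that regc' regy \<alpha> by blast
qed

text \<open>The induction follows a minimal gallery. Hence every hyperplane crossed separates the
  two ends and every point met is interposed between them; these facts are what later decides
  whether a crossing is allowed.\<close>

lemma gallery_induct:
  assumes arr: "symmetric_arrangement \<Phi>" and "regular \<Phi> c" and d: "regular \<Phi> d"
    and same: "\<And>x y. \<lbrakk>regular \<Phi> x; regular \<Phi> y; interposed \<Phi> c d x; interposed \<Phi> c d y; same_side \<Phi> x y\<rbrakk> \<Longrightarrow> R x y"
    and cross: "\<And>x y \<alpha>. \<lbrakk>regular \<Phi> x; regular \<Phi> y; interposed \<Phi> c d x; interposed \<Phi> c d y;
        \<alpha> \<in> sep \<Phi> c d; sep \<Phi> x y = {\<alpha>}\<rbrakk> \<Longrightarrow> R x y"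
  shows "R\<^sup>*\<^sup>* c d"
  using assms(2) same cross
proof (induction "card (sep \<Phi> c d)" arbitrary: c rule: less_induct)
  case less
  have fin: "finite \<Phi>" using arr unfolding symmetric_arrangement_def by blast
  show ?case
  proof (cases "sep \<Phi> c d = {}")
    case True
    have "same_side \<Phi> c d" by (rule same_sideI[OF arr less.prems(1) d True])
    then have "R c d" using less.prems(1) d by (intro less.prems(2)) (auto simp: interposed_def)
    then show ?thesis by blast
  next
    case False
    obtain c' y \<alpha> where o: "regular \<Phi> c'" "same_side \<Phi> c c'" "regular \<Phi> y"
      "\<alpha> \<in> sep \<Phi> c d" "sep \<Phi> c' y = {\<alpha>}" "sep \<Phi> y d = sep \<Phi> c d - {\<alpha>}" "interposed \<Phi> c d y"
      using first_crossing[OF arr less.prems(1) d False] by metis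
    have bc': "interposed \<Phi> c d c'" "interposed \<Phi> c d c" using o(2) unfolding same_side_def interposed_def by auto
    have "R c c'" using less.prems(1) o bc' by (intro less.prems(2)) auto
    moreover have "R c' y" using o bc' by (intro less.prems(3)) auto
    moreover have "R\<^sup>*\<^sup>* y d"
    proof (rule less.hyps)
      show "card (sep \<Phi> y d) < card (sep \<Phi> c d)" using o(4,6) fin
        by (metis (no_types, lifting) card_Diff1_less finite_subset mem_Collect_eq sep_def subsetI)
      have mono: "interposed \<Phi> c d x" if "interposed \<Phi> y d x" for x
        using that o(7) unfolding interposed_def by blast
      show "R x z" if "regular \<Phi> x" "regular \<Phi> z" "interposed \<Phi> y d x" "interposed \<Phi> y d z" "same_side \<Phi> x z" for x z
        using that mono less.prems(2) by blast
      show "R x z" if "regular \<Phi> x" "regular \<Phi> z" "interposed \<Phi> y d x" "interposed \<Phi> y d z"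
        "\<beta> \<in> sep \<Phi> y d" "sep \<Phi> x z = {\<beta>}" for x z \<beta>
        using that mono less.prems(3) o(6) by blast
    qed (rule o(3))
    ultimately show ?thesis by (meson converse_rtranclp_into_rtranclp)
  qed
qed

lemma lex_point:
  fixes a b :: "'v::real_inner"
  assumes "finite \<Phi>"
  shows "\<exists>d. \<forall>\<alpha>\<in>\<Phi>. (0 < d \<bullet> \<alpha> \<longleftrightarrow> 0 < a \<bullet> \<alpha> \<or> a \<bullet> \<alpha> = 0 \<and> 0 < b \<bullet> \<alpha>) \<and>
    (d \<bullet> \<alpha> < 0 \<longleftrightarrow> a \<bullet> \<alpha> < 0 \<or> a \<bullet> \<alpha> = 0 \<and> b \<bullet> \<alpha> < 0)"
proof -
  obtain \<epsilon> where "0 < \<epsilon>" "\<epsilon> < 1" "\<And>\<alpha>. \<alpha> \<in> \<Phi> \<Longrightarrow>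
    0 < (a + \<epsilon> *\<^sub>R b) \<bullet> \<alpha> \<longleftrightarrow> 0 < a \<bullet> \<alpha> \<or> a \<bullet> \<alpha> = 0 \<and> 0 < b \<bullet> \<alpha>"
    "\<And>\<alpha>. \<alpha> \<in> \<Phi> \<Longrightarrow>
    (a + \<epsilon> *\<^sub>R b) \<bullet> \<alpha> < 0 \<longleftrightarrow> a \<bullet> \<alpha> < 0 \<or> a \<bullet> \<alpha> = 0 \<and> b \<bullet> \<alpha> < 0"
    using lex_perturbation[OF assms, of 1 a b] by auto
  then show ?thesis by blast
qed

section \<open>Compactness and projection in the span of a finite set\<close>

lemma compact_cball_span:
  fixes B :: "'v::real_inner set"
  assumes "finite B" "pairwise orthogonal B"
  shows "compact {x \<in> span B. norm x \<le> K}"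
  using assms
proof (induction rule: finite_induct)
  case empty
  have "{x \<in> span {}. norm x \<le> K} \<subseteq> {0::'v}" by auto
  then show ?case using finite_subset finite_imp_compact by blast
next
  case (insert b B)
  have IH: "compact {x \<in> span B. norm x \<le> K}"
    using insert by (auto simp: pairwise_insert)
  show ?case
  proof (cases "b = 0")
    case True
    then show ?thesis using IH by (simp add: span_insert_0)
  next
    case False
    have orth: "y \<bullet> b = 0" if "y \<in> span B" for y
      using that
    proof (induction rule: span_induct_alt)
      case (step c x y)
      then have "x \<bullet> b = 0" using insert.prems insert.hyps
        by (auto simp: pairwise_insert orthogonal_def)
      then show ?case using step by (simp add: inner_add_left)
    qed simp
    define f where "f = (\<lambda>(y, t). y + t *\<^sub>R b)"
    \<comment> \<open>By orthogonality both components of a vector of norm at most \<open>K\<close>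
      are bounded, so the ball is a closed part of the image of a smaller ball times an
      interval.\<close>
    have sub: "{x \<in> span (insert b B). norm x \<le> K}
      = f ` ({x \<in> span B. norm x \<le> K} \<times> {- (K / norm b)..K / norm b}) \<inter> cball 0 K"
    proof (intro equalityI subsetI)
      fix x assume x: "x \<in> {x \<in> span (insert b B). norm x \<le> K}"
      then obtain t where t: "x - t *\<^sub>R b \<in> span B" using span_breakdown_eq by blast
      define y where "y = x - t *\<^sub>R b"
      have xy: "x = y + t *\<^sub>R b" "y \<in> span B" using t by (auto simp: y_def)
      have "(norm x)\<^sup>2 = (norm y)\<^sup>2 + (t * norm b)\<^sup>2"
        unfolding xy(1) using orth[OF xy(2)]
        by (simp add: power2_norm_eq_inner power_mult_distrib inner_add inner_commute) (simp add: power2_eq_square)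
      moreover have "(norm x)\<^sup>2 \<le> K\<^sup>2" "K \<ge> 0" using x by (auto intro: order_trans[OF norm_ge_zero] power_mono)
      ultimately have "(norm y)\<^sup>2 \<le> K\<^sup>2" "(t * norm b)\<^sup>2 \<le> K\<^sup>2"
        by (smt (verit) zero_le_power2)+
      then have "norm y \<le> K" "\<bar>t * norm b\<bar> \<le> K"
        using \<open>K \<ge> 0\<close> power2_le_imp_le[of "norm y" K] abs_le_square_iff[of "t * norm b" K] by simp_all
      then have "norm y \<le> K" "\<bar>t\<bar> \<le> K / norm b" using False by (auto simp: abs_mult field_simps)
      then have "(y, t) \<in> {x \<in> span B. norm x \<le> K} \<times> {- (K / norm b)..K / norm b}"
        using xy(2) by (auto simp: abs_le_iff)
      then show "x \<in> f ` ({x \<in> span B. norm x \<le> K} \<times> {- (K / norm b)..K / norm b}) \<inter> cball 0 K"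
        using x xy(1) by (force simp: f_def)
    next
      fix x assume "x \<in> f ` ({x \<in> span B. norm x \<le> K} \<times> {- (K / norm b)..K / norm b}) \<inter> cball 0 K"
      then obtain y t where "x = y + t *\<^sub>R b" "y \<in> span B" "norm x \<le> K" by (auto simp: f_def)
      then show "x \<in> {x \<in> span (insert b B). norm x \<le> K}"
        using span_breakdown_eq[of x b B] by (auto intro!: exI[of _ t])
    qed
    have "continuous_on UNIV f" unfolding f_def case_prod_unfold by (intro continuous_intros)
    then have "compact (f ` ({x \<in> span B. norm x \<le> K} \<times> {- (K / norm b)..K / norm b}))"
      by (intro compact_continuous_image compact_Times IH compact_Icc) (auto intro: continuous_on_subset)
    then show ?thesis unfolding sub by (rule compact_Int_closed) simp
  qed
qed

text \<open>The vector space used for Coxeter groups below may be infinite dimensional, so extrema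
  are only available inside the span of finitely many normals.\<close>

lemma compact_sphere_span:
  fixes \<Phi> :: "'v::real_inner set"
  assumes "finite \<Phi>"
  shows "compact {x \<in> span \<Phi>. norm x = 1}"
proof -
  obtain C where C: "finite C" "span C = span \<Phi>" "pairwise orthogonal C"
    using basis_orthogonal[OF assms] by blast
  have "closed {x::'v. norm x = 1}" by (intro closed_Collect_eq continuous_intros)
  moreover have "{x \<in> span \<Phi>. norm x = 1} = {x \<in> span C. norm x \<le> 1} \<inter> {x. norm x = 1}"
    using C by auto
  ultimately show ?thesis using compact_Int_closed[OF compact_cball_span[OF C(1,3)]] by metis
qed

lemma orthogonal_projection_span:
  fixes \<Phi> :: "'v::real_inner set"
  assumes "finite \<Phi>"
  obtains y where "y \<in> span \<Phi>" "\<And>v. v \<in> span \<Phi> \<Longrightarrow> (x - y) \<bullet> v = 0"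
proof -
  obtain C where C: "finite C" "span C = span \<Phi>" "pairwise orthogonal C"
    using basis_orthogonal[OF assms] by blast
  define y where "y = (\<Sum>b\<in>C. (x \<bullet> b / (b \<bullet> b)) *\<^sub>R b)"
  have base: "(x - y) \<bullet> c = 0" if c: "c \<in> C" for c
  proof -
    have "y \<bullet> c = (\<Sum>b\<in>C. if b = c then x \<bullet> c else 0)"
      unfolding y_def inner_sum_left
      by (rule sum.cong) (use C(3) c in \<open>auto simp: pairwise_def orthogonal_def\<close>)
    then show ?thesis using C(1) c by (simp add: inner_diff_left)
  qed
  have "(x - y) \<bullet> v = 0" if "v \<in> span C" for v
    using that by (induction rule: span_induct_alt) (auto simp: inner_add_right base)
  moreover have "y \<in> span C" unfolding y_def by (intro span_sum span_scale span_base)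
  ultimately show ?thesis using that C(2) by metis
qed

lemma card_le_exchange:
  assumes "finite A" "x \<in> A" "B \<subseteq> insert y (A - {x})"
  shows "card B \<le> card A"
proof -
  have "card B \<le> card (insert y (A - {x}))" using assms by (intro card_mono) auto
  also have "\<dots> \<le> Suc (card (A - {x}))" using assms by (auto simp: card_insert_if)
  also have "\<dots> = card A" using assms by (simp only: card_Suc_Diff1)
  finally show ?thesis .
qed

section \<open>Displacement under an isometry that preserves the arrangement\<close>

locale isometry_pair =
  fixes w w' :: "'v::real_inner \<Rightarrow> 'v"
  assumes lin: "linear w" and lin': "linear w'"
    and inv1 [simp]: "w (w' x) = x" and inv2 [simp]: "w' (w x) = x"
    and iso: "w x \<bullet> w y = x \<bullet> y"
begin

lemma adj: "w x \<bullet> y = x \<bullet> w' y" and adj': "w' x \<bullet> y = x \<bullet> w y"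
  by (metis inv1 iso) (metis inv1 iso)

lemma w_simps [simp]: "w (- x) = - w x" "w' (- x) = - w' x"
  using lin lin' by (auto simp: linear_neg)

lemma norm_w: "norm (w x) = norm x" by (simp add: norm_eq_sqrt_inner iso)
lemma norm_w': "norm (w' x) = norm x" using norm_w[of "w' x"] by simp

text \<open>As \<open>x \<bullet> T x\<close> is twice \<open>x \<bullet> w x\<close>, a unit vector
  with a large Rayleigh quotient is moved only a short way by \<open>w\<close>. This is the
  continuous counterpart of the displacement of a chamber, and unlike \<open>w\<close> the map is
  self-adjoint.\<close>

definition T :: "'v \<Rightarrow> 'v" where "T x = w x + w' x"

lemma T_inner: "T x \<bullet> y = x \<bullet> w' y + x \<bullet> w y"
  by (simp add: T_def inner_add_left adj adj')

lemma T_adj: "T x \<bullet> y = x \<bullet> T y"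
  by (simp add: T_inner) (simp add: T_def inner_add_right)

lemma linear_T: "linear T"
  unfolding T_def using lin lin' by (rule linear_compose_add)

lemma continuous_T: "continuous_on A T"
proof -
  have "bounded_linear w" "bounded_linear w'"
    using lin lin' norm_w norm_w'
    by (auto intro!: bounded_linear_intro[where K = 1] simp: linear_add linear_scale)
  then show ?thesis unfolding T_def
    by (intro continuous_intros linear_continuous_on)
qed

definition arr :: "'v set \<Rightarrow> bool" where
  "arr \<Phi> \<longleftrightarrow> symmetric_arrangement \<Phi> \<and> (\<forall>\<alpha>\<in>\<Phi>. w \<alpha> \<in> \<Phi> \<and> w' \<alpha> \<in> \<Phi>)"

lemma arrD:
  assumes "arr \<Phi>"
  shows "symmetric_arrangement \<Phi>" "finite \<Phi>" "0 \<notin> \<Phi>" "\<And>\<alpha>. \<alpha> \<in> \<Phi> \<Longrightarrow> - \<alpha> \<in> \<Phi>"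
    "\<And>\<alpha>. \<alpha> \<in> \<Phi> \<Longrightarrow> w \<alpha> \<in> \<Phi>" "\<And>\<alpha>. \<alpha> \<in> \<Phi> \<Longrightarrow> w' \<alpha> \<in> \<Phi>"
  using assms unfolding arr_def symmetric_arrangement_def by blast+

text \<open>As \<open>c \<bullet> w' \<alpha> = w c \<bullet> \<alpha>\<close>, this counts the hyperplanes separating \<open>c\<close> from \<open>w c\<close>.\<close>
definition disp :: "'v set \<Rightarrow> 'v \<Rightarrow> nat" where
  "disp \<Phi> c = card {\<alpha>\<in>\<Phi>. 0 < c \<bullet> \<alpha> \<and> c \<bullet> w' \<alpha> < 0}"

text \<open>An empty \<open>sep\<close> is permitted: such a step changes only the representative of
  a chamber.\<close>

definition step :: "'v set \<Rightarrow> 'v \<Rightarrow> 'v \<Rightarrow> bool" where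
  "step \<Phi> c d \<longleftrightarrow> regular \<Phi> c \<and> regular \<Phi> d \<and> card (sep \<Phi> c d) \<le> 1 \<and> disp \<Phi> d \<le> disp \<Phi> c"

lemma disp_cong:
  assumes "arr \<Phi>" "regular \<Phi> c" "regular \<Phi> d" "same_side \<Phi> c d"
  shows "disp \<Phi> c = disp \<Phi> d"
proof -
  have "{\<alpha>\<in>\<Phi>. 0 < c \<bullet> \<alpha> \<and> c \<bullet> w' \<alpha> < 0} = {\<alpha>\<in>\<Phi>. 0 < d \<bullet> \<alpha> \<and> d \<bullet> w' \<alpha> < 0}"
  proof (intro Collect_cong conj_cong refl)
    fix \<alpha> assume a: "\<alpha> \<in> \<Phi>"
    show "0 < c \<bullet> \<alpha> \<longleftrightarrow> 0 < d \<bullet> \<alpha>" using assms(4) a unfolding same_side_def by blast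
    have "w' \<alpha> \<in> \<Phi>" using arrD(6)[OF assms(1) a] .
    then have "0 < c \<bullet> w' \<alpha> \<longleftrightarrow> 0 < d \<bullet> w' \<alpha>" "c \<bullet> w' \<alpha> \<noteq> 0" "d \<bullet> w' \<alpha> \<noteq> 0"
      using assms(2-4) unfolding same_side_def regular_def by blast+
    then show "c \<bullet> w' \<alpha> < 0 \<longleftrightarrow> d \<bullet> w' \<alpha> < 0" by linarith
  qed
  then show ?thesis unfolding disp_def by simp
qed

lemma step_same_side:
  assumes "arr \<Phi>" "regular \<Phi> c" "regular \<Phi> d" "same_side \<Phi> c d"
  shows "step \<Phi> c d"
proof -
  have "sep \<Phi> c d = {}" using assms(2,4) unfolding sep_def same_side_def by auto
  then show ?thesis unfolding step_def using assms disp_cong[OF assms] by simp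
qed

text \<open>Crossing changes only the signs of \<open>\<alpha>\<close> and
  \<open>- \<alpha>\<close>, so the counted set can change only at these two normals and their
  images under \<open>w\<close>. If \<open>c \<bullet> w' \<alpha> > 0\<close> then
  \<open>- \<alpha>\<close> is lost and at most \<open>- w \<alpha>\<close> is gained; if
  \<open>c \<bullet> w \<alpha> > 0\<close> then \<open>w \<alpha>\<close> is lost and at most
  \<open>\<alpha>\<close> is gained. The excluded sign pattern is the one where both gains could
  occur without a loss.\<close>

lemma disp_le_cross:
  assumes arr: "arr \<Phi>" and c: "regular \<Phi> c" and d: "regular \<Phi> d"
    and sep: "sep \<Phi> c d = {\<alpha>}" and sgn: "\<not> (c \<bullet> w \<alpha> < 0 \<and> c \<bullet> w' \<alpha> < 0)"
  shows "disp \<Phi> d \<le> disp \<Phi> c"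
proof -
  note arr = arrD[OF arr]
  have a: "\<alpha> \<in> \<Phi>" "c \<bullet> \<alpha> < 0" "0 < d \<bullet> \<alpha>" using sep unfolding sep_def by auto
  have off: "(0 < d \<bullet> \<beta> \<longleftrightarrow> 0 < c \<bullet> \<beta>) \<and> (d \<bullet> \<beta> < 0 \<longleftrightarrow> c \<bullet> \<beta> < 0)"
    if "\<beta> \<in> \<Phi>" "\<beta> \<noteq> \<alpha>" "\<beta> \<noteq> - \<alpha>" for \<beta>
  proof -
    have "\<beta> \<notin> sep \<Phi> c d" "- \<beta> \<notin> sep \<Phi> c d" using sep that by (auto simp: minus_equation_iff)
    then show ?thesis
      using that(1) arr(4) c d unfolding sep_def regular_def by (auto simp: less_le)
  qed
  define A where "A x = {\<alpha>\<in>\<Phi>. 0 < x \<bullet> \<alpha> \<and> x \<bullet> w' \<alpha> < 0}" for x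
  have fin: "finite (A x)" for x unfolding A_def using arr(2) by simp
  have "c \<bullet> w \<alpha> \<noteq> 0" "c \<bullet> w' \<alpha> \<noteq> 0" using c arr a unfolding regular_def by blast+
  then consider "0 < c \<bullet> w' \<alpha>" | "0 < c \<bullet> w \<alpha>" using sgn by linarith
  then have "card (A d) \<le> card (A c)"
  proof cases
    case 1
    have "- \<alpha> \<in> A c" unfolding A_def using 1 a arr by auto
    moreover have "A d \<subseteq> insert (- w \<alpha>) (A c - {- \<alpha>})"
    proof
      fix \<beta> assume "\<beta> \<in> A d"
      then have b: "\<beta> \<in> \<Phi>" "0 < d \<bullet> \<beta>" "d \<bullet> w' \<beta> < 0" unfolding A_def by auto
      show "\<beta> \<in> insert (- w \<alpha>) (A c - {- \<alpha>})"
      proof (cases "\<beta> = - w \<alpha>")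
        case False
        then have "w' \<beta> \<noteq> - \<alpha>" by (metis inv1 w_simps(1))
        moreover have "w' \<beta> \<noteq> \<alpha>" using b a by auto
        ultimately have c1: "c \<bullet> w' \<beta> < 0" using off[of "w' \<beta>"] b arr(6) by blast
        then have "\<beta> \<noteq> \<alpha>" using 1 by auto
        moreover have "\<beta> \<noteq> - \<alpha>" using b a by auto
        ultimately show ?thesis using off[OF b(1)] b c1 unfolding A_def by auto
      qed simp
    qed
    ultimately show ?thesis by (rule card_le_exchange[OF fin])
  next
    case 2
    have "w \<alpha> \<in> A c" unfolding A_def using 2 a arr by auto
    moreover have "A d \<subseteq> insert \<alpha> (A c - {w \<alpha>})"
    proof
      fix \<beta> assume "\<beta> \<in> A d"
      then have b: "\<beta> \<in> \<Phi>" "0 < d \<bullet> \<beta>" "d \<bullet> w' \<beta> < 0" unfolding A_def by auto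
      show "\<beta> \<in> insert \<alpha> (A c - {w \<alpha>})"
      proof (cases "\<beta> = \<alpha>")
        case False
        moreover have "\<beta> \<noteq> - \<alpha>" using b a by auto
        ultimately have c1: "0 < c \<bullet> \<beta>" using off[OF b(1)] b by blast
        have "w' \<beta> \<noteq> - \<alpha>"
        proof
          assume "w' \<beta> = - \<alpha>"
          then have "\<beta> = - w \<alpha>" using inv1[of \<beta>] by simp
          then show False using c1 2 by simp
        qed
        moreover have n: "w' \<beta> \<noteq> \<alpha>" using b a by auto
        ultimately have "c \<bullet> w' \<beta> < 0" using off[of "w' \<beta>"] b arr(6) by blast
        then show ?thesis using c1 b n unfolding A_def by auto
      qed simp
    qed
    ultimately show ?thesis by (rule card_le_exchange[OF fin])
  qed
  then show ?thesis unfolding disp_def A_def .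
qed

text \<open>If \<open>p\<close> is an eigenvector of \<open>T\<close>, the plane spanned by
  \<open>p\<close> and \<open>w p\<close> is stable under \<open>w\<close>, and this is the set of
  normals orthogonal to that plane. Taking only the hyperplanes through \<open>p\<close> would not
  give an arrangement stable under \<open>w\<close>.\<close>

definition loc :: "'v set \<Rightarrow> 'v \<Rightarrow> 'v set" where
  "loc \<Phi> p = {\<alpha>\<in>\<Phi>. p \<bullet> \<alpha> = 0 \<and> p \<bullet> w \<alpha> = 0}"

lemma eigen_inner:
  assumes "T p = \<mu> *\<^sub>R p"
  shows "p \<bullet> w' x = \<mu> * (p \<bullet> x) - p \<bullet> w x"
  using T_inner[of p x] assms by simp

lemma arr_loc:
  assumes "arr \<Phi>" "T p = \<mu> *\<^sub>R p"
  shows "arr (loc \<Phi> p)"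
proof -
  have "w \<alpha> \<in> loc \<Phi> p \<and> w' \<alpha> \<in> loc \<Phi> p" if "\<alpha> \<in> loc \<Phi> p" for \<alpha>
    using that arrD(5,6)[OF assms(1)] eigen_inner[OF assms(2), of \<alpha>]
      eigen_inner[OF assms(2), of "w \<alpha>"] unfolding loc_def by simp
  moreover have "symmetric_arrangement (loc \<Phi> p)"
    using arrD(1)[OF assms(1)] unfolding symmetric_arrangement_def loc_def by auto
  ultimately show ?thesis unfolding arr_def by blast
qed

text \<open>For a hyperplane through \<open>p\<close> but not through \<open>w p\<close>, \<open>w p\<close> and \<open>w' p\<close> lie on opposite sides, so whichever
  side \<open>c\<close> is on, exactly one of the hyperplane and its image under \<open>w\<close> separates \<open>c\<close> from \<open>w c\<close>.\<close>
lemma disp_local: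
  assumes arr: "arr \<Phi>" and p: "T p = \<mu> *\<^sub>R p"
    and c: "regular \<Phi> c" "in_closure \<Phi> c p"
  shows "disp \<Phi> c = disp (loc \<Phi> p) c + card {\<beta>\<in>\<Phi>. 0 < p \<bullet> \<beta> \<and> p \<bullet> w' \<beta> < 0}
           + card {\<gamma>\<in>\<Phi>. p \<bullet> \<gamma> = 0 \<and> p \<bullet> w' \<gamma> < 0}"
proof -
  note arr = arrD[OF arr]
  define X where "X = {\<alpha>\<in>loc \<Phi> p. 0 < c \<bullet> \<alpha> \<and> c \<bullet> w' \<alpha> < 0}"
  define P where "P = {\<beta>\<in>\<Phi>. 0 < p \<bullet> \<beta> \<and> p \<bullet> w' \<beta> < 0}"
  define Q where "Q = {\<beta>\<in>\<Phi>. p \<bullet> \<beta> = 0 \<and> p \<bullet> w' \<beta> < 0 \<and> 0 < c \<bullet> \<beta>}"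
  define R where "R = {\<beta>\<in>\<Phi>. 0 < p \<bullet> \<beta> \<and> p \<bullet> w' \<beta> = 0 \<and> c \<bullet> w' \<beta> < 0}"
  define R' where "R' = {\<gamma>\<in>\<Phi>. p \<bullet> \<gamma> = 0 \<and> p \<bullet> w' \<gamma> < 0 \<and> c \<bullet> \<gamma> < 0}"
  note defs = X_def P_def Q_def R_def R'_def
  have fin: "finite X" "finite P" "finite Q" "finite R" "finite R'"
    unfolding defs loc_def using arr(2) by auto
  have pos: "0 < c \<bullet> \<beta>" if "\<beta> \<in> \<Phi>" "0 < p \<bullet> \<beta>" for \<beta> using c(2) that unfolding in_closure_def by blast
  have neg: "c \<bullet> \<beta> < 0" if "\<beta> \<in> \<Phi>" "p \<bullet> \<beta> < 0" for \<beta> using pos[of "- \<beta>"] that arr(4) by auto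
  have neg': "c \<bullet> w' \<beta> < 0" if "\<beta> \<in> \<Phi>" "p \<bullet> w' \<beta> < 0" for \<beta> using neg that arr(6) by blast
  have nneg: "p \<bullet> \<beta> \<ge> 0" if "\<beta> \<in> \<Phi>" "0 < c \<bullet> \<beta>" for \<beta>
    using neg[OF that(1)] that(2) by (meson less_asym not_less)
  have nneg': "p \<bullet> w' \<beta> \<le> 0" if "\<beta> \<in> \<Phi>" "c \<bullet> w' \<beta> < 0" for \<beta>
    using pos[OF arr(6)[OF that(1)]] that(2) by (meson less_asym not_less)
  have "{\<alpha>\<in>\<Phi>. 0 < c \<bullet> \<alpha> \<and> c \<bullet> w' \<alpha> < 0} = X \<union> P \<union> (Q \<union> R)"
  proof (intro equalityI subsetI)
    fix \<beta> assume "\<beta> \<in> {\<alpha>\<in>\<Phi>. 0 < c \<bullet> \<alpha> \<and> c \<bullet> w' \<alpha> < 0}"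
    then have b: "\<beta> \<in> \<Phi>" "0 < c \<bullet> \<beta>" "c \<bullet> w' \<beta> < 0" by auto
    have "\<beta> \<in> loc \<Phi> p" if "p \<bullet> \<beta> = 0" "p \<bullet> w' \<beta> = 0"
      using that eigen_inner[OF p, of \<beta>] b(1) unfolding loc_def by auto
    then show "\<beta> \<in> X \<union> P \<union> (Q \<union> R)"
      using b nneg[OF b(1,2)] nneg'[OF b(1,3)] unfolding defs by force
  next
    fix \<beta> assume "\<beta> \<in> X \<union> P \<union> (Q \<union> R)"
    then show "\<beta> \<in> {\<alpha>\<in>\<Phi>. 0 < c \<bullet> \<alpha> \<and> c \<bullet> w' \<alpha> < 0}"
      unfolding defs using pos neg' unfolding loc_def by auto
  qed
  moreover have "X \<inter> P = {}" "(X \<union> P) \<inter> (Q \<union> R) = {}" "Q \<inter> R = {}"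
    unfolding defs loc_def using eigen_inner[OF p] by auto
  ultimately have "disp \<Phi> c = card X + card P + (card Q + card R)"
    unfolding disp_def using fin by (simp add: card_Un_disjoint)
  \<comment> \<open>If \<open>p \<bullet> w' \<beta> = 0\<close>, the eigenvector relation gives
    \<open>p \<bullet> w' (w' \<beta>) = - (p \<bullet> \<beta>)\<close>, so \<open>w'\<close>
    carries \<open>R\<close> to \<open>R'\<close>. Then \<open>Q\<close> and \<open>R'\<close>
    together exhaust a set that does not depend on \<open>c\<close>.\<close>
  moreover have "card R = card R'"
  proof (rule bij_betw_same_card[of w'], rule bij_betw_byWitness[where f' = w])
    show "w' ` R \<subseteq> R'"
    proof
      fix x assume "x \<in> w' ` R"
      then obtain \<beta> where "x = w' \<beta>" "\<beta> \<in> R" by blast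
      then show "x \<in> R'"
        using arr(6) eigen_inner[OF p, of "w' \<beta>"] unfolding R_def R'_def by simp
    qed
    show "w ` R' \<subseteq> R"
    proof
      fix x assume "x \<in> w ` R'"
      then obtain \<gamma> where "x = w \<gamma>" "\<gamma> \<in> R'" by blast
      then show "x \<in> R"
        using arr(5) eigen_inner[OF p, of \<gamma>] unfolding R_def R'_def by auto
    qed
  qed auto
  moreover have "{\<gamma>\<in>\<Phi>. p \<bullet> \<gamma> = 0 \<and> p \<bullet> w' \<gamma> < 0} = Q \<union> R'"
    unfolding Q_def R'_def using c(1) unfolding regular_def by (auto simp: neq_iff)
  moreover have "Q \<inter> R' = {}" unfolding Q_def R'_def by auto
  ultimately show ?thesis using fin
    by (simp add: card_Un_disjoint disp_def X_def P_def)
qed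

text \<open>Only walls through \<open>p\<close> with \<open>T p \<bullet> \<alpha> > 0\<close> are crossed, and crossing those does not increase the displacement.\<close>
lemma ascent_step:
  assumes arr: "arr \<Phi>" and c: "regular \<Phi> c" "in_closure \<Phi> c p"
  shows "\<exists>d. (step \<Phi>)\<^sup>*\<^sup>* c d \<and>
    (\<forall>\<alpha>\<in>\<Phi>. 0 < p \<bullet> \<alpha> \<or> p \<bullet> \<alpha> = 0 \<and> 0 < T p \<bullet> \<alpha> \<longrightarrow> 0 < d \<bullet> \<alpha>)"
proof -
  note ar = arrD[OF arr]
  \<comment> \<open>Together the two choices make \<open>d\<close> the point
    \<open>p + eps T p + eps^2 c\<close> for infinitesimal \<open>eps\<close>: \<open>c\<close> only
    breaks the remaining ties.\<close>
  obtain b where b: "\<forall>\<alpha>\<in>\<Phi>. (0 < b \<bullet> \<alpha> \<longleftrightarrow> 0 < T p \<bullet> \<alpha> \<or> T p \<bullet> \<alpha> = 0 \<and> 0 < c \<bullet> \<alpha>) \<and>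
    (b \<bullet> \<alpha> < 0 \<longleftrightarrow> T p \<bullet> \<alpha> < 0 \<or> T p \<bullet> \<alpha> = 0 \<and> c \<bullet> \<alpha> < 0)" using lex_point[OF ar(2)] by blast
  obtain d where d: "\<forall>\<alpha>\<in>\<Phi>. (0 < d \<bullet> \<alpha> \<longleftrightarrow> 0 < p \<bullet> \<alpha> \<or> p \<bullet> \<alpha> = 0 \<and> 0 < b \<bullet> \<alpha>) \<and>
    (d \<bullet> \<alpha> < 0 \<longleftrightarrow> p \<bullet> \<alpha> < 0 \<or> p \<bullet> \<alpha> = 0 \<and> b \<bullet> \<alpha> < 0)" using lex_point[OF ar(2)] by blast
  have regd: "regular \<Phi> d"
    unfolding regular_def
  proof
    fix \<alpha> assume a: "\<alpha> \<in> \<Phi>"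
    have "c \<bullet> \<alpha> \<noteq> 0" using c(1) a unfolding regular_def by blast
    moreover have "(0 < d \<bullet> \<alpha> \<longleftrightarrow> 0 < p \<bullet> \<alpha> \<or> p \<bullet> \<alpha> = 0 \<and> 0 < b \<bullet> \<alpha>)"
      "(d \<bullet> \<alpha> < 0 \<longleftrightarrow> p \<bullet> \<alpha> < 0 \<or> p \<bullet> \<alpha> = 0 \<and> b \<bullet> \<alpha> < 0)" using d a by blast+
    moreover have "(0 < b \<bullet> \<alpha> \<longleftrightarrow> 0 < T p \<bullet> \<alpha> \<or> T p \<bullet> \<alpha> = 0 \<and> 0 < c \<bullet> \<alpha>)"
      "(b \<bullet> \<alpha> < 0 \<longleftrightarrow> T p \<bullet> \<alpha> < 0 \<or> T p \<bullet> \<alpha> = 0 \<and> c \<bullet> \<alpha> < 0)" using b a by blast+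
    ultimately show "d \<bullet> \<alpha> \<noteq> 0" by linarith
  qed
  have "(step \<Phi>)\<^sup>*\<^sup>* c d"
  proof (rule gallery_induct[OF ar(1) c(1) regd])
    fix x y assume "regular \<Phi> x" "regular \<Phi> y" "same_side \<Phi> x y"
    then show "step \<Phi> x y" using step_same_side[OF arr] by blast
  next
    fix x y \<alpha>
    assume x: "regular \<Phi> x" "regular \<Phi> y" "interposed \<Phi> c d x" "\<alpha> \<in> sep \<Phi> c d" "sep \<Phi> x y = {\<alpha>}"
    then have a: "\<alpha> \<in> \<Phi>" "c \<bullet> \<alpha> < 0" "0 < d \<bullet> \<alpha>" unfolding sep_def by auto
    have px: "0 < x \<bullet> \<beta>" if "\<beta> \<in> \<Phi>" "0 < p \<bullet> \<beta>" for \<beta>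
      using that x(3) c(2) d unfolding interposed_def in_closure_def by blast
    have "\<not> (x \<bullet> w \<alpha> < 0 \<and> x \<bullet> w' \<alpha> < 0)"
    proof
      assume "x \<bullet> w \<alpha> < 0 \<and> x \<bullet> w' \<alpha> < 0"
      then have "p \<bullet> w \<alpha> \<le> 0" "p \<bullet> w' \<alpha> \<le> 0"
        using px[OF ar(5)[OF a(1)]] px[OF ar(6)[OF a(1)]] by linarith+
      then have "T p \<bullet> \<alpha> \<le> 0" by (simp add: T_inner)
      moreover have "\<not> 0 < p \<bullet> \<alpha>" using c(2) a unfolding in_closure_def by (meson less_asym)
      ultimately show False using a d b by (meson less_asym not_less)
    qed
    from disp_le_cross[OF arr x(1,2,5) this] show "step \<Phi> x y"
      using x unfolding step_def by simp
  qed
  moreover have "\<forall>\<alpha>\<in>\<Phi>. 0 < p \<bullet> \<alpha> \<or> p \<bullet> \<alpha> = 0 \<and> 0 < T p \<bullet> \<alpha> \<longrightarrow> 0 < d \<bullet> \<alpha>"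
    using d b by blast
  ultimately show ?thesis by blast
qed

text \<open>All hyperplanes between \<open>y\<close> and \<open>z\<close> pass through
  \<open>p\<close>. Those outside the local arrangement do not affect the displacement, by
  \<open>disp_local\<close>. At most one belongs to it, and before crossing that one the gallery has
  the local signs of \<open>y\<close>, afterwards those of \<open>z\<close>, so the assumed
  inequality applies at this crossing.\<close>

lemma local_move:
  assumes arr: "arr \<Phi>" and p: "T p = \<mu> *\<^sub>R p"
    and y: "regular \<Phi> y" "in_closure \<Phi> y p" and z: "regular \<Phi> z" "in_closure \<Phi> z p"
    and U: "card (sep (loc \<Phi> p) y z) \<le> 1" "disp (loc \<Phi> p) z \<le> disp (loc \<Phi> p) y"
  shows "(step \<Phi>)\<^sup>*\<^sup>* y z"
proof (rule gallery_induct[OF arrD(1)[OF arr] y(1) z(1)])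
  fix x x' assume "regular \<Phi> x" "regular \<Phi> x'" "same_side \<Phi> x x'"
  then show "step \<Phi> x x'" using step_same_side[OF arr] by blast
next
  fix x x' \<alpha>
  assume x: "regular \<Phi> x" "regular \<Phi> x'" "interposed \<Phi> y z x" "interposed \<Phi> y z x'"
    "\<alpha> \<in> sep \<Phi> y z" "sep \<Phi> x x' = {\<alpha>}"
  define U where "U = loc \<Phi> p"
  note ar = arrD[OF arr]
  have arrU: "arr U" unfolding U_def using arr_loc[OF arr p] .
  have sub: "U \<subseteq> \<Phi>" unfolding U_def loc_def by auto
  have regU: "regular U v" if "regular \<Phi> v" for v using that sub unfolding regular_def by blast
  have cl: "in_closure \<Phi> x p" "in_closure \<Phi> x' p"
    using x(3,4) y(2) z(2) unfolding interposed_def in_closure_def by blast+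
  have sepU: "sep U a b = sep \<Phi> a b \<inter> U" for a b using sub unfolding sep_def by auto
  have "disp U x' \<le> disp U x"
  proof (cases "\<alpha> \<in> U")
    case False
    then have "sep U x x' = {}" using x(6) sepU by auto
    then have "same_side U x x'" using same_sideI[OF arrD(1)[OF arrU]] regU x(1,2) by blast
    then show ?thesis using disp_cong[OF arrU regU[OF x(1)] regU[OF x(2)]] by simp
  next
    case True
    then have "\<alpha> \<in> sep U y z" using x(5) sepU by auto
    then have syz: "sep U y z = {\<alpha>}"
      using assms(7) card_le_Suc0_iff_eq[of "sep U y z"] arrD(2)[OF arrU] unfolding U_def[symmetric] sep_def by auto
    have a: "y \<bullet> \<alpha> < 0" "0 < z \<bullet> \<alpha>" "x \<bullet> \<alpha> < 0" "0 < x' \<bullet> \<alpha>"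
      using x(5,6) unfolding sep_def by auto
    have ss: "same_side U v t" if v: "regular \<Phi> v" "v = y \<or> v = z" and t: "regular \<Phi> t" "interposed \<Phi> y z t"
      "(v \<bullet> \<alpha> < 0) = (t \<bullet> \<alpha> < 0)" for v t
    proof (rule same_sideI[OF arrD(1)[OF arrU]])
      show "regular U v" "regular U t" using regU that by auto
      show "sep U v t = {}"
      proof (rule ccontr)
        assume "sep U v t \<noteq> {}"
        then obtain \<beta> where b: "\<beta> \<in> U" "v \<bullet> \<beta> < 0" "0 < t \<bullet> \<beta>" unfolding sep_def by auto
        have nb: "- \<beta> \<in> U" using b(1) arrD(4)[OF arrU] by blast
        have "\<not> (y \<bullet> \<beta> < 0 \<and> z \<bullet> \<beta> < 0)"
          using t(2) nb b(3) sub unfolding interposed_def by fastforce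
        moreover have "y \<bullet> \<beta> \<noteq> 0" "z \<bullet> \<beta> \<noteq> 0" using y(1) z(1) b(1) sub unfolding regular_def by auto
        ultimately have "\<beta> \<in> sep U y z \<or> - \<beta> \<in> sep U y z"
          using b v(2) nb unfolding sep_def by (auto simp: not_less less_le)
        then have "\<beta> = \<alpha> \<or> \<beta> = - \<alpha>" using syz by (auto simp: minus_equation_iff)
        then show False using b t(3) by auto
      qed
    qed
    have "same_side U y x" using ss[of y x] y x a by auto
    moreover have "same_side U z x'" using ss[of z x'] z x a by auto
    ultimately have "disp U x = disp U y" "disp U x' = disp U z"
      using disp_cong[OF arrU] regU x(1,2) y(1) z(1) by metis+
    then show ?thesis using assms(8) unfolding U_def by simp
  qed
  then have "disp \<Phi> x' \<le> disp \<Phi> x"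
    using disp_local[OF arr p x(1) cl(1)] disp_local[OF arr p x(2) cl(2)] unfolding U_def by simp
  then show "step \<Phi> x x'" using x unfolding step_def by simp
qed

section \<open>Lifting moves from a local arrangement\<close>

lemma lex_regular:
  assumes arr: "arr \<Phi>" and c: "regular \<Phi> c"
  shows "\<exists>d. regular \<Phi> d \<and> (\<forall>\<alpha>\<in>\<Phi>. (0 < p \<bullet> \<alpha> \<longrightarrow> 0 < d \<bullet> \<alpha>) \<and> (p \<bullet> \<alpha> < 0 \<longrightarrow> d \<bullet> \<alpha> < 0) \<and>
    (p \<bullet> \<alpha> = 0 \<and> x \<bullet> \<alpha> \<noteq> 0 \<longrightarrow> (0 < d \<bullet> \<alpha> \<longleftrightarrow> 0 < x \<bullet> \<alpha>)))"
proof -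
  note ar = arrD[OF arr]
  \<comment> \<open>The point is \<open>p + eps x + eps^2 c\<close> for infinitesimal
    \<open>eps\<close>.\<close>
  obtain b where b: "\<forall>\<alpha>\<in>\<Phi>. (0 < b \<bullet> \<alpha> \<longleftrightarrow> 0 < x \<bullet> \<alpha> \<or> x \<bullet> \<alpha> = 0 \<and> 0 < c \<bullet> \<alpha>) \<and>
    (b \<bullet> \<alpha> < 0 \<longleftrightarrow> x \<bullet> \<alpha> < 0 \<or> x \<bullet> \<alpha> = 0 \<and> c \<bullet> \<alpha> < 0)" using lex_point[OF ar(2)] by blast
  obtain d where d: "\<forall>\<alpha>\<in>\<Phi>. (0 < d \<bullet> \<alpha> \<longleftrightarrow> 0 < p \<bullet> \<alpha> \<or> p \<bullet> \<alpha> = 0 \<and> 0 < b \<bullet> \<alpha>) \<and>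
    (d \<bullet> \<alpha> < 0 \<longleftrightarrow> p \<bullet> \<alpha> < 0 \<or> p \<bullet> \<alpha> = 0 \<and> b \<bullet> \<alpha> < 0)" using lex_point[OF ar(2)] by blast
  have "d \<bullet> \<alpha> \<noteq> 0" if a: "\<alpha> \<in> \<Phi>" for \<alpha>
  proof -
    have "c \<bullet> \<alpha> \<noteq> 0" using c a unfolding regular_def by blast
    moreover have "(0 < d \<bullet> \<alpha> \<longleftrightarrow> 0 < p \<bullet> \<alpha> \<or> p \<bullet> \<alpha> = 0 \<and> 0 < b \<bullet> \<alpha>)"
      "(d \<bullet> \<alpha> < 0 \<longleftrightarrow> p \<bullet> \<alpha> < 0 \<or> p \<bullet> \<alpha> = 0 \<and> b \<bullet> \<alpha> < 0)" using d a by blast+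
    moreover have "(0 < b \<bullet> \<alpha> \<longleftrightarrow> 0 < x \<bullet> \<alpha> \<or> x \<bullet> \<alpha> = 0 \<and> 0 < c \<bullet> \<alpha>)"
      "(b \<bullet> \<alpha> < 0 \<longleftrightarrow> x \<bullet> \<alpha> < 0 \<or> x \<bullet> \<alpha> = 0 \<and> c \<bullet> \<alpha> < 0)" using b a by blast+
    ultimately show "d \<bullet> \<alpha> \<noteq> 0" by linarith
  qed
  then show ?thesis unfolding regular_def using d b by (intro exI[of _ d]) auto
qed

lemma step_regular:
  assumes "(step \<Phi>)\<^sup>*\<^sup>* c d" "regular \<Phi> c"
  shows "regular \<Phi> d"
  using assms by (induction rule: rtranclp_induct) (auto simp: step_def)

text \<open>Each local chamber on the way is realised by a chamber of the full arrangement at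
  \<open>p\<close>, chosen infinitesimally close to \<open>p\<close> in the direction of the local
  point; \<open>local_move\<close> joins consecutive choices. The end \<open>d\<close> is arbitrary
  among the chambers at \<open>p\<close> with the right local signs, since changing the other signs
  is free.\<close>

lemma local_lift:
  assumes arr: "arr \<Phi>" and p: "T p = \<mu> *\<^sub>R p"
    and c: "regular \<Phi> c" "in_closure \<Phi> c p"
    and reach: "(step (loc \<Phi> p))\<^sup>*\<^sup>* c x"
    and d: "regular \<Phi> d" "in_closure \<Phi> d p" "same_side (loc \<Phi> p) x d"
  shows "(step \<Phi>)\<^sup>*\<^sup>* c d"
  using reach d
proof (induction arbitrary: d rule: rtranclp_induct)
  case base
  define U where "U = loc \<Phi> p"
  have arrU: "arr U" unfolding U_def using arr_loc[OF arr p] .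
  have regU: "regular U v" if "regular \<Phi> v" for v using that unfolding U_def loc_def regular_def by blast
  have "step U c d" using step_same_side[OF arrU] regU base c unfolding U_def by blast
  then show ?case
    using local_move[OF arr p c base(1,2)] unfolding step_def U_def by blast
next
  case (step x x')
  define U where "U = loc \<Phi> p"
  have arrU: "arr U" unfolding U_def using arr_loc[OF arr p] .
  have regU: "regular U v" if "regular \<Phi> v" for v using that unfolding U_def loc_def regular_def by blast
  have xs: "regular U x" "regular U x'" "card (sep U x x') \<le> 1" "disp U x' \<le> disp U x"
    using step(2) unfolding U_def step_def by auto
  obtain e where e: "regular \<Phi> e" "\<forall>\<alpha>\<in>\<Phi>. (0 < p \<bullet> \<alpha> \<longrightarrow> 0 < e \<bullet> \<alpha>) \<and> (p \<bullet> \<alpha> < 0 \<longrightarrow> e \<bullet> \<alpha> < 0) \<and>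
    (p \<bullet> \<alpha> = 0 \<and> x \<bullet> \<alpha> \<noteq> 0 \<longrightarrow> (0 < e \<bullet> \<alpha> \<longleftrightarrow> 0 < x \<bullet> \<alpha>))"
    using lex_regular[OF arr c(1)] by blast
  have ecl: "in_closure \<Phi> e p" using e(2) unfolding in_closure_def by blast
  have same: "same_side U x e"
    using e(2) xs(1) unfolding same_side_def U_def loc_def regular_def by auto
  have "(step \<Phi>)\<^sup>*\<^sup>* c e" using step.IH[OF e(1) ecl] same unfolding U_def by blast
  moreover have "(step \<Phi>)\<^sup>*\<^sup>* e d"
  proof (rule local_move[OF arr p e(1) ecl step.prems(1,2)])
    have neg: "v \<bullet> \<alpha> < 0 \<longleftrightarrow> \<not> 0 < v \<bullet> \<alpha>" if "regular U v" "\<alpha> \<in> U" for v \<alpha>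
      using that unfolding regular_def by (auto simp: not_less less_le)
    have "sep U e d = sep U x x'"
      using same step.prems(3) neg[OF regU[OF e(1)]] neg[OF xs(1)]
      unfolding sep_def same_side_def U_def[symmetric] by blast
    then show "card (sep (loc \<Phi> p) e d) \<le> 1" using xs(3) unfolding U_def by simp
    show "disp (loc \<Phi> p) d \<le> disp (loc \<Phi> p) e"
      using xs(4) disp_cong[OF arrU xs(1) regU[OF e(1)] same]
        disp_cong[OF arrU xs(2) regU[OF step.prems(1)]] step.prems(3) unfolding U_def by simp
  qed
  ultimately show ?case by simp
qed

text \<open>The chamber reached is one whose closure contains \<open>p + eps q\<close> for small
  \<open>eps\<close>. Locally only the signs on \<open>loc \<Phi> p\<close> are controlled; for the
  other hyperplanes through \<open>p\<close> the sign of \<open>q\<close> can be imposed because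
  crossing them does not change the displacement.\<close>

lemma towards:
  assumes arr: "arr \<Phi>" and p: "T p = \<mu> *\<^sub>R p"
    and x: "regular \<Phi> x" "in_closure \<Phi> x p"
    and ex: "\<exists>y. (step (loc \<Phi> p))\<^sup>*\<^sup>* x y \<and> in_closure (loc \<Phi> p) y q"
  shows "\<exists>d. (step \<Phi>)\<^sup>*\<^sup>* x d \<and> regular \<Phi> d \<and>
    (\<forall>\<alpha>\<in>\<Phi>. 0 < p \<bullet> \<alpha> \<or> p \<bullet> \<alpha> = 0 \<and> 0 < q \<bullet> \<alpha> \<longrightarrow> 0 < d \<bullet> \<alpha>)"
proof -
  define U where "U = loc \<Phi> p"
  have arrU: "arr U" unfolding U_def using arr_loc[OF arr p] .
  have regxU: "regular U x" using x(1) unfolding U_def loc_def regular_def by blast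
  obtain y where y: "(step U)\<^sup>*\<^sup>* x y" "in_closure U y q" using ex unfolding U_def by blast
  have regy: "regular U y" using step_regular[OF y(1) regxU] .
  obtain e where e: "regular \<Phi> e" "\<forall>\<alpha>\<in>\<Phi>. (0 < q \<bullet> \<alpha> \<longrightarrow> 0 < e \<bullet> \<alpha>) \<and> (q \<bullet> \<alpha> < 0 \<longrightarrow> e \<bullet> \<alpha> < 0) \<and>
    (q \<bullet> \<alpha> = 0 \<and> y \<bullet> \<alpha> \<noteq> 0 \<longrightarrow> (0 < e \<bullet> \<alpha> \<longleftrightarrow> 0 < y \<bullet> \<alpha>))"
    using lex_regular[OF arr x(1)] by blast
  obtain d where d: "regular \<Phi> d" "\<forall>\<alpha>\<in>\<Phi>. (0 < p \<bullet> \<alpha> \<longrightarrow> 0 < d \<bullet> \<alpha>) \<and> (p \<bullet> \<alpha> < 0 \<longrightarrow> d \<bullet> \<alpha> < 0) \<and>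
    (p \<bullet> \<alpha> = 0 \<and> e \<bullet> \<alpha> \<noteq> 0 \<longrightarrow> (0 < d \<bullet> \<alpha> \<longleftrightarrow> 0 < e \<bullet> \<alpha>))"
    using lex_regular[OF arr x(1)] by blast
  have "same_side U y d"
    unfolding same_side_def
  proof
    fix \<alpha> assume a: "\<alpha> \<in> U"
    then have a': "\<alpha> \<in> \<Phi>" "p \<bullet> \<alpha> = 0" unfolding U_def loc_def by auto
    have "e \<bullet> \<alpha> \<noteq> 0" using e(1) a' unfolding regular_def by blast
    then have de: "0 < d \<bullet> \<alpha> \<longleftrightarrow> 0 < e \<bullet> \<alpha>" using d(2) a' by blast
    consider "0 < q \<bullet> \<alpha>" | "q \<bullet> \<alpha> < 0" | "q \<bullet> \<alpha> = 0" by linarith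
    then show "0 < y \<bullet> \<alpha> \<longleftrightarrow> 0 < d \<bullet> \<alpha>"
    proof cases
      case 1
      then show ?thesis using de e(2) a a' y(2) unfolding in_closure_def by blast
    next
      case 2
      then have "0 < y \<bullet> (- \<alpha>)" using y(2) arrD(4)[OF arrU a] unfolding in_closure_def by auto
      moreover have "e \<bullet> \<alpha> < 0" using e(2) a' 2 by blast
      ultimately show ?thesis using de by auto
    next
      case 3
      have "y \<bullet> \<alpha> \<noteq> 0" using regy a unfolding regular_def by blast
      then show ?thesis using de e(2) a' 3 by blast
    qed
  qed
  moreover have "in_closure \<Phi> d p" using d(2) unfolding in_closure_def by blast
  ultimately have "(step \<Phi>)\<^sup>*\<^sup>* x d"
    using local_lift[OF arr p x] y(1) d(1) unfolding U_def by blast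
  moreover have "0 < d \<bullet> \<alpha>" if "\<alpha> \<in> \<Phi>" "0 < p \<bullet> \<alpha> \<or> p \<bullet> \<alpha> = 0 \<and> 0 < q \<bullet> \<alpha>" for \<alpha>
    using that d(2) e(2) by (metis less_irrefl)
  ultimately show ?thesis using d(1) by blast
qed

text \<open>Move from \<open>p\<close> to \<open>q\<close> along a ray of eigenvectors, changing chambers only at the finitely many points
  where the ray meets a hyperplane.\<close>
lemma move_top:
  assumes arr: "arr \<Phi>" and q: "T q = l *\<^sub>R q"
    and IH: "\<And>p x. \<lbrakk>T p = l *\<^sub>R p; p \<in> span \<Phi>; p \<noteq> 0; regular \<Phi> x; in_closure \<Phi> x p\<rbrakk> \<Longrightarrow>
      \<exists>y. (step (loc \<Phi> p))\<^sup>*\<^sup>* x y \<and> in_closure (loc \<Phi> p) y q"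
    and p: "T p = l *\<^sub>R p" "p \<in> span \<Phi>" and qs: "q \<in> span \<Phi>" and ne: "\<And>t. t \<ge> 0 \<Longrightarrow> p + t *\<^sub>R q \<noteq> 0"
    and x: "regular \<Phi> x" "in_closure \<Phi> x p"
  shows "\<exists>d. (step \<Phi>)\<^sup>*\<^sup>* x d \<and> in_closure \<Phi> d q"
  using p ne x
proof (induction "card {\<alpha>\<in>\<Phi>. 0 < p \<bullet> \<alpha> \<and> q \<bullet> \<alpha> < 0}" arbitrary: p x rule: less_induct)
  case less
  note ar = arrD[OF arr]
  \<comment> \<open>Avoiding the origin matters at every point of the ray: the local arrangement is
    smaller, and so \<open>IH\<close> available, only at nonzero points.\<close>
  have p0: "p \<noteq> 0" using less.prems(3)[of 0] by simp
  obtain d where d: "(step \<Phi>)\<^sup>*\<^sup>* x d" "regular \<Phi> d"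
    "\<And>\<alpha>. \<alpha> \<in> \<Phi> \<Longrightarrow> 0 < p \<bullet> \<alpha> \<or> p \<bullet> \<alpha> = 0 \<and> 0 < q \<bullet> \<alpha> \<Longrightarrow> 0 < d \<bullet> \<alpha>"
    using towards[OF arr less.prems(1,4,5) IH[OF less.prems(1,2) p0 less.prems(4,5)]] by blast
  define N where "N p = {\<alpha>\<in>\<Phi>. 0 < p \<bullet> \<alpha> \<and> q \<bullet> \<alpha> < 0}" for p
  show ?case
  proof (cases "N p = {}")
    case True
    have "in_closure \<Phi> d q"
      unfolding in_closure_def
    proof (intro ballI impI)
      fix \<alpha> assume a: "\<alpha> \<in> \<Phi>" "0 < q \<bullet> \<alpha>"
      have "- \<alpha> \<notin> N p" using True by blast
      then have "0 \<le> p \<bullet> \<alpha>" using a ar(4) unfolding N_def by auto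
      then show "0 < d \<bullet> \<alpha>" using d(3)[OF a(1)] a(2) by linarith
    qed
    then show ?thesis using d(1) by blast
  next
    case False
    define r where "r \<alpha> = p \<bullet> \<alpha> / - (q \<bullet> \<alpha>)" for \<alpha>
    have finN: "finite (N p)" unfolding N_def using ar(2) by simp
    define \<alpha>0 where "\<alpha>0 = arg_min_on r (N p)"
    define t where "t = r \<alpha>0"
    have a0: "\<alpha>0 \<in> N p" using finN False unfolding \<alpha>0_def by (rule arg_min_if_finite(1))
    have tle: "t \<le> r \<beta>" if "\<beta> \<in> N p" for \<beta>
      unfolding t_def \<alpha>0_def by (rule arg_min_least[OF finN False that])
    have t0: "0 < t" using a0 unfolding t_def r_def N_def by (simp add: divide_pos_neg)
    define p' where "p' = p + t *\<^sub>R q"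
    have p'in: "p' \<bullet> \<alpha> = p \<bullet> \<alpha> + t * (q \<bullet> \<alpha>)" for \<alpha> unfolding p'_def by (simp add: inner_add_left)
    have "\<exists>e. (step \<Phi>)\<^sup>*\<^sup>* d e \<and> in_closure \<Phi> e q"
    proof (rule less.hyps)
      have "N p' \<subseteq> N p"
      proof
        fix \<alpha> assume "\<alpha> \<in> N p'"
        then have a: "\<alpha> \<in> \<Phi>" "0 < p \<bullet> \<alpha> + t * (q \<bullet> \<alpha>)" "q \<bullet> \<alpha> < 0" unfolding N_def p'in by auto
        moreover have "t * (q \<bullet> \<alpha>) < 0" using a(3) t0 by (simp add: mult_pos_neg)
        ultimately show "\<alpha> \<in> N p" unfolding N_def by auto
      qed
      moreover have "\<alpha>0 \<notin> N p'"
        using a0 unfolding N_def p'in t_def r_def by simp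
      ultimately have "card (N p') < card (N p)" using a0 finN by (intro psubset_card_mono) auto
      then show "card {\<alpha>\<in>\<Phi>. 0 < p' \<bullet> \<alpha> \<and> q \<bullet> \<alpha> < 0} < card {\<alpha>\<in>\<Phi>. 0 < p \<bullet> \<alpha> \<and> q \<bullet> \<alpha> < 0}"
        unfolding N_def .
      show "T p' = l *\<^sub>R p'" unfolding p'_def using linear_T less.prems(1) q
        by (simp add: linear_add linear_scale scaleR_add_right mult.commute)
      show "p' \<in> span \<Phi>" unfolding p'_def using less.prems(2) qs by (intro span_add span_scale)
      show "p' + s *\<^sub>R q \<noteq> 0" if "s \<ge> 0" for s
        using less.prems(3)[of "t + s"] t0 that unfolding p'_def by (simp add: scaleR_add_left add.assoc)
      show "regular \<Phi> d" by (rule d(2))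
      show "in_closure \<Phi> d p'"
        unfolding in_closure_def
      proof (intro ballI impI)
        fix \<alpha> assume a: "\<alpha> \<in> \<Phi>" "0 < p' \<bullet> \<alpha>"
        consider "0 < p \<bullet> \<alpha>" | "p \<bullet> \<alpha> = 0" | "p \<bullet> \<alpha> < 0" by linarith
        then show "0 < d \<bullet> \<alpha>"
        proof cases
          case 1 then show ?thesis using d(3) a by blast
        next
          case 2
          then have "0 < q \<bullet> \<alpha>" using a(2) t0 unfolding p'in by (simp add: zero_less_mult_iff)
          then show ?thesis using d(3) a 2 by blast
        next
          case 3
          then have "0 < t * (q \<bullet> \<alpha>)" using a(2) unfolding p'in by linarith
          then have qa: "0 < q \<bullet> \<alpha>" using t0 by (simp add: zero_less_mult_iff)
          then have "- \<alpha> \<in> N p" using 3 a ar(4) unfolding N_def by auto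
          from tle[OF this] have "t * (q \<bullet> \<alpha>) \<le> - (p \<bullet> \<alpha>)" using qa unfolding r_def by (simp add: field_simps)
          then show ?thesis using a(2) unfolding p'in by linarith
        qed
      qed
    qed
    then show ?thesis using d(1) by (meson rtranclp_trans)
  qed
qed

section \<open>The Rayleigh quotient and its maximisers\<close>

lemma span_stable:
  assumes "arr \<Phi>" "x \<in> span \<Phi>"
  shows "w x \<in> span \<Phi>" "w' x \<in> span \<Phi>" "T x \<in> span \<Phi>"
proof -
  have "span (w ` \<Phi>) \<subseteq> span \<Phi>" "span (w' ` \<Phi>) \<subseteq> span \<Phi>"
    using arrD(5,6)[OF assms(1)] by (auto intro!: span_mono)
  then show "w x \<in> span \<Phi>" "w' x \<in> span \<Phi>"
    using assms(2) linear_span_image[OF lin, of \<Phi>] linear_span_image[OF lin', of \<Phi>] by blast+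
  then show "T x \<in> span \<Phi>" unfolding T_def by (rule span_add)
qed

lemma orth_span_zero:
  assumes "x \<in> span \<Phi>" "\<And>\<alpha>. \<alpha> \<in> \<Phi> \<Longrightarrow> x \<bullet> \<alpha> = 0"
  shows "x = (0::'v)"
proof -
  have "x \<bullet> v = 0" if "v \<in> span \<Phi>" for v
    using that by (induction rule: span_induct_alt) (auto simp: inner_add_right assms(2))
  then show ?thesis using assms(1) inner_eq_zero_iff by blast
qed

text \<open>A nonzero vector of the span cannot be orthogonal to every normal. This is why
  eigenvectors are projected to the span and maxima are taken there.\<close>

lemma card_loc_less:
  assumes "arr \<Phi>" "p \<in> span \<Phi>" "p \<noteq> 0"
  shows "card (loc \<Phi> p) < card \<Phi>"
proof -
  obtain \<alpha> where "\<alpha> \<in> \<Phi>" "p \<bullet> \<alpha> \<noteq> 0" using orth_span_zero assms(2,3) by blast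
  then have "loc \<Phi> p \<subset> \<Phi>" unfolding loc_def by blast
  then show ?thesis using arrD(2)[OF assms(1)] by (simp add: psubset_card_mono)
qed

text \<open>There are infinitely many regular points but only finitely many sign patterns. The
  closure of each reachable chamber meets the unit sphere of the span in a compact set depending on
  the pattern alone, so the maximum runs over a finite union of compact sets.\<close>

lemma maximal_point:
  assumes arr: "arr \<Phi>" and c: "regular \<Phi> c" and ne: "\<Phi> \<noteq> {}"
  obtains p x where "(step \<Phi>)\<^sup>*\<^sup>* c x" "regular \<Phi> x" "p \<in> span \<Phi>" "p \<bullet> p = 1" "in_closure \<Phi> x p"
    "\<And>y v. (step \<Phi>)\<^sup>*\<^sup>* c y \<Longrightarrow> v \<in> span \<Phi> \<Longrightarrow> in_closure \<Phi> y v \<Longrightarrow> v \<bullet> T v \<le> (p \<bullet> T p) * (v \<bullet> v)"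
proof -
  note ar = arrD[OF arr]
  define F where "F P = {v \<in> span \<Phi>. norm v = 1} \<inter> (\<Inter>\<alpha>\<in>\<Phi> - P. {v. v \<bullet> \<alpha> \<le> 0})" for P
  have compF: "compact (F P)" for P
    unfolding F_def
    by (intro compact_Int_closed compact_sphere_span ar(2) closed_INT ballI closed_Collect_le continuous_intros)
  define pos where "pos x = {\<alpha>\<in>\<Phi>. 0 < x \<bullet> \<alpha>}" for x
  have F: "v \<in> F (pos x) \<longleftrightarrow> v \<in> span \<Phi> \<and> norm v = 1 \<and> in_closure \<Phi> x v" for x v
    unfolding F_def pos_def in_closure_def by (fastforce simp: not_less[symmetric])
  define K where "K = \<Union> (F ` (pos ` {x. (step \<Phi>)\<^sup>*\<^sup>* c x}))"
  have "finite (pos ` {x. (step \<Phi>)\<^sup>*\<^sup>* c x})"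
    by (rule finite_subset[of _ "Pow \<Phi>"]) (auto simp: pos_def ar(2))
  then have "compact K" unfolding K_def using compF by (intro compact_Union) auto
  moreover have "K \<noteq> {}"
  proof -
    \<comment> \<open>The point \<open>c\<close> itself may lie outside the span; its projection has
      the same signs and shows that the union is not empty.\<close>
    obtain y where y: "y \<in> span \<Phi>" "\<And>v. v \<in> span \<Phi> \<Longrightarrow> (c - y) \<bullet> v = 0"
      using orthogonal_projection_span[OF ar(2), of c] by metis
    then have yc: "y \<bullet> \<alpha> = c \<bullet> \<alpha>" if "\<alpha> \<in> \<Phi>" for \<alpha>
      using span_base[OF that] by (simp add: inner_diff_left)
    then have "y \<noteq> 0" using ne c unfolding regular_def by auto
    then have "(1 / norm y) *\<^sub>R y \<in> F (pos c)"
      unfolding F in_closure_def using y(1) yc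
      by (auto intro: span_scale simp: zero_less_divide_iff zero_less_mult_iff)
    then show ?thesis unfolding K_def by blast
  qed
  moreover have "continuous_on K (\<lambda>v. v \<bullet> T v)"
    by (intro continuous_intros continuous_T)
  ultimately obtain p where p: "p \<in> K" "\<And>v. v \<in> K \<Longrightarrow> v \<bullet> T v \<le> p \<bullet> T p"
    using continuous_attains_sup by metis
  then obtain x where x: "(step \<Phi>)\<^sup>*\<^sup>* c x" "p \<in> F (pos x)" unfolding K_def by blast
  show ?thesis
  proof (rule that[OF x(1) step_regular[OF x(1) c]])
    show "p \<in> span \<Phi>" "p \<bullet> p = 1" "in_closure \<Phi> x p" using x(2) unfolding F by (auto simp: norm_eq_1)
    fix y v assume y: "(step \<Phi>)\<^sup>*\<^sup>* c y" "v \<in> span \<Phi>" "in_closure \<Phi> y v"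
    show "v \<bullet> T v \<le> (p \<bullet> T p) * (v \<bullet> v)"
    proof (cases "v = 0")
      case False
      have "(1 / norm v) *\<^sub>R v \<in> F (pos y)"
        unfolding F using y False unfolding in_closure_def
        by (auto intro: span_scale simp: zero_less_divide_iff zero_less_mult_iff)
      then have "((1 / norm v) *\<^sub>R v) \<bullet> T ((1 / norm v) *\<^sub>R v) \<le> p \<bullet> T p"
        using p(2) y(1) unfolding K_def by blast
      then have "(v \<bullet> T v) / (norm v)\<^sup>2 \<le> p \<bullet> T p"
        using linear_T by (simp add: linear_scale power2_eq_square)
      then show ?thesis using False by (simp add: power2_norm_eq_inner pos_divide_le_eq)
    qed (use linear_T in \<open>simp add: linear_0\<close>)
  qed
qed

text \<open>Along \<open>p + eps T p\<close> the first-order change of the Rayleigh quotient is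
  \<open>2 * eps\<close> times the squared length of \<open>T p - \<mu> p\<close>. Maximality is
  assumed only for this direction and for arbitrarily small \<open>eps\<close>, because
  \<open>ascent_step\<close> gives access to these points alone.\<close>

lemma rayleigh_eigenvector:
  assumes p: "p \<bullet> p = 1"
    and max: "\<And>\<delta>. \<delta> > 0 \<Longrightarrow> \<exists>\<epsilon>>0. \<epsilon> < \<delta> \<and>
      (p + \<epsilon> *\<^sub>R T p) \<bullet> T (p + \<epsilon> *\<^sub>R T p) \<le> (p \<bullet> T p) * ((p + \<epsilon> *\<^sub>R T p) \<bullet> (p + \<epsilon> *\<^sub>R T p))"
  shows "T p = (p \<bullet> T p) *\<^sub>R p"
proof -
  define \<mu> where "\<mu> = p \<bullet> T p"
  define N where "N = T p \<bullet> T p"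
  define K where "K = T p \<bullet> T (T p)"
  define D where "D = N - \<mu>\<^sup>2"
  define C where "C = \<mu> * N - K"
  have comm: "T p \<bullet> p = \<mu>" "p \<bullet> T (T p) = N" unfolding \<mu>_def N_def
    by (simp add: inner_commute) (metis T_adj)
  have DD: "(T p - \<mu> *\<^sub>R p) \<bullet> (T p - \<mu> *\<^sub>R p) = D"
    unfolding D_def using p comm
    by (simp add: inner_diff inner_commute N_def \<mu>_def power2_eq_square)
  have "D \<le> 0"
  proof (rule ccontr)
    assume "\<not> D \<le> 0"
    then have D: "D > 0" by simp
    \<comment> \<open>Chosen so that for \<open>eps < \<delta>\<close> the second-order term, with
      coefficient \<open>C\<close>, stays below the first-order gain \<open>2 * D\<close>.\<close>
    define \<delta> where "\<delta> = 2 * D / (\<bar>C\<bar> + 1)"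
    have "\<delta> > 0" using D by (simp add: \<delta>_def)
    from max[OF this] obtain \<epsilon> where e: "0 < \<epsilon>" "\<epsilon> < \<delta>" "(p + \<epsilon> *\<^sub>R T p) \<bullet> T (p + \<epsilon> *\<^sub>R T p) \<le> \<mu> * ((p + \<epsilon> *\<^sub>R T p) \<bullet> (p + \<epsilon> *\<^sub>R T p))"
      unfolding \<mu>_def by blast
    have "(p + \<epsilon> *\<^sub>R T p) \<bullet> T (p + \<epsilon> *\<^sub>R T p) = \<mu> + 2 * \<epsilon> * N + \<epsilon>\<^sup>2 * K"
      using linear_T comm
      by (simp add: linear_add linear_scale inner_add algebra_simps \<mu>_def[symmetric] N_def[symmetric] K_def[symmetric] power2_eq_square)
    moreover have "(p + \<epsilon> *\<^sub>R T p) \<bullet> (p + \<epsilon> *\<^sub>R T p) = 1 + 2 * \<epsilon> * \<mu> + \<epsilon>\<^sup>2 * N"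
      using comm p by (simp add: inner_add algebra_simps \<mu>_def[symmetric] N_def[symmetric] power2_eq_square)
    ultimately have "\<epsilon> * (2 * D) \<le> \<epsilon> * (\<epsilon> * C)"
      using e(3) by (simp add: D_def C_def power2_eq_square algebra_simps)
    then have "2 * D \<le> \<epsilon> * C" using e(1) by (simp only: mult_le_cancel_left_pos)
    also have "\<dots> \<le> \<epsilon> * \<bar>C\<bar>" using e(1) by (intro mult_left_mono) auto
    also have "\<dots> \<le> \<delta> * \<bar>C\<bar>" using e(2) by (intro mult_right_mono) auto
    also have "\<dots> < 2 * D" using D unfolding \<delta>_def by (simp add: field_simps)
    finally show False by simp
  qed
  then have "T p - \<mu> *\<^sub>R p = 0" using DD inner_ge_zero[of "T p - \<mu> *\<^sub>R p"] by (metis antisym inner_eq_zero_iff)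
  then show ?thesis by (simp add: \<mu>_def)
qed

lemma top_eigenvector:
  assumes arr: "arr \<Phi>" and ne: "\<Phi> \<noteq> {}"
  obtains q l where "q \<in> span \<Phi>" "q \<noteq> 0" "T q = l *\<^sub>R q" "\<And>v. v \<in> span \<Phi> \<Longrightarrow> v \<bullet> T v \<le> l * (v \<bullet> v)"
proof -
  note ar = arrD[OF arr]
  define K where "K = {v \<in> span \<Phi>. norm v = 1}"
  obtain \<alpha> where a: "\<alpha> \<in> \<Phi>" using ne by blast
  then have "(1 / norm \<alpha>) *\<^sub>R \<alpha> \<in> K" using ar(3) unfolding K_def by (auto intro: span_scale span_base)
  moreover have "compact K" unfolding K_def using compact_sphere_span[OF ar(2)] .
  moreover have "continuous_on K (\<lambda>v. v \<bullet> T v)"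
    by (intro continuous_intros continuous_T)
  ultimately obtain p where p: "p \<in> K" "\<And>v. v \<in> K \<Longrightarrow> v \<bullet> T v \<le> p \<bullet> T p"
    using continuous_attains_sup by (metis empty_iff)
  have le: "v \<bullet> T v \<le> (p \<bullet> T p) * (v \<bullet> v)" if v: "v \<in> span \<Phi>" for v
  proof (cases "v = 0")
    case False
    have "(1 / norm v) *\<^sub>R v \<in> K"
      unfolding K_def using v False by (auto intro: span_scale)
    then have "((1 / norm v) *\<^sub>R v) \<bullet> T ((1 / norm v) *\<^sub>R v) \<le> p \<bullet> T p" by (rule p(2))
    then have "(v \<bullet> T v) / (norm v)\<^sup>2 \<le> p \<bullet> T p"
      using linear_T by (simp add: linear_scale power2_eq_square)
    then show ?thesis using False by (simp add: power2_norm_eq_inner pos_divide_le_eq)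
  qed (use linear_T in \<open>simp add: linear_0\<close>)
  have ps: "p \<in> span \<Phi>" "p \<bullet> p = 1" using p(1) unfolding K_def by (auto simp: norm_eq_1)
  have "T p = (p \<bullet> T p) *\<^sub>R p"
  proof (rule rayleigh_eigenvector[OF ps(2)])
    fix \<delta> :: real assume "\<delta> > 0"
    then show "\<exists>\<epsilon>>0. \<epsilon> < \<delta> \<and>
      (p + \<epsilon> *\<^sub>R T p) \<bullet> T (p + \<epsilon> *\<^sub>R T p) \<le> (p \<bullet> T p) * ((p + \<epsilon> *\<^sub>R T p) \<bullet> (p + \<epsilon> *\<^sub>R T p))"
      by (intro exI[of _ "\<delta>/2"] conjI le span_add span_scale span_stable[OF arr] ps) auto
  qed
  then show ?thesis using that ps le by fastforce
qed

text \<open>Take a point \<open>p\<close> maximising the Rayleigh quotient over the closures of all reachable chambers. It is an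
  eigenvector by \<open>ascent_step\<close>, and its eigenvalue is the largest one: otherwise induction for the arrangement at
  \<open>p\<close> reaches a chamber whose closure contains \<open>p + \<epsilon> q\<close>, where the quotient is larger.\<close>
lemma reach_top:
  assumes "arr \<Phi>" and "\<And>v. v \<in> span \<Phi> \<Longrightarrow> w v = v \<Longrightarrow> v = 0"
    and "\<And>v. v \<in> span \<Phi> \<Longrightarrow> v \<bullet> T v \<le> l * (v \<bullet> v)"
    and "T q = l *\<^sub>R q" and "regular \<Phi> c"
  shows "\<exists>d. (step \<Phi>)\<^sup>*\<^sup>* c d \<and> in_closure \<Phi> d q"
  using assms
proof (induction "card \<Phi>" arbitrary: \<Phi> c q rule: less_induct)
  case less
  note arr = less.prems(1) and nofix = less.prems(2) and top = less.prems(3)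
    and c = less.prems(5)
  note ar = arrD[OF arr]
  show ?case
  proof (cases "\<exists>\<alpha>\<in>\<Phi>. q \<bullet> \<alpha> \<noteq> 0")
    case False
    then have "in_closure \<Phi> c q" unfolding in_closure_def by auto
    then show ?thesis by blast
  next
    case True
    \<comment> \<open>The projection has the same products with all normals, hence the same closures
      contain it. It is again an eigenvector because the self-adjoint map \<open>T\<close> preserves
      both the span and its orthogonal complement.\<close>
    obtain q1 where q1: "q1 \<in> span \<Phi>" "\<And>v. v \<in> span \<Phi> \<Longrightarrow> (q - q1) \<bullet> v = 0"
      using orthogonal_projection_span[OF ar(2), of q] by metis
    have q1q: "q1 \<bullet> \<alpha> = q \<bullet> \<alpha>" if "\<alpha> \<in> \<Phi>" for \<alpha>
      using q1(2)[OF span_base[OF that]] by (simp add: inner_diff_left)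
    have q10: "q1 \<noteq> 0" using True q1q by auto
    have Tq1: "T q1 = l *\<^sub>R q1"
    proof -
      define z where "z = T q1 - l *\<^sub>R q1"
      have zs: "z \<in> span \<Phi>" unfolding z_def by (intro span_diff span_scale span_stable[OF arr] q1(1))
      have "z = - (T (q - q1) - l *\<^sub>R (q - q1))"
        unfolding z_def using linear_T less.prems(4) by (simp add: linear_diff algebra_simps)
      then have "z \<bullet> z = - (T (q - q1) \<bullet> z - l * ((q - q1) \<bullet> z))"
        by (metis inner_diff_left inner_minus_left inner_scaleR_left)
      also have "\<dots> = 0"
        using q1(2)[OF zs] q1(2)[OF span_stable(3)[OF arr zs]] by (simp add: T_adj)
      finally show ?thesis by (simp add: z_def)
    qed
    have IH: "\<exists>y. (step (loc \<Phi> p))\<^sup>*\<^sup>* x y \<and> in_closure (loc \<Phi> p) y r"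
      if "T p = \<mu> *\<^sub>R p" "p \<in> span \<Phi>" "p \<noteq> 0" "regular \<Phi> x" "T r = l *\<^sub>R r" for p x \<mu> r
    proof (rule less.hyps[OF card_loc_less[OF arr that(2,3)] arr_loc[OF arr that(1)]])
      have sub: "loc \<Phi> p \<subseteq> \<Phi>" unfolding loc_def by auto
      then have "span (loc \<Phi> p) \<subseteq> span \<Phi>" by (rule span_mono)
      then show "v = 0" if "v \<in> span (loc \<Phi> p)" "w v = v" for v using nofix that by blast
      show "v \<bullet> T v \<le> l * (v \<bullet> v)" if "v \<in> span (loc \<Phi> p)" for v
        using top that \<open>span (loc \<Phi> p) \<subseteq> span \<Phi>\<close> by blast
      show "T r = l *\<^sub>R r" by fact
      show "regular (loc \<Phi> p) x" using that(4) sub unfolding regular_def by blast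
    qed
    have "\<exists>d. (step \<Phi>)\<^sup>*\<^sup>* c d \<and> in_closure \<Phi> d q1"
    proof (cases "\<forall>v\<in>span \<Phi>. w v = - v")
      \<comment> \<open>Here \<open>w \<alpha> = w' \<alpha> = - \<alpha>\<close>, so every crossing
        is allowed. The case is split off because the detour at the end requires
        \<open>w p \<noteq> - p\<close>.\<close>
      case minus: True
      obtain d where d: "regular \<Phi> d" "\<forall>\<alpha>\<in>\<Phi>. (0 < q1 \<bullet> \<alpha> \<longrightarrow> 0 < d \<bullet> \<alpha>)"
        using lex_regular[OF arr c, of q1 0] by blast
      have "(step \<Phi>)\<^sup>*\<^sup>* c d"
      proof (rule gallery_induct[OF ar(1) c d(1)])
        fix x y assume "regular \<Phi> x" "regular \<Phi> y" "same_side \<Phi> x y"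
        then show "step \<Phi> x y" using step_same_side[OF arr] by blast
      next
        fix x y \<alpha> assume x: "regular \<Phi> x" "regular \<Phi> y" "sep \<Phi> x y = {\<alpha>}"
        then have a: "\<alpha> \<in> \<Phi>" "x \<bullet> \<alpha> < 0" unfolding sep_def by auto
        then have "w \<alpha> = - \<alpha>" using minus span_base by blast
        then have "\<not> (x \<bullet> w \<alpha> < 0 \<and> x \<bullet> w' \<alpha> < 0)" using a by simp
        from disp_le_cross[OF arr x this] show "step \<Phi> x y" using x unfolding step_def by simp
      qed
      then show ?thesis using d(2) unfolding in_closure_def by blast
    next
      case notminus: False
      have "\<Phi> \<noteq> {}" using True by blast
      then obtain p x where px: "(step \<Phi>)\<^sup>*\<^sup>* c x" "regular \<Phi> x" "p \<in> span \<Phi>" "p \<bullet> p = 1" "in_closure \<Phi> x p"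
        and max: "\<And>y v. (step \<Phi>)\<^sup>*\<^sup>* c y \<Longrightarrow> v \<in> span \<Phi> \<Longrightarrow> in_closure \<Phi> y v \<Longrightarrow> v \<bullet> T v \<le> (p \<bullet> T p) * (v \<bullet> v)"
        using maximal_point[OF arr c] by metis
      have p0: "p \<noteq> 0" using px(4) by auto
      define \<mu> where "\<mu> = p \<bullet> T p"
      have Tp: "T p = \<mu> *\<^sub>R p"
        unfolding \<mu>_def
      proof (rule rayleigh_eigenvector[OF px(4)])
        fix \<delta> :: real assume "\<delta> > 0"
        obtain d where d: "(step \<Phi>)\<^sup>*\<^sup>* x d"
          "\<And>\<alpha>. \<alpha> \<in> \<Phi> \<Longrightarrow> 0 < p \<bullet> \<alpha> \<or> p \<bullet> \<alpha> = 0 \<and> 0 < T p \<bullet> \<alpha> \<Longrightarrow> 0 < d \<bullet> \<alpha>"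
          using ascent_step[OF arr px(2,5)] by blast
        obtain \<epsilon> where e: "0 < \<epsilon>" "\<epsilon> < \<delta>" "\<And>\<alpha>. \<alpha> \<in> \<Phi> \<Longrightarrow>
          0 < (p + \<epsilon> *\<^sub>R T p) \<bullet> \<alpha> \<longleftrightarrow> 0 < p \<bullet> \<alpha> \<or> p \<bullet> \<alpha> = 0 \<and> 0 < T p \<bullet> \<alpha>"
          "\<And>\<alpha>. \<alpha> \<in> \<Phi> \<Longrightarrow>
          (p + \<epsilon> *\<^sub>R T p) \<bullet> \<alpha> < 0 \<longleftrightarrow> p \<bullet> \<alpha> < 0 \<or> p \<bullet> \<alpha> = 0 \<and> T p \<bullet> \<alpha> < 0"
          using lex_perturbation[OF ar(2) \<open>\<delta> > 0\<close>, of p "T p"] by auto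
        have "in_closure \<Phi> d (p + \<epsilon> *\<^sub>R T p)" unfolding in_closure_def using d(2) e(3) by blast
        then have "(p + \<epsilon> *\<^sub>R T p) \<bullet> T (p + \<epsilon> *\<^sub>R T p) \<le> (p \<bullet> T p) * ((p + \<epsilon> *\<^sub>R T p) \<bullet> (p + \<epsilon> *\<^sub>R T p))"
          using max rtranclp_trans[OF px(1) d(1)]
          by (intro max) (auto intro!: span_add span_scale span_stable[OF arr] px(3))
        then show "\<exists>\<epsilon>>0. \<epsilon> < \<delta> \<and>
          (p + \<epsilon> *\<^sub>R T p) \<bullet> T (p + \<epsilon> *\<^sub>R T p) \<le> (p \<bullet> T p) * ((p + \<epsilon> *\<^sub>R T p) \<bullet> (p + \<epsilon> *\<^sub>R T p))"
          using e by blast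
      qed
      have "\<mu> = l"
      proof (rule ccontr)
        assume "\<mu> \<noteq> l"
        moreover have "\<mu> \<le> l" using top[OF px(3)] px(4) by (simp add: \<mu>_def)
        ultimately have lt: "\<mu> < l" by simp
        \<comment> \<open>Eigenvectors of a self-adjoint map with different eigenvalues are
          orthogonal. The quotient at \<open>p + eps q1\<close> is then a weighted mean of
          \<open>\<mu>\<close> and \<open>l\<close>, which exceeds \<open>\<mu>\<close>.\<close>
        have "\<mu> * (p \<bullet> q1) = l * (p \<bullet> q1)" using T_adj[of p q1] Tp Tq1 by simp
        then have pq: "p \<bullet> q1 = 0" using lt by simp
        obtain d where d: "(step \<Phi>)\<^sup>*\<^sup>* x d"
          "\<And>\<alpha>. \<alpha> \<in> \<Phi> \<Longrightarrow> 0 < p \<bullet> \<alpha> \<or> p \<bullet> \<alpha> = 0 \<and> 0 < q1 \<bullet> \<alpha> \<Longrightarrow> 0 < d \<bullet> \<alpha>"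
          using towards[OF arr Tp px(2,5) IH[OF Tp px(3) p0 px(2) Tq1]] by blast
        obtain \<epsilon> where e: "0 < \<epsilon>" "\<epsilon> < 1" "\<And>\<alpha>. \<alpha> \<in> \<Phi> \<Longrightarrow>
          0 < (p + \<epsilon> *\<^sub>R q1) \<bullet> \<alpha> \<longleftrightarrow> 0 < p \<bullet> \<alpha> \<or> p \<bullet> \<alpha> = 0 \<and> 0 < q1 \<bullet> \<alpha>"
          "\<And>\<alpha>. \<alpha> \<in> \<Phi> \<Longrightarrow>
          (p + \<epsilon> *\<^sub>R q1) \<bullet> \<alpha> < 0 \<longleftrightarrow> p \<bullet> \<alpha> < 0 \<or> p \<bullet> \<alpha> = 0 \<and> q1 \<bullet> \<alpha> < 0"
          using lex_perturbation[OF ar(2), of 1 p q1] by auto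
        have "in_closure \<Phi> d (p + \<epsilon> *\<^sub>R q1)" unfolding in_closure_def using d(2) e(3) by blast
        then have "(p + \<epsilon> *\<^sub>R q1) \<bullet> T (p + \<epsilon> *\<^sub>R q1) \<le> \<mu> * ((p + \<epsilon> *\<^sub>R q1) \<bullet> (p + \<epsilon> *\<^sub>R q1))"
          using rtranclp_trans[OF px(1) d(1)] unfolding \<mu>_def
          by (intro max) (auto intro!: span_add span_scale px(3) q1(1))
        moreover have "(p + \<epsilon> *\<^sub>R q1) \<bullet> T (p + \<epsilon> *\<^sub>R q1) = \<mu> + \<epsilon>\<^sup>2 * l * (q1 \<bullet> q1)"
          using linear_T Tp Tq1 pq px(4)
          by (simp add: linear_add linear_scale inner_add inner_commute power2_eq_square)
        moreover have "(p + \<epsilon> *\<^sub>R q1) \<bullet> (p + \<epsilon> *\<^sub>R q1) = 1 + \<epsilon>\<^sup>2 * (q1 \<bullet> q1)"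
          using pq px(4) by (simp add: inner_add inner_commute power2_eq_square)
        ultimately have "\<mu> + \<epsilon>\<^sup>2 * l * (q1 \<bullet> q1) \<le> \<mu> * (1 + \<epsilon>\<^sup>2 * (q1 \<bullet> q1))" by (simp only:)
        then have "l * (\<epsilon>\<^sup>2 * (q1 \<bullet> q1)) \<le> \<mu> * (\<epsilon>\<^sup>2 * (q1 \<bullet> q1))" by (simp add: algebra_simps)
        moreover have "0 < \<epsilon>\<^sup>2 * (q1 \<bullet> q1)" using e(1) q10 by simp
        ultimately show False using lt by (simp add: mult_le_cancel_right)
      qed
      then have Tp: "T p = l *\<^sub>R p" using Tp by simp
      have move: "\<exists>d. (step \<Phi>)\<^sup>*\<^sup>* x d \<and> in_closure \<Phi> d r"
        if "T p = l *\<^sub>R p" "p \<in> span \<Phi>" "T r = l *\<^sub>R r" "r \<in> span \<Phi>" "\<And>t. t \<ge> 0 \<Longrightarrow> p + t *\<^sub>R r \<noteq> 0"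
          "regular \<Phi> x" "in_closure \<Phi> x p" for p r x
        by (rule move_top[OF arr that(3) _ that(1,2,4-7)]) (rule IH[OF _ _ _ _ that(3)])
      show ?thesis
      proof (cases "\<exists>t\<ge>0. p + t *\<^sub>R q1 = 0")
        case False
        then obtain d where "(step \<Phi>)\<^sup>*\<^sup>* x d" "in_closure \<Phi> d q1"
          using move[OF Tp px(3) Tq1 q1(1) _ px(2,5)] by blast
        then show ?thesis using px(1) by (meson rtranclp_trans)
      next
        \<comment> \<open>Now \<open>p\<close> is a negative multiple of \<open>q1\<close>, so the
          ray to \<open>q1\<close> runs through the origin. The vector \<open>w p\<close> has the
          same eigenvalue and norm as \<open>p\<close>; being different from \<open>p\<close> and
          \<open>- p\<close>, it allows a detour along two rays that both avoid the origin.\<close>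
        case True
        then obtain t where t: "t \<ge> 0" "p + t *\<^sub>R q1 = 0" by blast
        have wp: "w p \<in> span \<Phi>" using span_stable[OF arr px(3)] by blast
        have "T (w p) = w (T p)" using lin unfolding T_def by (simp add: linear_add)
        then have Twp: "T (w p) = l *\<^sub>R w p" using Tp lin by (simp add: linear_scale)
        have wpp: "w p \<noteq> - p"
        proof
          assume "w p = - p"
          then have "w' p = - p" using inv2[of p] by (metis minus_minus w_simps(2))
          then have "T p = (- 2) *\<^sub>R p" using \<open>w p = - p\<close> unfolding T_def by (simp add: scaleR_2)
          \<comment> \<open>On unit vectors \<open>2 * (v \<bullet> w v)\<close> is never below
            \<open>-2\<close>. If that is also its upper bound, it is attained everywhere, which
            forces \<open>w = -1\<close> on the span.\<close>
          then have "l = - 2" using Tp p0 by (metis scaleR_cancel_right)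
          have "w v = - v" if "v \<in> span \<Phi>" for v
          proof -
            have "(w v + v) \<bullet> (w v + v) = 2 * (v \<bullet> v) + v \<bullet> T v"
              using adj[of v v] by (simp add: inner_add iso T_def inner_commute)
            also have "\<dots> \<le> 0" using top[OF that] \<open>l = -2\<close> by simp
            finally have "w v + v = 0" by (metis antisym inner_eq_zero_iff inner_ge_zero)
            then show ?thesis by (simp add: add_eq_0_iff2)
          qed
          then show False using notminus by blast
        qed
        have "p + s *\<^sub>R w p \<noteq> 0" if "s \<ge> 0" for s
        proof
          assume *: "p + s *\<^sub>R w p = 0"
          then have "p = - (s *\<^sub>R w p)" by (simp add: eq_neg_iff_add_eq_0)
          then have "norm p = s * norm p" using that by (metis abs_of_nonneg norm_minus_cancel norm_scaleR norm_w)
          then have "s = 1" using p0 by simp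
          then show False using * wpp by (simp add: add_eq_0_iff)
        qed
        then obtain d where d: "(step \<Phi>)\<^sup>*\<^sup>* x d" "in_closure \<Phi> d (w p)"
          using move[OF Tp px(3) Twp wp _ px(2,5)] by blast
        have t0: "t > 0" using t p0 by (cases "t = 0") auto
        have "w p + s *\<^sub>R q1 \<noteq> 0" if "s \<ge> 0" for s
        proof
          assume *: "w p + s *\<^sub>R q1 = 0"
          have "t *\<^sub>R q1 = - p" using t(2) by (simp add: add_eq_0_iff)
          then have q: "q1 = - ((1/t) *\<^sub>R p)" using t0
            by (metis divide_inverse_commute mult.right_neutral scaleR_minus_right scaleR_scaleR scaleR_one right_inverse
                less_irrefl mult.commute)
          have "w p = (s / t) *\<^sub>R p" using * unfolding q by simp
          moreover from this have "norm p = (s / t) * norm p" using that t0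
            by (metis abs_of_nonneg divide_nonneg_pos norm_scaleR norm_w)
          then have "s / t = 1" using p0 by (metis mult_cancel_right1 norm_eq_zero)
          ultimately have "w p = p" by simp
          then show False using nofix px(3) p0 by blast
        qed
        then obtain d' where "(step \<Phi>)\<^sup>*\<^sup>* d d'" "in_closure \<Phi> d' q1"
          using move[OF Twp wp Tq1 q1(1) _ step_regular[OF d(1) px(2)] d(2)] by blast
        then show ?thesis using px(1) d(1) by (meson rtranclp_trans)
      qed
    qed
    then show ?thesis using q1q unfolding in_closure_def by auto
  qed
qed

text \<open>Starting from the least displacement no step can lower it, so every step preserves it
  and can be retraced.\<close>

lemma step_rev:
  assumes "(step \<Phi>)\<^sup>*\<^sup>* c d" "arr \<Phi>" "\<And>x. regular \<Phi> x \<Longrightarrow> disp \<Phi> c \<le> disp \<Phi> x"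
  shows "(step \<Phi>)\<^sup>*\<^sup>* d c \<and> disp \<Phi> d = disp \<Phi> c"
  using assms(1)
proof (induction rule: rtranclp_induct)
  case (step d e)
  then have de: "regular \<Phi> d" "regular \<Phi> e" "card (sep \<Phi> d e) \<le> 1" "disp \<Phi> e \<le> disp \<Phi> d"
    unfolding step_def by auto
  have eq: "disp \<Phi> e = disp \<Phi> d" using de step.IH assms(3)[OF de(2)] by simp
  have "sep \<Phi> e d = uminus ` sep \<Phi> d e"
  proof (intro equalityI subsetI)
    fix \<alpha> assume "\<alpha> \<in> sep \<Phi> e d"
    then show "\<alpha> \<in> uminus ` sep \<Phi> d e" using arrD(4)[OF assms(2)]
      unfolding sep_def by (auto intro!: image_eqI[of _ _ "- \<alpha>"])
  qed (use arrD(4)[OF assms(2)] in \<open>auto simp: sep_def\<close>)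
  then have "card (sep \<Phi> e d) \<le> 1" using de(3) by (simp add: card_image)
  then have "step \<Phi> e d" using de eq unfolding step_def by simp
  then have "(step \<Phi>)\<^sup>*\<^sup>* e c" using step.IH by (meson converse_rtranclp_into_rtranclp)
  then show ?case using step.IH eq by simp
qed auto

text \<open>Both \<open>c\<close> and \<open>d\<close> descend to chambers at a common top
  eigenvector. Minimality of \<open>d\<close> serves twice: it makes the path from \<open>d\<close>
  reversible, and it passes to the local arrangement because the full and local displacements differ
  there by a constant.\<close>

theorem min_disp_connected:
  assumes "arr \<Phi>" and "\<And>v. v \<in> span \<Phi> \<Longrightarrow> w v = v \<Longrightarrow> v = 0"
    and "regular \<Phi> c" "regular \<Phi> d" "\<And>x. regular \<Phi> x \<Longrightarrow> disp \<Phi> d \<le> disp \<Phi> x"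
  shows "(step \<Phi>)\<^sup>*\<^sup>* c d"
  using assms
proof (induction "card \<Phi>" arbitrary: \<Phi> c d rule: less_induct)
  case less
  note arr = less.prems(1) and nofix = less.prems(2) and c = less.prems(3) and d = less.prems(4,5)
  note ar = arrD[OF arr]
  show ?case
  proof (cases "\<Phi> = {}")
    case True
    then have "same_side \<Phi> c d" unfolding same_side_def by simp
    then show ?thesis using step_same_side[OF arr c d(1)] by blast
  next
    case False
    then obtain q l where q: "q \<in> span \<Phi>" "q \<noteq> 0" "T q = l *\<^sub>R q" and top: "\<And>v. v \<in> span \<Phi> \<Longrightarrow> v \<bullet> T v \<le> l * (v \<bullet> v)"
      using top_eigenvector[OF arr] by metis
    obtain c' where c': "(step \<Phi>)\<^sup>*\<^sup>* c c'" "in_closure \<Phi> c' q"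
      using reach_top[OF arr nofix top q(3) c] by blast
    obtain d' where d': "(step \<Phi>)\<^sup>*\<^sup>* d d'" "in_closure \<Phi> d' q"
      using reach_top[OF arr nofix top q(3) d(1)] by blast
    have rc': "regular \<Phi> c'" and rd': "regular \<Phi> d'"
      using step_regular c'(1) d'(1) c d(1) by blast+
    have d'd: "(step \<Phi>)\<^sup>*\<^sup>* d' d" "disp \<Phi> d' = disp \<Phi> d" using step_rev[OF d'(1) arr d(2)] by auto
    define U where "U = loc \<Phi> q"
    have arrU: "arr U" unfolding U_def using arr_loc[OF arr q(3)] .
    have sub: "U \<subseteq> \<Phi>" unfolding U_def loc_def by auto
    have regU: "regular U v" if "regular \<Phi> v" for v using that sub unfolding regular_def by blast
    have "(step U)\<^sup>*\<^sup>* c' d'"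
    proof (rule less.hyps)
      show "card U < card \<Phi>" unfolding U_def using card_loc_less[OF arr q(1,2)] .
      show "v = 0" if "v \<in> span U" "w v = v" for v using nofix that span_mono[OF sub] by blast
      fix x assume x: "regular U x"
      obtain e where e: "regular \<Phi> e" "\<forall>\<alpha>\<in>\<Phi>. (0 < q \<bullet> \<alpha> \<longrightarrow> 0 < e \<bullet> \<alpha>) \<and> (q \<bullet> \<alpha> < 0 \<longrightarrow> e \<bullet> \<alpha> < 0) \<and>
        (q \<bullet> \<alpha> = 0 \<and> x \<bullet> \<alpha> \<noteq> 0 \<longrightarrow> (0 < e \<bullet> \<alpha> \<longleftrightarrow> 0 < x \<bullet> \<alpha>))"
        using lex_regular[OF arr c] by blast
      have ecl: "in_closure \<Phi> e q" using e(2) unfolding in_closure_def by blast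
      have same: "same_side U x e"
        using e(2) x unfolding same_side_def U_def loc_def regular_def by auto
      have "disp \<Phi> d' \<le> disp \<Phi> e" using d(2)[OF e(1)] d'd(2) by simp
      then have "disp U d' \<le> disp U e"
        using disp_local[OF arr q(3) rd' d'(2)] disp_local[OF arr q(3) e(1) ecl] unfolding U_def by simp
      then show "disp U d' \<le> disp U x" using disp_cong[OF arrU x regU[OF e(1)] same] by simp
    qed (use arrU regU rc' rd' in auto)
    then have "(step \<Phi>)\<^sup>*\<^sup>* c' d'"
      using local_lift[OF arr q(3) rc' c'(2) _ rd' d'(2)] unfolding U_def same_side_def by blast
    then show ?thesis using c'(1) d'd(1) by (meson rtranclp_trans)
  qed
qed

end

subsection \<open>A Euclidean space over an arbitrary index type\<close>

text \<open>The dimension needed depends on \<open>W\<close> and \<open>S\<close>, which are sets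
  and not types. Finitely supported functions on the whole index type accommodate every choice of
  these finite sets.\<close>

typedef 'i fvec = "{f :: 'i \<Rightarrow> real. finite {x. f x \<noteq> 0}}"
  morphisms coord Fvec
  by (rule exI[of _ "\<lambda>_. 0"]) simp

lemma coord_finite: "finite {x. coord f x \<noteq> 0}"
  using coord[of f] by simp

lemma coord_Fvec: "finite A \<Longrightarrow> (\<And>x. x \<notin> A \<Longrightarrow> f x = 0) \<Longrightarrow> coord (Fvec f) = f"
proof -
  assume "finite A" "\<And>x. x \<notin> A \<Longrightarrow> f x = 0"
  then have "finite {x. f x \<noteq> 0}" by (metis (mono_tags, lifting) finite_subset mem_Collect_eq subsetI)
  then show ?thesis by (simp add: Fvec_inverse)
qed

lemma fvec_eqI: "(\<And>x. coord f x = coord g x) \<Longrightarrow> f = g"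
  by (metis coord_inject ext)

instantiation fvec :: (type) real_inner
begin

definition "0 = Fvec (\<lambda>_. 0)"
definition "f + g = Fvec (\<lambda>x. coord f x + coord g x)"
definition "f - g = Fvec (\<lambda>x. coord f x - coord g x)"
definition "- f = Fvec (\<lambda>x. - coord f x)"
definition "a *\<^sub>R f = Fvec (\<lambda>x. a * coord f x)"
definition "f \<bullet> g = (\<Sum>x | coord f x \<noteq> 0. coord f x * coord g x)"
definition "norm (f :: 'a fvec) = sqrt (f \<bullet> f)"
definition "dist (f :: 'a fvec) g = norm (f - g)"
definition "sgn (f :: 'a fvec) = inverse (norm f) *\<^sub>R f"
definition "(uniformity :: ('a fvec \<times> 'a fvec) filter) = (INF e\<in>{0<..}. principal {(x, y). dist x y < e})"
definition "open (U :: 'a fvec set) \<longleftrightarrow> (\<forall>x\<in>U. \<forall>\<^sub>F (x', y) in uniformity. x' = x \<longrightarrow> y \<in> U)"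

lemma coord_0: "coord 0 x = 0"
  unfolding zero_fvec_def by (subst coord_Fvec[of "{}"]) auto
lemma coord_add: "coord (f + g) x = coord f x + coord g x"
  unfolding plus_fvec_def
  by (subst coord_Fvec[of "{x. coord f x \<noteq> 0} \<union> {x. coord g x \<noteq> 0}"]) (auto simp: coord_finite)
lemma coord_diff: "coord (f - g) x = coord f x - coord g x"
  unfolding minus_fvec_def
  by (subst coord_Fvec[of "{x. coord f x \<noteq> 0} \<union> {x. coord g x \<noteq> 0}"]) (auto simp: coord_finite)
lemma coord_minus: "coord (- f) x = - coord f x"
  unfolding uminus_fvec_def
  by (subst coord_Fvec[of "{x. coord f x \<noteq> 0}"]) (auto simp: coord_finite)
lemma coord_scale: "coord (a *\<^sub>R f) x = a * coord f x"
  unfolding scaleR_fvec_def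
  by (subst coord_Fvec[of "{x. coord f x \<noteq> 0}"]) (auto simp: coord_finite)

lemmas coord_simps = coord_0 coord_add coord_diff coord_minus coord_scale

lemma inner_fvec:
  assumes "finite A" "\<And>x. x \<notin> A \<Longrightarrow> coord f x = 0"
  shows "f \<bullet> g = (\<Sum>x\<in>A. coord f x * coord g x)"
  unfolding inner_fvec_def by (rule sum.mono_neutral_left) (use assms in auto)

instance
proof
  fix f g h :: "'a fvec" and a b :: real
  show "f + g + h = f + (g + h)" "f + g = g + f" "0 + f = f" "- f + f = 0" "f - g = f + - g"
    "a *\<^sub>R (f + g) = a *\<^sub>R f + a *\<^sub>R g" "(a + b) *\<^sub>R f = a *\<^sub>R f + b *\<^sub>R f"
    "a *\<^sub>R b *\<^sub>R f = (a * b) *\<^sub>R f" "1 *\<^sub>R f = f"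
    by (rule fvec_eqI; simp add: coord_simps algebra_simps)+
  define A where "A = {x. coord f x \<noteq> 0} \<union> {x. coord g x \<noteq> 0} \<union> {x. coord h x \<noteq> 0}"
  have fin: "finite A" unfolding A_def by (simp add: coord_finite)
  have out: "coord f x = 0" "coord g x = 0" "coord h x = 0" if "x \<notin> A" for x using that unfolding A_def by auto
  have inA: "k \<bullet> l = (\<Sum>x\<in>A. coord k x * coord l x)" if "\<And>x. x \<notin> A \<Longrightarrow> coord k x = 0" for k l
    using inner_fvec[OF fin that] .
  show "f \<bullet> g = g \<bullet> f" using inA[of f g] inA[of g f] out by (simp add: mult.commute)
  show "(f + g) \<bullet> h = f \<bullet> h + g \<bullet> h"
    using inA[of f h] inA[of g h] inA[of "f + g" h] out by (simp add: coord_simps sum.distrib algebra_simps)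
  show "(a *\<^sub>R f) \<bullet> g = a * (f \<bullet> g)"
    using inA[of f g] inA[of "a *\<^sub>R f" g] out by (simp add: coord_simps sum_distrib_left mult.assoc)
  show "0 \<le> f \<bullet> f" unfolding inner_fvec_def by (intro sum_nonneg) auto
  show "f \<bullet> f = 0 \<longleftrightarrow> f = 0"
  proof
    assume "f \<bullet> f = 0"
    then have "\<forall>x\<in>{x. coord f x \<noteq> 0}. coord f x * coord f x = 0"
      unfolding inner_fvec_def using coord_finite by (subst (asm) sum_nonneg_eq_0_iff) auto
    then show "f = 0" by (intro fvec_eqI) (auto simp: coord_0)
  qed (simp add: inner_fvec_def coord_0)
qed (simp_all add: norm_fvec_def dist_fvec_def sgn_fvec_def uniformity_fvec_def open_fvec_def)

end

definition pull :: "('i \<Rightarrow> 'i) \<Rightarrow> 'i fvec \<Rightarrow> 'i fvec" where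
  "pull h f = Fvec (\<lambda>x. coord f (h x))"

lemma coord_pull: "bij h \<Longrightarrow> coord (pull h f) x = coord f (h x)"
proof -
  assume h: "bij h"
  have "finite (h -` {x. coord f x \<noteq> 0})"
    using h coord_finite by (intro finite_vimageI) (auto simp: bij_def)
  then show ?thesis unfolding pull_def by (subst coord_Fvec) auto
qed

lemma inner_pull:
  assumes h: "bij h"
  shows "pull h f \<bullet> pull h g = f \<bullet> g"
proof -
  have "f \<bullet> g = (\<Sum>x\<in>h ` (h -` {x. coord f x \<noteq> 0}). coord f x * coord g x)"
    using h surj_image_vimage_eq[of h "{x. coord f x \<noteq> 0}"] unfolding inner_fvec_def bij_def by simp
  also have "\<dots> = (\<Sum>x\<in>h -` {x. coord f x \<noteq> 0}. coord f (h x) * coord g (h x))"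
    using h by (subst sum.reindex) (auto simp: bij_def inj_on_def)
  finally show ?thesis unfolding inner_fvec_def[of "pull h f"] by (simp add: coord_pull[OF h] vimage_def)
qed

lemma linear_pull: "bij h \<Longrightarrow> linear (pull h)"
  by (rule linearI) (auto intro!: fvec_eqI simp: coord_pull coord_simps)

lemma pull_inv:
  assumes h: "bij h"
  shows "pull h (pull (inv_into UNIV h) f) = f" "pull (inv_into UNIV h) (pull h f) = f"
  using bij_imp_bij_inv[OF h] bij_is_inj[OF h] bij_is_surj[OF h]
  by (auto intro!: fvec_eqI simp: coord_pull[OF h] coord_pull surj_f_inv_f inv_into_f_f)

subsection \<open>Coxeter groups\<close>

lemma cox_prod_Nil [simp]: "cox_prod G [] = \<one>\<^bsub>G\<^esub>"
  and cox_prod_Cons [simp]: "cox_prod G (s # ss) = s \<otimes>\<^bsub>G\<^esub> cox_prod G ss"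
  by (simp_all add: cox_prod_def)

lemma (in group) cox_prod_closed: "set ss \<subseteq> carrier G \<Longrightarrow> cox_prod G ss \<in> carrier G"
  by (induction ss) auto

lemma (in group) cox_prod_append:
  "set ss \<subseteq> carrier G \<Longrightarrow> set tt \<subseteq> carrier G \<Longrightarrow>
    cox_prod G (ss @ tt) = cox_prod G ss \<otimes> cox_prod G tt"
  by (induction ss) (auto simp: cox_prod_closed m_assoc)

locale coxeter = group G for G (structure) +
  fixes W S :: "'a set"
  assumes cs: "coxeter_system G W S"
begin

abbreviation prd :: "'a list \<Rightarrow> 'a" where "prd \<equiv> cox_prod G"
abbreviation len :: "'a \<Rightarrow> nat" where "len \<equiv> cox_lenW G S"

definition reduced :: "'a list \<Rightarrow> bool" where
  "reduced ss \<longleftrightarrow> set ss \<subseteq> S \<and> length ss = len (prd ss)"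

definition par :: "'a set \<Rightarrow> 'a set" where
  "par I = {prd ss | ss. set ss \<subseteq> I}"

lemma W_subgroup: "subgroup W G" and S_W: "s \<in> S \<Longrightarrow> s \<in> W"
  and S_ne: "s \<in> S \<Longrightarrow> s \<noteq> \<one>" and S_sq: "s \<in> S \<Longrightarrow> s \<otimes> s = \<one>"
  and W_gen: "x \<in> W \<Longrightarrow> \<exists>ss. set ss \<subseteq> S \<and> x = prd ss"
  using cs unfolding coxeter_system_def by blast+

lemma W_carrier: "x \<in> W \<Longrightarrow> x \<in> carrier G"
  using subgroup.mem_carrier[OF W_subgroup] .

lemma S_carrier: "s \<in> S \<Longrightarrow> s \<in> carrier G"
  using W_carrier S_W by blast

lemma S_sub: "S \<subseteq> carrier G" using S_carrier by blast

lemma set_carrier: "set ss \<subseteq> S \<Longrightarrow> set ss \<subseteq> carrier G"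
  using S_sub by blast

lemma W_mult: "x \<in> W \<Longrightarrow> y \<in> W \<Longrightarrow> x \<otimes> y \<in> W" and W_inv: "x \<in> W \<Longrightarrow> inv x \<in> W"
  and W_one: "\<one> \<in> W"
  using W_subgroup by (auto simp: subgroup.m_closed subgroup.m_inv_closed subgroup.one_closed)

lemma prd_carrier: "set ss \<subseteq> S \<Longrightarrow> prd ss \<in> carrier G"
  using cox_prod_closed set_carrier by blast

lemma prd_append: "set ss \<subseteq> S \<Longrightarrow> set tt \<subseteq> S \<Longrightarrow> prd (ss @ tt) = prd ss \<otimes> prd tt"
  using cox_prod_append set_carrier by blast

lemma prd_W: "set ss \<subseteq> S \<Longrightarrow> prd ss \<in> W"
  by (induction ss) (auto simp: W_one W_mult S_W)

lemma inv_S: "s \<in> S \<Longrightarrow> inv s = s"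
  using inv_equality[OF S_sq S_carrier S_carrier] .

lemma S_cancel: "s \<in> S \<Longrightarrow> x \<in> carrier G \<Longrightarrow> s \<otimes> (s \<otimes> x) = x"
  by (simp add: m_assoc[symmetric] S_carrier S_sq)

lemma S_cancel': "s \<in> S \<Longrightarrow> x \<in> carrier G \<Longrightarrow> x \<otimes> s \<otimes> s = x"
  by (simp add: m_assoc S_carrier S_sq)

lemma prd_rev: "set ss \<subseteq> S \<Longrightarrow> prd (rev ss) = inv (prd ss)"
  by (induction ss) (auto simp: prd_append prd_carrier S_carrier inv_mult_group inv_S)

section \<open>Length and the exchange condition\<close>

lemma len_le: "set ss \<subseteq> S \<Longrightarrow> len (prd ss) \<le> length ss"
  unfolding cox_lenW_def by (rule Least_le) blast

lemma reduced_ex: "x \<in> W \<Longrightarrow> \<exists>ss. reduced ss \<and> prd ss = x"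
proof -
  assume "x \<in> W"
  then obtain ss where ss: "set ss \<subseteq> S" "x = prd ss" using W_gen by blast
  then have "\<exists>n ss. set ss \<subseteq> S \<and> length ss = n \<and> x = prd ss" by blast
  then have "\<exists>ss. set ss \<subseteq> S \<and> length ss = len x \<and> x = prd ss"
    unfolding cox_lenW_def by (rule LeastI_ex)
  then show ?thesis unfolding reduced_def by blast
qed

lemma len_one [simp]: "len \<one> = 0"
  using len_le[of "[]"] by simp

lemma len_0: "x \<in> W \<Longrightarrow> len x = 0 \<longleftrightarrow> x = \<one>"
  using reduced_ex[of x] unfolding reduced_def by auto

lemma len_mult: "x \<in> W \<Longrightarrow> y \<in> W \<Longrightarrow> len (x \<otimes> y) \<le> len x + len y"
proof -
  assume "x \<in> W" "y \<in> W"
  then obtain a b where "reduced a" "prd a = x" "reduced b" "prd b = y" using reduced_ex by metis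
  then show ?thesis using len_le[of "a @ b"] prd_append[of a b] unfolding reduced_def by auto
qed

lemma len_inv: "x \<in> W \<Longrightarrow> len (inv x) = len x"
proof -
  have le: "len (inv x) \<le> len x" if x: "x \<in> W" for x
  proof -
    obtain a where a: "reduced a" "prd a = x" using reduced_ex[OF x] by blast
    then have "inv x = prd (rev a)" using prd_rev unfolding reduced_def by metis
    then show ?thesis using len_le[of "rev a"] a unfolding reduced_def by simp
  qed
  assume x: "x \<in> W"
  then show ?thesis using le[OF x] le[OF W_inv[OF x]] W_carrier by (simp add: antisym)
qed

lemma len_S: "s \<in> S \<Longrightarrow> len s = 1"
proof -
  assume s: "s \<in> S"
  then have "len s \<le> 1" using len_le[of "[s]"] S_carrier by simp
  moreover have "len s \<noteq> 0" using len_0 S_ne S_W s by blast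
  ultimately show ?thesis by simp
qed

lemma exchange:
  assumes "reduced ss" "s \<in> S" "len (s \<otimes> prd ss) \<le> len (prd ss)"
  obtains a t b where "ss = a @ t # b" "s \<otimes> prd ss = prd (a @ b)"
proof -
  have "\<exists>i < length ss. s \<otimes> prd ss = prd (take i ss @ drop (Suc i) ss)"
    using cs assms unfolding coxeter_system_def reduced_def by blast
  then obtain i where "i < length ss" "s \<otimes> prd ss = prd (take i ss @ drop (Suc i) ss)" by blast
  then show ?thesis using that id_take_nth_drop by blast
qed

text \<open>The exchange condition is stated with \<open>\<le>\<close> and deletes a letter, so a
  product that is not longer is strictly shorter; equality of the two lengths is thereby
  excluded.\<close>

lemma len_left:
  assumes "x \<in> W" "s \<in> S"
  shows "len (s \<otimes> x) = Suc (len x) \<or> len x = Suc (len (s \<otimes> x))"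
proof -
  obtain ss where ss: "reduced ss" "prd ss = x" using reduced_ex[OF assms(1)] by blast
  have up: "len (s \<otimes> x) \<le> Suc (len x)" using len_mult[OF S_W[OF assms(2)] assms(1)] len_S[OF assms(2)] by simp
  have sx: "s \<otimes> x \<in> W" using W_mult S_W assms by blast
  have dn: "len x \<le> Suc (len (s \<otimes> x))"
    using len_mult[OF S_W[OF assms(2)] sx] len_S[OF assms(2)] S_cancel[OF assms(2) W_carrier[OF assms(1)]] by simp
  show ?thesis
  proof (cases "len (s \<otimes> x) \<le> len x")
    case True
    then obtain a t b where "ss = a @ t # b" "s \<otimes> x = prd (a @ b)" using exchange[OF ss(1) assms(2)] ss(2) by metis
    then have "len (s \<otimes> x) < len x" using len_le[of "a @ b"] ss unfolding reduced_def by auto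
    then show ?thesis using dn by simp
  qed (use up in simp)
qed

lemma len_right:
  assumes "x \<in> W" "s \<in> S"
  shows "len (x \<otimes> s) = Suc (len x) \<or> len x = Suc (len (x \<otimes> s))"
proof -
  have "inv (x \<otimes> s) = s \<otimes> inv x" using assms W_carrier S_carrier by (simp add: inv_mult_group inv_S)
  then have "len (x \<otimes> s) = len (s \<otimes> inv x)" using len_inv[of "x \<otimes> s"] W_mult S_W assms by simp
  then show ?thesis using len_left[OF W_inv[OF assms(1)] assms(2)] len_inv[OF assms(1)] by simp
qed

lemma reduced_append:
  assumes "reduced (a @ b)"
  shows "reduced a" "reduced b"
proof -
  have S: "set a \<subseteq> S" "set b \<subseteq> S" using assms unfolding reduced_def by auto
  have "length a + length b \<le> len (prd a) + len (prd b)"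
    using assms len_mult[OF prd_W[OF S(1)] prd_W[OF S(2)]] prd_append[OF S] unfolding reduced_def by simp
  then show "reduced a" "reduced b" using S len_le[OF S(1)] len_le[OF S(2)] unfolding reduced_def by auto
qed

lemma reduced_Cons: "reduced (s # ss) \<Longrightarrow> reduced ss"
  using reduced_append(2)[of "[s]" ss] by simp

lemma reduced_rev:
  assumes "reduced a" shows "reduced (rev a)"
  using assms prd_rev[of a] len_inv[OF prd_W[of a]] unfolding reduced_def by simp

lemma descent_word:
  assumes "x \<in> W" "s \<in> S" "len (s \<otimes> x) < len x"
  obtains rr where "reduced (s # rr)" "prd (s # rr) = x"
proof -
  have sx: "s \<otimes> x \<in> W" using W_mult S_W assms by blast
  obtain rr where rr: "reduced rr" "prd rr = s \<otimes> x" using reduced_ex[OF sx] by blast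
  then have x: "prd (s # rr) = x" using S_cancel assms W_carrier by simp
  have "len x = Suc (len (s \<otimes> x))" using len_left assms by fastforce
  then have "reduced (s # rr)" using rr x assms(2) unfolding reduced_def by simp
  then show ?thesis using that x by blast
qed

text \<open>Exchange only deletes letters, so a word can be reduced without introducing new ones.
  Every statement about supports goes back to this.\<close>

lemma reduced_subword:
  assumes "set ss \<subseteq> S"
  shows "\<exists>rr. reduced rr \<and> set rr \<subseteq> set ss \<and> prd rr = prd ss"
  using assms
proof (induction ss)
  case Nil
  then show ?case by (auto simp: reduced_def intro: exI[of _ "[]"])
next
  case (Cons s ss)
  then obtain rr where rr: "reduced rr" "set rr \<subseteq> set ss" "prd rr = prd ss" by auto
  have s: "s \<in> S" using Cons by simp
  have W: "prd rr \<in> W" using rr prd_W unfolding reduced_def by blast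
  show ?case
  proof (cases "len (s \<otimes> prd rr) \<le> len (prd rr)")
    case True
    then obtain a t b where abt: "rr = a @ t # b" "s \<otimes> prd rr = prd (a @ b)" using exchange[OF rr(1) s] by metis
    have "len (prd rr) = Suc (len (s \<otimes> prd rr))" using len_left[OF W s] True by auto
    then have "reduced (a @ b)" using rr(1) abt unfolding reduced_def by auto
    then show ?thesis using abt rr by (intro exI[of _ "a @ b"]) auto
  next
    case False
    then have "reduced (s # rr)" using rr(1) s len_left[OF W s] unfolding reduced_def by auto
    then show ?thesis using rr by (intro exI[of _ "s # rr"]) auto
  qed
qed

section \<open>Standard parabolic subgroups and their cosets\<close>

lemma S_in_word:
  assumes "t \<in> S" "set ss \<subseteq> S" "t = prd ss"
  shows "t \<in> set ss"
proof -
  obtain rr where rr: "reduced rr" "set rr \<subseteq> set ss" "prd rr = t" using reduced_subword[OF assms(2)] assms(3) by auto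
  then have "length rr = 1" using len_S[OF assms(1)] unfolding reduced_def by simp
  then obtain r where "rr = [r]" by (auto simp: length_Suc_conv)
  then show ?thesis using rr S_carrier unfolding reduced_def by auto
qed

lemma par_W: "I \<subseteq> S \<Longrightarrow> x \<in> par I \<Longrightarrow> x \<in> W"
  unfolding par_def using prd_W by blast

lemma par_mult: "I \<subseteq> S \<Longrightarrow> x \<in> par I \<Longrightarrow> y \<in> par I \<Longrightarrow> x \<otimes> y \<in> par I"
proof -
  assume I: "I \<subseteq> S" and "x \<in> par I" "y \<in> par I"
  then obtain a b where "set a \<subseteq> I" "x = prd a" "set b \<subseteq> I" "y = prd b" unfolding par_def by blast
  then have "x \<otimes> y = prd (a @ b)" "set (a @ b) \<subseteq> I" using prd_append[of a b] I by auto
  then show ?thesis unfolding par_def by blast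
qed

lemma par_inv: "I \<subseteq> S \<Longrightarrow> x \<in> par I \<Longrightarrow> inv x \<in> par I"
proof -
  assume I: "I \<subseteq> S" and "x \<in> par I"
  then obtain a where "set a \<subseteq> I" "x = prd a" unfolding par_def by blast
  then have "inv x = prd (rev a)" "set (rev a) \<subseteq> I" using prd_rev[of a] I by auto
  then show ?thesis unfolding par_def by blast
qed

lemma par_one: "\<one> \<in> par I"
  unfolding par_def by (auto intro!: exI[of _ "[]"])

lemma par_gen: "I \<subseteq> S \<Longrightarrow> s \<in> I \<Longrightarrow> s \<in> par I"
  unfolding par_def using S_carrier by (auto intro!: exI[of _ "[s]"])

lemma par_S: "par S = W"
  using W_gen prd_W unfolding par_def by blast

lemma par_subgroup: "I \<subseteq> S \<Longrightarrow> subgroup (par I) G"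
proof (rule subgroupI)
  assume I: "I \<subseteq> S"
  show "par I \<subseteq> carrier G" using par_W[OF I] W_carrier by blast
  show "par I \<noteq> {}" using par_one by blast
qed (auto intro: par_mult par_inv)

lemma S_in_par: "I \<subseteq> S \<Longrightarrow> t \<in> S \<Longrightarrow> t \<in> par I \<Longrightarrow> t \<in> I"
  unfolding par_def using S_in_word by blast

text \<open>The first letter of \<open>tt\<close> is a descent, so exchange in a reduced word over
  \<open>I\<close> keeps the remaining product in \<open>par I\<close>; the first letter is then a
  quotient of two elements of \<open>par I\<close>. In particular the support does not depend on the
  reduced word.\<close>

lemma reduced_in_par:
  assumes "reduced tt" "I \<subseteq> S" "prd tt \<in> par I"
  shows "set tt \<subseteq> I"
  using assms(1,3)
proof (induction tt)
  case (Cons t tt)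
  have red: "reduced tt" using reduced_Cons[OF Cons.prems(1)] .
  have t: "t \<in> S" and ttS: "set tt \<subseteq> S" using Cons.prems(1) unfolding reduced_def by auto
  define x where "x = prd (t # tt)"
  obtain ss where ss: "set ss \<subseteq> I" "prd ss = x" using Cons.prems(2) unfolding par_def x_def by auto
  obtain rr where rr: "reduced rr" "set rr \<subseteq> I" "prd rr = x" using reduced_subword[of ss] ss assms(2) by blast
  have tx: "t \<otimes> x = prd tt" using S_cancel[OF t prd_carrier[OF ttS]] unfolding x_def by simp
  have "len (t \<otimes> prd rr) \<le> len (prd rr)"
    using tx rr Cons.prems(1) red unfolding reduced_def x_def by simp
  then obtain a u b where "rr = a @ u # b" "t \<otimes> prd rr = prd (a @ b)" using exchange[OF rr(1) t] by metis
  then have ttI: "prd tt \<in> par I" using tx rr unfolding par_def by (auto intro!: exI[of _ "a @ b"])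
  have "t = x \<otimes> inv (prd tt)"
    unfolding x_def using prd_carrier[OF ttS] S_carrier[OF t] by (simp add: m_assoc)
  then have "t \<in> par I" using Cons.prems(2) ttI par_mult par_inv assms(2) unfolding x_def by metis
  then show ?case using S_in_par[OF assms(2) t] Cons.IH[OF red ttI] by simp
qed simp

text \<open>Take \<open>y\<close> of least length in the coset. If prepending a letter to a
  concatenated word failed to lengthen it, exchange would delete a letter either of the parabolic
  part, which is reduced, or of \<open>yy\<close>, which would give a shorter element of the
  coset.\<close>

lemma coset_rep:
  assumes I: "I \<subseteq> S" and x: "x \<in> W"
  obtains a y where "a \<in> par I" "y \<in> W" "x = a \<otimes> y" "\<And>b. b \<in> par I \<Longrightarrow> len (b \<otimes> y) = len b + len y"
proof -
  define A where "A = {a \<otimes> x | a. a \<in> par I}"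
  have "x \<in> A" unfolding A_def using par_one W_carrier[OF x] by force
  define y where "y = arg_min len (\<lambda>y. y \<in> A)"
  have yA: "y \<in> A" and ymin: "\<And>z. z \<in> A \<Longrightarrow> len y \<le> len z"
    using arg_min_nat_lemma[of "\<lambda>y. y \<in> A" x len] \<open>x \<in> A\<close> unfolding y_def by auto
  then obtain a where a: "a \<in> par I" "y = a \<otimes> x" unfolding A_def by blast
  have aW: "a \<in> W" using par_W[OF I a(1)] .
  have yW: "y \<in> W" using a aW x W_mult by blast
  have A_mult: "b \<otimes> y \<in> A" if "b \<in> par I" for b
  proof -
    have "b \<otimes> y = (b \<otimes> a) \<otimes> x" using that a aW x par_W[OF I that] W_carrier by (simp add: m_assoc)
    then show ?thesis using par_mult[OF I that a(1)] unfolding A_def by blast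
  qed
  obtain yy where yy: "reduced yy" "prd yy = y" using reduced_ex[OF yW] by blast
  have add: "reduced bb \<Longrightarrow> set bb \<subseteq> I \<Longrightarrow> reduced (bb @ yy)" for bb
  proof (induction bb)
    case (Cons s bb)
    have s: "s \<in> I" "s \<in> S" and bI: "set bb \<subseteq> I" and bS: "set bb \<subseteq> S"
      using Cons.prems(2) I by auto
    have rb: "reduced bb" using reduced_Cons[OF Cons.prems(1)] .
    have yS: "set yy \<subseteq> S" using yy unfolding reduced_def by blast
    have red: "reduced (bb @ yy)" using Cons.IH rb bI by blast
    show ?case
    proof (rule ccontr)
      assume "\<not> reduced ((s # bb) @ yy)"
      then have "len (s \<otimes> prd (bb @ yy)) \<le> len (prd (bb @ yy))"
        using len_left[OF prd_W[of "bb @ yy"] s(2)] red s(2) unfolding reduced_def by auto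
      then obtain c t d where ctd: "bb @ yy = c @ t # d" "s \<otimes> prd (bb @ yy) = prd (c @ d)"
        using exchange[OF red s(2)] by metis
      show False
      proof (cases "length c < length bb")
        case True
        then obtain d1 where d1: "bb = c @ t # d1" "d = d1 @ yy"
          using ctd(1) by (auto simp: append_eq_append_conv2 append_eq_Cons_conv)
        have S: "set c \<subseteq> S" "set d1 \<subseteq> S" using bS d1 by auto
        have "(s \<otimes> prd bb) \<otimes> prd yy = prd (c @ d1) \<otimes> prd yy"
          using ctd(2) prd_append[OF bS yS] prd_append[of "c @ d1" yy] S yS d1(2) S_carrier[OF s(2)]
            prd_carrier[OF bS] prd_carrier[OF yS] by (simp add: m_assoc)
        then have "s \<otimes> prd bb = prd (c @ d1)"
          using prd_carrier[of "c @ d1"] prd_carrier[OF yS] prd_carrier[OF bS] S S_carrier[OF s(2)] by simp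
        then have "len (prd (s # bb)) \<le> length (c @ d1)" using len_le[of "c @ d1"] S by auto
        then show False using Cons.prems(1) d1(1) unfolding reduced_def by simp
      next
        case False
        then obtain c1 where c1: "c = bb @ c1" "yy = c1 @ t # d"
          using ctd(1) by (auto simp: append_eq_append_conv2 append_eq_Cons_conv)
        have S: "set c1 \<subseteq> S" "set d \<subseteq> S" using yS c1 by auto
        have bc: "prd bb \<in> carrier G" "prd (c1 @ d) \<in> carrier G" "prd yy \<in> carrier G"
          using prd_carrier bS S yS by auto
        have "s \<otimes> prd bb \<otimes> prd yy = prd bb \<otimes> prd (c1 @ d)"
          using ctd(2) prd_append[OF bS yS] prd_append[of bb "c1 @ d"] S bS c1 S_carrier[OF s(2)] bc
          by (simp add: m_assoc)
        then have "prd (c1 @ d) = (inv (prd bb) \<otimes> (s \<otimes> prd bb)) \<otimes> y"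
          using bc S_carrier[OF s(2)] yy(2) by (metis inv_solve_left m_assoc m_closed inv_closed)
        moreover have "prd bb \<in> par I" "s \<in> par I" using bI par_gen[OF I s(1)] unfolding par_def by auto
        ultimately have "prd (c1 @ d) \<in> A" using A_mult par_mult[OF I] par_inv[OF I] by metis
        then have "len y \<le> len (prd (c1 @ d))" by (rule ymin)
        also have "\<dots> \<le> length (c1 @ d)" using S by (intro len_le) auto
        also have "\<dots> < length yy" using c1 by simp
        finally show False using yy unfolding reduced_def by simp
      qed
    qed
  qed (use yy in simp)
  show ?thesis
  proof (rule that[of "inv a" y])
    show "inv a \<in> par I" using par_inv[OF I a(1)] .
    show "x = inv a \<otimes> y" using a aW x W_carrier by (simp add: m_assoc[symmetric])
    fix b assume b: "b \<in> par I"
    obtain bb where bb: "reduced bb" "prd bb = b" using reduced_ex[OF par_W[OF I b]] by blast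
    have "set bb \<subseteq> I" using reduced_in_par[OF bb(1) I] bb(2) b by simp
    then have "reduced (bb @ yy)" using add bb(1) by blast
    then show "len (b \<otimes> y) = len b + len y"
      using bb yy prd_append[of bb yy] unfolding reduced_def by auto
  qed (rule yW)
qed

end

subsection \<open>The geometric representation\<close>

fun alt :: "'a \<Rightarrow> 'a \<Rightarrow> nat \<Rightarrow> 'a list" where
  "alt s t 0 = []"
| "alt s t (Suc k) = s # alt t s k"

lemma length_alt [simp]: "length (alt s t k) = k"
  by (induction k arbitrary: s t) auto

lemma set_alt: "set (alt s t k) \<subseteq> {s, t}"
proof (induction k arbitrary: s t)
  case (Suc k)
  then show ?case using Suc[of t s] by auto
qed simp

lemma alt_append: "alt s t (i + j) = alt s t i @ (if even i then alt s t j else alt t s j)"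
  by (induction i arbitrary: s t) auto

lemma alt_snoc: "alt s t (Suc k) = alt s t k @ [if even k then s else t]"
  using alt_append[of s t k 1] by simp

lemma rev_alt: "rev (alt t s k) = (if even k then alt s t k else alt t s k)"
proof (induction k arbitrary: s t)
  case (Suc k)
  show ?case
    by (simp only: alt.simps rev.simps Suc) (use alt_snoc[of s t k] alt_snoc[of t s k] in \<open>auto\<close>)
qed simp

text \<open>In the group the reversed word is the inverse, so \<open>(s t)^k = 1\<close> exactly
  when the two alternating words of length \<open>k\<close> have the same product.\<close>

lemma alt_double: "alt s t (2 * k) = alt s t k @ rev (alt t s k)"
  using alt_append[of s t k k] rev_alt[of t s k] by (simp add: mult_2)

locale finite_coxeter = coxeter +
  assumes finite_W: "finite W"
begin

lemma finite_S: "finite S"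
  using finite_subset[OF _ finite_W] S_W by blast

lemma prd_alt_double:
  assumes "s \<in> S" "t \<in> S"
  shows "prd (alt s t (2 * k)) = (s \<otimes> t) [^] k"
proof (induction k)
  case (Suc k)
  have "prd (alt s t (2 * Suc k)) = (s \<otimes> t) \<otimes> (s \<otimes> t) [^] k"
    using Suc assms S_carrier by (simp add: m_assoc)
  then show ?case using assms S_carrier by (metis m_closed nat_pow_Suc2)
qed simp

definition m :: "'a \<Rightarrow> 'a \<Rightarrow> nat" where "m s t = ord (s \<otimes> t)"

lemma m_pow:
  assumes "s \<in> S" "t \<in> S"
  shows "(s \<otimes> t) [^] (n::nat) = \<one> \<longleftrightarrow> m s t dvd n"
  unfolding m_def using pow_eq_id[of "s \<otimes> t" n] assms S_carrier by simp

lemma m_pos: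
  assumes "s \<in> S" "t \<in> S"
  shows "m s t > 0"
proof -
  define x where "x = s \<otimes> t"
  have x: "x \<in> W" "x \<in> carrier G" unfolding x_def using assms W_mult S_W W_carrier by auto
  have "x [^] (n::nat) \<in> W" for n
    by (induction n) (auto simp: W_one W_mult x)
  then have "finite (range (\<lambda>n::nat. x [^] n))" using finite_subset[OF _ finite_W] by blast
  then have "\<not> inj (\<lambda>n::nat. x [^] n)" using finite_imageD infinite_UNIV_nat by blast
  then obtain i j :: nat where ij: "x [^] i = x [^] j" "i \<noteq> j" unfolding inj_on_def by blast
  have "\<exists>n::nat. n > 0 \<and> x [^] n = \<one>"
  proof -
    have *: "x [^] (j - i) = \<one>" if "x [^] i = x [^] j" "i < j" for i j :: nat
    proof -
      have "x [^] i \<otimes> x [^] (j - i) = x [^] i \<otimes> \<one>"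
        using that(2) x nat_pow_mult[of x i "j - i"] that(1)[symmetric] by simp
      then show ?thesis using x by simp
    qed
    show ?thesis
    proof (cases "i < j")
      case True
      then show ?thesis using *[OF ij(1)] by (intro exI[of _ "j - i"]) simp
    next
      case False
      then show ?thesis using *[of j i] ij by (intro exI[of _ "i - j"]) simp
    qed
  qed
  then obtain n :: nat where "n > 0" "x [^] n = \<one>" by blast
  then have "m s t dvd n" using m_pow[OF assms] unfolding x_def by blast
  then show ?thesis using \<open>n > 0\<close> by (auto intro: Nat.gr0I)
qed

lemma m_sym: "s \<in> S \<Longrightarrow> t \<in> S \<Longrightarrow> m s t = m t s"
proof -
  assume st: "s \<in> S" "t \<in> S"
  have "inv (s \<otimes> t) = t \<otimes> s" using st S_carrier inv_S by (simp add: inv_mult_group)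
  then show ?thesis unfolding m_def using ord_inv[of "s \<otimes> t"] st S_carrier by simp
qed

lemma m_self: "s \<in> S \<Longrightarrow> m s s = 1"
  unfolding m_def by (simp add: S_sq)

lemma m_ge_2: "s \<in> S \<Longrightarrow> t \<in> S \<Longrightarrow> s \<noteq> t \<Longrightarrow> m s t \<ge> 2"
proof (rule ccontr)
  assume st: "s \<in> S" "t \<in> S" "s \<noteq> t" and "\<not> m s t \<ge> 2"
  then have "m s t = 1" using m_pos[OF st(1,2)] by simp
  then have "(s \<otimes> t) [^] (1::nat) = \<one>" using m_pow[OF st(1,2), of 1] by simp
  then have "s \<otimes> t = \<one>" using st S_carrier by simp
  then have "s = inv t" using st S_carrier by (simp add: inv_equality)
  then show False using st inv_S by simp
qed

text \<open>Since \<open>(s t)^m = 1\<close>, an alternating word of length \<open>m + 1\<close>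
  equals the inverse of the remaining \<open>m - 1\<close> letters and is therefore not
  reduced.\<close>

lemma reduced_alt_le:
  assumes "s \<in> S" "t \<in> S" "reduced (alt s t n)"
  shows "n \<le> m s t"
proof (rule ccontr)
  define k where "k = m s t"
  assume "\<not> n \<le> m s t"
  then have n: "n = Suc k + (n - Suc k)" unfolding k_def by simp
  have "reduced (alt s t (Suc k))"
    using assms(3) reduced_append(1) alt_append[of s t "Suc k" "n - Suc k"] n by metis
  then have len: "len (prd (alt s t (Suc k))) = Suc k" unfolding reduced_def by (simp only: length_alt)
  have k0: "k > 0" unfolding k_def using m_pos assms by blast
  define r where "r = (if even (Suc k) then alt s t (k - 1) else alt t s (k - 1))"
  have S: "set (alt s t (Suc k)) \<subseteq> S" "set r \<subseteq> S"
    using set_alt[of s t "Suc k"] set_alt[of s t "k-1"] set_alt[of t s "k-1"] assms unfolding r_def by auto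
  have "alt s t (2 * k) = alt s t (Suc k) @ r"
    using alt_append[of s t "Suc k" "k - 1"] k0 unfolding r_def by (simp add: mult_2)
  then have "prd (alt s t (Suc k)) \<otimes> prd r = \<one>"
    using prd_alt_double[OF assms(1,2), of k] m_pow[OF assms(1,2), of k] prd_append[OF S] unfolding k_def by simp
  then have "prd (alt s t (Suc k)) = inv (prd r)"
    using prd_carrier S by (metis inv_equality inv_inv)
  then have "len (prd (alt s t (Suc k))) \<le> length r"
    using len_inv[OF prd_W[OF S(2)]] len_le[OF S(2)] by simp
  moreover have "length r = k - 1" unfolding r_def by simp
  ultimately show False using len by simp
qed

lemma reduced_dihedral:
  assumes "reduced rr" "set rr \<subseteq> {s, t}" "rr = [] \<or> hd rr = s"
  shows "rr = alt s t (length rr)"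
  using assms
proof (induction rr arbitrary: s t)
  case (Cons a rr)
  have a: "a = s" using Cons.prems by simp
  have "rr = [] \<or> hd rr = t"
  proof (rule ccontr)
    assume "\<not> (rr = [] \<or> hd rr = t)"
    then obtain r where r: "rr = s # r" using Cons.prems(2) by (cases rr) auto
    have S: "set r \<subseteq> S" "s \<in> S" using Cons.prems(1) unfolding reduced_def r by auto
    have "prd (a # rr) = prd r" using S_cancel[OF S(2) prd_carrier[OF S(1)]] a r by simp
    then show False using len_le[OF S(1)] Cons.prems(1) r unfolding reduced_def by simp
  qed
  then have "rr = alt t s (length rr)"
    using Cons.IH[OF reduced_Cons[OF Cons.prems(1)], of t s] Cons.prems(2) by auto
  then show ?case using a by simp
qed simp

text \<open>Split \<open>x\<close> along the dihedral subgroup of \<open>s\<close> and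
  \<open>t\<close>. The dihedral factor inherits both descents, so it has a reduced word beginning
  with each letter, and reduced dihedral words alternate. This yields two reduced words of
  \<open>x\<close> that differ by a braid move at the front.\<close>

lemma two_descents:
  assumes st: "s \<in> S" "t \<in> S" and xW: "x \<in> W"
    and desc: "len (s \<otimes> x) < len x" "len (t \<otimes> x) < len x"
  obtains k yy where "reduced (alt s t (Suc k) @ yy)" "reduced (alt t s (Suc k) @ yy)"
    "prd (alt s t (Suc k)) = prd (alt t s (Suc k))"
    "prd (alt s t (Suc k) @ yy) = x" "prd (alt t s (Suc k) @ yy) = x"
proof -
  have I: "{s, t} \<subseteq> S" using st by simp
  obtain d y where dy: "d \<in> par {s, t}" "y \<in> W" "x = d \<otimes> y"
    "\<And>b. b \<in> par {s, t} \<Longrightarrow> len (b \<otimes> y) = len b + len y"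
    using coset_rep[OF I xW] by metis
  have dW: "d \<in> W" using par_W[OF I dy(1)] .
  have alt: "reduced (alt a b (len d)) \<and> prd (alt a b (len d)) = d"
    if ab: "{a, b} = {s, t}" "len (a \<otimes> x) < len x" for a b
  proof -
    have a: "a \<in> {s, t}" "a \<in> S" using ab I by auto
    have ad: "a \<otimes> d \<in> par {s, t}" using par_mult[OF I par_gen[OF I a(1)] dy(1)] .
    have "a \<otimes> x = (a \<otimes> d) \<otimes> y" using dy(2,3) dW W_carrier S_carrier[OF a(2)] by (simp add: m_assoc)
    then have "len (a \<otimes> d) < len d" using dy(3) dy(4)[OF ad] dy(4)[OF dy(1)] ab(2) by simp
    then obtain rr where rr: "reduced (a # rr)" "prd (a # rr) = d" using descent_word[OF dW a(2)] by metis
    have "set (a # rr) \<subseteq> {a, b}" using reduced_in_par[OF rr(1) I] rr(2) dy(1) ab(1) by simp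
    then have "a # rr = alt a b (length (a # rr))" using reduced_dihedral[OF rr(1), of a b] by simp
    moreover have "length (a # rr) = len d" using rr unfolding reduced_def by simp
    ultimately show ?thesis using rr by metis
  qed
  have A: "reduced (alt s t (len d))" "prd (alt s t (len d)) = d"
    "reduced (alt t s (len d))" "prd (alt t s (len d)) = d"
    using alt[of s t] alt[of t s] desc by auto
  obtain yy where yy: "reduced yy" "prd yy = y" using reduced_ex[OF dy(2)] by blast
  have dne: "d \<noteq> \<one>"
  proof
    assume "d = \<one>"
    then have "x = y" using dy W_carrier by simp
    moreover have "len (s \<otimes> y) = len s + len y" using dy(4) par_gen[OF I] by simp
    ultimately show False using desc by simp
  qed
  then obtain k where k: "len d = Suc k" using len_0[OF dW] by (cases "len d") auto
  have red: "reduced (alt a b (len d) @ yy) \<and> prd (alt a b (len d) @ yy) = x"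
    if "reduced (alt a b (len d))" "prd (alt a b (len d)) = d" for a b
  proof -
    have S2: "set (alt a b (len d)) \<subseteq> S" "set yy \<subseteq> S" using that yy unfolding reduced_def by auto
    have pr: "prd (alt a b (len d) @ yy) = x" using prd_append[OF S2] that yy dy by simp
    moreover have "length (alt a b (len d) @ yy) = len x"
      using dy(3) dy(4)[OF dy(1)] yy unfolding reduced_def by simp
    ultimately show ?thesis unfolding reduced_def using S2 by simp
  qed
  show ?thesis
    using that[of k yy] red[OF A(1,2)] red[OF A(3,4)] A(2,4) k by metis
qed

section \<open>The reflection representation\<close>

definition B :: "'a \<Rightarrow> 'a \<Rightarrow> real" where "B s t = - cos (pi / m s t)"
text \<open>The symmetric form given by \<open>B\<close>, paired with the basis vector of
  \<open>s\<close>. Vectors are functions on the ambient type of which only the values on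
  \<open>S\<close> enter.\<close>

definition bs :: "'a \<Rightarrow> ('a \<Rightarrow> real) \<Rightarrow> real" where "bs s v = (\<Sum>u\<in>S. B s u * v u)"
definition e :: "'a \<Rightarrow> 'a \<Rightarrow> real" where "e s = (\<lambda>r. if r = s then 1 else 0)"
definition refl :: "'a \<Rightarrow> ('a \<Rightarrow> real) \<Rightarrow> 'a \<Rightarrow> real" where
  "refl s v = (\<lambda>r. v r - 2 * bs s v * e s r)"
definition acts :: "'a list \<Rightarrow> ('a \<Rightarrow> real) \<Rightarrow> 'a \<Rightarrow> real" where
  "acts ss v = foldr refl ss v"

lemma acts_simps [simp]: "acts [] v = v" "acts (s # ss) v = refl s (acts ss v)"
  "acts (ss @ tt) v = acts ss (acts tt v)"
  by (simp_all add: acts_def)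

lemma B_self: "s \<in> S \<Longrightarrow> B s s = 1"
  unfolding B_def by (simp add: m_self)

lemma B_sym: "s \<in> S \<Longrightarrow> t \<in> S \<Longrightarrow> B s t = B t s"
  unfolding B_def using m_sym by simp

lemma bs_lin: "bs s (\<lambda>r. a * v r + b * u r) = a * bs s v + b * bs s u"
  unfolding bs_def by (simp add: sum_distrib_left sum.distrib algebra_simps)

lemma bs_e: "t \<in> S \<Longrightarrow> bs s (e t) = B s t"
  unfolding bs_def e_def using finite_S by (simp add: if_distrib cong: if_cong)

lemma refl_lin: "refl s (\<lambda>r. a * v r + b * u r) = (\<lambda>r. a * refl s v r + b * refl s u r)"
  unfolding refl_def by (simp add: bs_lin algebra_simps)

lemma acts_lin: "acts ss (\<lambda>r. a * v r + b * u r) = (\<lambda>r. a * acts ss v r + b * acts ss u r)"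
  by (induction ss) (auto simp: refl_lin)

lemma bs_refl: "s \<in> S \<Longrightarrow> bs t (refl s v) = bs t v - 2 * bs s v * B t s"
  unfolding refl_def using bs_lin[of t 1 v "- 2 * bs s v" "e s"] bs_e[of s t] by simp

lemma refl_invol: "s \<in> S \<Longrightarrow> refl s (refl s v) = v"
proof
  fix r assume s: "s \<in> S"
  show "refl s (refl s v) r = v r"
    unfolding refl_def[of s "refl s v"] bs_refl[OF s] B_self[OF s] by (simp add: refl_def)
qed

lemma acts_rev: "set ss \<subseteq> S \<Longrightarrow> acts ss (acts (rev ss) v) = v"
  by (induction ss arbitrary: v) (auto simp: refl_invol)

lemma acts_rev': "set ss \<subseteq> S \<Longrightarrow> acts (rev ss) (acts ss v) = v"
  using acts_rev[of "rev ss" v] by simp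

lemma refl_plane:
  assumes "s \<in> S" "t \<in> S"
  shows "refl s (\<lambda>r. x * e s r + y * e t r) = (\<lambda>r. (- x - 2 * B s t * y) * e s r + y * e t r)"
  unfolding refl_def bs_lin using assms by (simp add: bs_e B_self algebra_simps)

lemma refl_plane':
  assumes "s \<in> S" "t \<in> S"
  shows "refl t (\<lambda>r. x * e s r + y * e t r) = (\<lambda>r. x * e s r + (- y - 2 * B s t * x) * e t r)"
  unfolding refl_def bs_lin using assms B_sym[of s t] by (simp add: bs_e B_self algebra_simps)

text \<open>The product of the two reflections rotates the plane of \<open>e s\<close> and
  \<open>e t\<close> by twice the angle \<open>pi / m s t\<close>, and it fixes every vector
  annihilated by both forms. Each vector is a sum of one of either kind because the form is
  nondegenerate on the plane.\<close>

lemma braid_acts: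
  assumes st: "s \<in> S" "t \<in> S" "s \<noteq> t" and k: "m s t dvd k"
  shows "acts (alt s t (2 * k)) v = v"
proof -
  define \<theta> where "\<theta> = pi / m s t"
  have m2: "m s t \<ge> 2" using m_ge_2[OF st] .
  have \<theta>: "0 < \<theta>" "\<theta> < pi" unfolding \<theta>_def using m2 by (auto simp: field_simps)
  then have sin: "sin \<theta> > 0" by (rule sin_gt_zero)
  have Bst: "B s t = - cos \<theta>" unfolding B_def \<theta>_def by simp
  define g where "g \<phi> = (\<lambda>r. sin \<phi> * e s r + sin (\<phi> + \<theta>) * e t r)" for \<phi>
  have R: "refl s (refl t (g \<phi>)) = g (\<phi> - 2 * \<theta>)" for \<phi>
  proof -
    have "refl t (g \<phi>) = (\<lambda>r. sin \<phi> * e s r + sin (\<phi> - \<theta>) * e t r)"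
      unfolding g_def refl_plane'[OF st(1,2)] Bst
      by (simp add: sin_add sin_diff algebra_simps)
    then have "refl s (refl t (g \<phi>)) = (\<lambda>r. (- sin \<phi> + 2 * cos \<theta> * sin (\<phi> - \<theta>)) * e s r + sin (\<phi> - \<theta>) * e t r)"
      using refl_plane[OF st(1,2)] Bst by simp
    also have "- sin \<phi> + 2 * cos \<theta> * sin (\<phi> - \<theta>) = sin (\<phi> - 2 * \<theta>)"
    proof -
      define A where "A = \<phi> - \<theta>"
      have "\<phi> = A + \<theta>" "\<phi> - 2 * \<theta> = A - \<theta>" by (simp_all add: A_def)
      then show ?thesis unfolding A_def[symmetric] by (simp add: sin_add sin_diff algebra_simps)
    qed
    finally show ?thesis unfolding g_def by (simp add: algebra_simps)
  qed
  have Rk: "acts (alt s t (2 * k)) (g \<phi>) = g (\<phi> - 2 * k * \<theta>)" for k \<phi>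
    by (induction k) (auto simp: R algebra_simps)
  obtain j where j: "k = m s t * j" using k by blast
  have "2 * real k * \<theta> = 2 * pi * real j" unfolding j \<theta>_def using m2 by simp
  then have Rg: "acts (alt s t (2 * k)) (g \<phi>) = g \<phi>" for \<phi>
  proof -
    assume a: "2 * real k * \<theta> = 2 * pi * real j"
    have *: "sin (x - 2 * real k * \<theta>) = sin x" for x
    proof -
      have "cos (2 * pi * real j) = 1" "sin (2 * pi * real j) = 0"
        using cos_int_2pin[of "int j"] sin_int_2pin[of "int j"] by (simp_all add: mult_ac)
      then show ?thesis unfolding a by (simp add: sin_diff)
    qed
    have "\<phi> - 2 * real k * \<theta> + \<theta> = \<phi> + \<theta> - 2 * real k * \<theta>" by simp
    then have "g (\<phi> - 2 * real k * \<theta>) = g \<phi>" unfolding g_def by (simp only: *)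
    then show ?thesis using Rk by simp
  qed
  define c where "c = cos \<theta>"
  have c1: "1 - c\<^sup>2 > 0" unfolding c_def using sin by (simp add: sin_squared_eq[symmetric])
  \<comment> \<open>The component of \<open>v\<close> in the plane, from the linear system
    \<open>x - c y = bs s v\<close>, \<open>y - c x = bs t v\<close> with determinant
    \<open>1 - c^2 > 0\<close>.\<close>
  define x where "x = (bs s v + c * bs t v) / (1 - c\<^sup>2)"
  define y where "y = (bs t v + c * bs s v) / (1 - c\<^sup>2)"
  have xy0: "x * (1 - c\<^sup>2) = bs s v + c * bs t v" "y * (1 - c\<^sup>2) = bs t v + c * bs s v"
    unfolding x_def y_def using c1 by simp_all
  have "(x - c * y) * (1 - c\<^sup>2) = bs s v * (1 - c\<^sup>2)" "(y - c * x) * (1 - c\<^sup>2) = bs t v * (1 - c\<^sup>2)"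
    unfolding left_diff_distrib mult.assoc xy0 by (simp_all add: algebra_simps power2_eq_square)
  then have xy: "x - c * y = bs s v" "y - c * x = bs t v" using c1 by simp_all
  define pl where "pl = (\<lambda>r. x * e s r + y * e t r)"
  define u where "u = (\<lambda>r. 1 * v r + (- 1) * pl r)"
  have bpl: "bs s pl = bs s v" "bs t pl = bs t v"
    unfolding pl_def bs_lin using st xy B_sym[of t s] by (simp_all add: bs_e B_self Bst c_def algebra_simps)
  have bu: "bs s u = 0" "bs t u = 0" unfolding u_def bs_lin bpl by simp_all
  have "refl s u = u" "refl t u = u" unfolding refl_def bu by simp_all
  then have ufix: "acts (alt s t (2 * k)) u = u" for k
    by (induction k) auto
  have v: "v = (\<lambda>r. 1 * u r + 1 * pl r)" unfolding u_def by simp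
  \<comment> \<open>The vectors \<open>g (- \<theta>)\<close> and \<open>g 0\<close> are nonzero
    multiples of \<open>e s\<close> and \<open>e t\<close>.\<close>
  have pl: "pl = (\<lambda>r. (- x / sin \<theta>) * g (- \<theta>) r + (y / sin \<theta>) * g 0 r)"
    unfolding pl_def g_def using sin by (auto simp: fun_eq_iff)
  have "acts (alt s t (2 * k)) pl = pl"
    by (subst (1 2) pl) (simp only: acts_lin Rg)
  then show ?thesis
    by (subst (1 2) v) (simp only: acts_lin ufix)
qed

lemma acts_alt_eq:
  assumes st: "s \<in> S" "t \<in> S" and eq: "prd (alt s t k) = prd (alt t s k)"
  shows "acts (alt s t k) v = acts (alt t s k) v"
proof (cases "s = t")
  case False
  have S: "set (alt s t k) \<subseteq> S" "set (alt t s k) \<subseteq> S" using set_alt[of s t k] set_alt[of t s k] st by auto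
  have "(s \<otimes> t) [^] k = prd (alt s t k) \<otimes> inv (prd (alt t s k))"
    using prd_alt_double[OF st, of k] alt_double[of s t k] prd_append[of "alt s t k" "rev (alt t s k)"] S prd_rev by simp
  then have "(s \<otimes> t) [^] k = \<one>" using eq prd_carrier[OF S(2)] by simp
  then have "m s t dvd k" using m_pow[OF st] by blast
  from braid_acts[OF st False this, of "acts (alt t s k) v"]
  show ?thesis unfolding alt_double using acts_rev'[OF S(2)] by simp
qed simp

text \<open>Matsumoto's argument. If the first letters agree, cancel them. Otherwise both are
  descents, and the two words of \<open>two_descents\<close> serve as intermediate stages: each
  shares its first letter with one of the given words, and they are linked by a braid move, which
  acts correctly.\<close>

lemma reduced_acts:
  assumes "reduced p" "reduced q" "prd p = prd q"
  shows "acts p v = acts q v"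
  using assms
proof (induction "length p" arbitrary: p q v rule: less_induct)
  case less
  have leq: "length p = length q" using less.prems unfolding reduced_def by simp
  have IH: "acts (s # p') v = acts (s # q') v"
    if "reduced (s # p')" "reduced (s # q')" "prd (s # p') = prd (s # q')" "length (s # p') = length p" for s p' q'
  proof -
    have "s \<in> S" "set p' \<subseteq> S" "set q' \<subseteq> S" using that unfolding reduced_def by auto
    then have "prd p' = prd q'" using that(3) prd_carrier S_carrier by simp
    then have "acts p' v = acts q' v"
      using less.hyps[of p' q' v] that reduced_Cons by auto
    then show ?thesis by simp
  qed
  show ?case
  proof (cases "p = []")
    case True
    then show ?thesis using leq by simp
  next
    case False
    then obtain s p' t q' where pq: "p = s # p'" "q = t # q'" using leq by (cases p; cases q) auto
    have st: "s \<in> S" "t \<in> S" and S': "set p' \<subseteq> S" "set q' \<subseteq> S"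
      using less.prems pq unfolding reduced_def by auto
    define x where "x = prd p"
    have xW: "x \<in> W" unfolding x_def using less.prems(1) prd_W unfolding reduced_def by blast
    have desc: "len (s \<otimes> x) < len x" "len (t \<otimes> x) < len x"
    proof -
      have "s \<otimes> x = prd p'" unfolding x_def pq using S_cancel[OF st(1) prd_carrier[OF S'(1)]] by simp
      then show "len (s \<otimes> x) < len x" using len_le[OF S'(1)] less.prems(1) unfolding reduced_def x_def pq by simp
      have xq: "x = prd q" unfolding x_def using less.prems(3) .
      then have "t \<otimes> x = prd q'" unfolding pq using S_cancel[OF st(2) prd_carrier[OF S'(2)]] by simp
      then show "len (t \<otimes> x) < len x" using len_le[OF S'(2)] less.prems(2) unfolding xq reduced_def pq by simp
    qed
    show ?thesis
    proof (cases "s = t")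
      case True
      then show ?thesis using IH[of s p' q'] less.prems pq by simp
    next
      case False
      obtain k yy where k: "reduced (alt s t (Suc k) @ yy)" "reduced (alt t s (Suc k) @ yy)"
        "prd (alt s t (Suc k)) = prd (alt t s (Suc k))"
        "prd (alt s t (Suc k) @ yy) = x" "prd (alt t s (Suc k) @ yy) = x"
        using two_descents[OF st xW desc] by metis
      have r1: "reduced (s # alt t s k @ yy)" "prd (s # alt t s k @ yy) = x" using k by simp_all
      have r2: "reduced (t # alt s t k @ yy)" "prd (t # alt s t k @ yy) = x" using k by simp_all
      have lx: "length p = len x" using less.prems(1) unfolding reduced_def x_def by blast
      have "acts p v = acts (s # alt t s k @ yy) v"
        using IH[of s p' "alt t s k @ yy"] less.prems(1) r1 pq x_def by simp
      also have "\<dots> = acts (alt s t (Suc k)) (acts yy v)" by simp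
      also have "\<dots> = acts (alt t s (Suc k)) (acts yy v)" using acts_alt_eq[OF st k(3)] by simp
      also have "\<dots> = acts (t # alt s t k @ yy) v" by simp
      also have "\<dots> = acts q v"
      proof -
        have "length (t # alt s t k @ yy) = length p" using r2 lx unfolding reduced_def by simp
        then show ?thesis
          using IH[of t "alt s t k @ yy" q'] less.prems(2,3) r2 pq x_def by simp
      qed
      finally show ?thesis .
    qed
  qed
qed

definition rho :: "'a \<Rightarrow> ('a \<Rightarrow> real) \<Rightarrow> 'a \<Rightarrow> real" where
  "rho x = acts (SOME ss. reduced ss \<and> prd ss = x)"

lemma rho_reduced: "reduced ss \<Longrightarrow> acts ss v = rho (prd ss) v"
proof -
  assume ss: "reduced ss"
  then have "\<exists>rr. reduced rr \<and> prd rr = prd ss" by blast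
  from someI_ex[OF this] show ?thesis unfolding rho_def using reduced_acts[OF ss] by metis
qed

text \<open>Extends the previous fact to words that are not reduced: prepending a letter either
  gives a longer element or cancels the first letter of a suitable reduced word, and
  \<open>refl\<close> is an involution.\<close>

lemma acts_rho: "set ss \<subseteq> S \<Longrightarrow> acts ss v = rho (prd ss) v"
proof (induction ss)
  case Nil
  show ?case by (rule rho_reduced) (simp add: reduced_def)
next
  case (Cons s ss)
  have s: "s \<in> S" and ss: "set ss \<subseteq> S" using Cons by auto
  define y where "y = prd ss"
  have yW: "y \<in> W" unfolding y_def using prd_W[OF ss] .
  have IH: "acts ss v = rho y v" using Cons unfolding y_def by simp
  show ?case
  proof (cases "len (s \<otimes> y) < len y")
    case True
    obtain rr where rr: "reduced (s # rr)" "prd (s # rr) = y" using descent_word[OF yW s True] by metis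
    have rS: "set rr \<subseteq> S" using rr unfolding reduced_def by auto
    have "rho y v = refl s (acts rr v)" using rho_reduced[OF rr(1)] rr(2) by simp
    then have "refl s (rho y v) = acts rr v" using refl_invol[OF s] by simp
    also have "\<dots> = rho (prd rr) v" using rho_reduced reduced_Cons rr(1) by blast
    also have "prd rr = s \<otimes> y" using S_cancel[OF s prd_carrier[OF rS]] rr(2) by simp
    finally show ?thesis using IH unfolding y_def by simp
  next
    case False
    obtain rr where rr: "reduced rr" "prd rr = y" using reduced_ex[OF yW] by blast
    then have "reduced (s # rr)" using False len_left[OF yW s] s unfolding reduced_def by auto
    from rho_reduced[OF this, of v] show ?thesis using IH rr rho_reduced[OF rr(1), of v] unfolding y_def by simp
  qed
qed

lemma rho_mult: "x \<in> W \<Longrightarrow> y \<in> W \<Longrightarrow> rho (x \<otimes> y) v = rho x (rho y v)"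
proof -
  assume "x \<in> W" "y \<in> W"
  then obtain a b where ab: "set a \<subseteq> S" "x = prd a" "set b \<subseteq> S" "y = prd b" using W_gen by metis
  then show ?thesis using acts_rho[of "a @ b" v] acts_rho[of a "acts b v"] acts_rho[of b v] prd_append[of a b] by auto
qed

lemma rho_one: "rho \<one> v = v" using acts_rho[of "[]" v] by simp

lemma rho_S: "s \<in> S \<Longrightarrow> rho s v = refl s v"
  using acts_rho[of "[s]" v] S_carrier by simp

lemma rho_lin: "rho x (\<lambda>r. a * v r + b * u r) = (\<lambda>r. a * rho x v r + b * rho x u r)"
  unfolding rho_def by (rule acts_lin)

lemma rho_inv: "x \<in> W \<Longrightarrow> rho (inv x) (rho x v) = v" "x \<in> W \<Longrightarrow> rho x (rho (inv x) v) = v"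
  using rho_mult[of "inv x" x v] rho_mult[of x "inv x" v] W_inv W_carrier rho_one by auto

lemma refl_e: "s \<in> S \<Longrightarrow> refl s (e s) = (\<lambda>r. - e s r)"
  unfolding refl_def by (simp add: bs_e B_self)

lemma coset_rep_right:
  assumes I: "I \<subseteq> S" and x: "x \<in> W"
  obtains a y where "a \<in> par I" "y \<in> W" "x = y \<otimes> a" "\<And>b. b \<in> par I \<Longrightarrow> len (y \<otimes> b) = len y + len b"
proof -
  obtain a y where ay: "a \<in> par I" "y \<in> W" "inv x = a \<otimes> y" "\<And>b. b \<in> par I \<Longrightarrow> len (b \<otimes> y) = len b + len y"
    using coset_rep[OF I W_inv[OF x]] by metis
  have aW: "a \<in> W" using par_W[OF I ay(1)] .
  show ?thesis
  proof (rule that[of "inv a" "inv y"])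
    show "inv a \<in> par I" using par_inv[OF I ay(1)] .
    show "inv y \<in> W" using W_inv[OF ay(2)] .
    have "x = inv (a \<otimes> y)" using ay(3) W_carrier[OF x] inv_inv by metis
    then show "x = inv y \<otimes> inv a" using ay(2) aW W_carrier by (simp add: inv_mult_group)
    fix b assume b: "b \<in> par I"
    have bW: "b \<in> W" using par_W[OF I b] .
    have "inv y \<otimes> b = inv (inv b \<otimes> y)" using bW ay(2) W_carrier by (simp add: inv_mult_group)
    then have "len (inv y \<otimes> b) = len (inv b \<otimes> y)" using len_inv W_mult W_inv bW ay(2) by metis
    then show "len (inv y \<otimes> b) = len (inv y) + len b"
      using ay(4)[OF par_inv[OF I b]] len_inv bW ay(2) by simp
  qed
qed

text \<open>The coefficients are \<open>sin (j * \<theta>) / sin \<theta>\<close> for two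
  consecutive \<open>j\<close>, by the addition theorem. They are nonnegative as long as
  \<open>j * \<theta>\<close> does not exceed \<open>pi\<close>, which is where
  \<open>k < m s t\<close> enters.\<close>

lemma dihedral_pos:
  assumes st: "s \<in> S" "t \<in> S" "s \<noteq> t" and k: "k < m s t"
  shows "\<exists>a\<ge>0. \<exists>b\<ge>0. acts (rev (alt t s k)) (e s) = (\<lambda>r. a * e s r + b * e t r)"
proof -
  define \<theta> where "\<theta> = pi / m s t"
  have m2: "m s t \<ge> 2" using m_ge_2[OF st] .
  have \<theta>: "0 < \<theta>" "\<theta> < pi" unfolding \<theta>_def using m2 by (auto simp: field_simps)
  then have sin: "sin \<theta> > 0" by (rule sin_gt_zero)
  have Bst: "B s t = - cos \<theta>" unfolding B_def \<theta>_def by simp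
  define f where "f k = sin (real k * \<theta>) / sin \<theta>" for k
  have f: "f 0 = 0" "f 1 = 1" unfolding f_def using sin by auto
  have rec: "- f k + 2 * cos \<theta> * f (Suc k) = f (Suc (Suc k))" for k
  proof -
    define A where "A = real (Suc k) * \<theta>"
    have "real k * \<theta> = A - \<theta>" "real (Suc (Suc k)) * \<theta> = A + \<theta>" unfolding A_def by (simp_all add: algebra_simps)
    then have fA: "f k = sin (A - \<theta>) / sin \<theta>" "f (Suc k) = sin A / sin \<theta>" "f (Suc (Suc k)) = sin (A + \<theta>) / sin \<theta>"
      unfolding f_def A_def by simp_all
    have "- sin (A - \<theta>) + 2 * cos \<theta> * sin A = sin (A + \<theta>)" by (simp add: sin_add sin_diff)
    then show ?thesis unfolding fA by (metis (no_types) add_divide_distrib minus_divide_left times_divide_eq_right)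
  qed
  have form: "acts (rev (alt t s k)) (e s) = (if even k then (\<lambda>r. f (Suc k) * e s r + f k * e t r)
      else (\<lambda>r. f k * e s r + f (Suc k) * e t r))" for k
  proof (induction k)
    case 0
    then show ?case using f by (simp add: One_nat_def)
  next
    case (Suc k)
    show ?case
    proof (cases "even k")
      case True
      have "acts (rev (alt t s (Suc k))) (e s) = refl t (\<lambda>r. f (Suc k) * e s r + f k * e t r)"
        unfolding alt_snoc using Suc True by simp
      then show ?thesis unfolding refl_plane'[OF st(1,2)] Bst using rec[of k] True by simp
    next
      case False
      have "acts (rev (alt t s (Suc k))) (e s) = refl s (\<lambda>r. f k * e s r + f (Suc k) * e t r)"
        unfolding alt_snoc using Suc False by simp
      then show ?thesis unfolding refl_plane[OF st(1,2)] Bst using rec[of k] False by simp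
    qed
  qed
  have nonneg: "f j \<ge> 0" if "j \<le> m s t" for j
  proof -
    have "real j * \<theta> \<le> pi" unfolding \<theta>_def using that m2 by (simp add: field_simps)
    then show ?thesis unfolding f_def using sin \<theta> by (intro divide_nonneg_pos sin_ge_zero) auto
  qed
  have "f k \<ge> 0" "f (Suc k) \<ge> 0" using nonneg k by auto
  then show ?thesis using form[of k] by (cases "even k") auto
qed

text \<open>Choose a right descent \<open>t\<close> of \<open>x\<close> and split
  \<open>x = y v\<close> along the dihedral subgroup of \<open>s\<close> and \<open>t\<close>. Then
  \<open>v\<close> maps \<open>e s\<close> to a nonnegative combination of \<open>e s\<close> and
  \<open>e t\<close>, and \<open>y\<close> is shorter and lengthened by both letters, so induction
  applies to it.\<close>

lemma rho_pos:
  assumes "x \<in> W" "s \<in> S" "len (x \<otimes> s) > len x"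
  shows "0 \<le> rho x (e s) r"
  using assms
proof (induction "len x" arbitrary: x s r rule: less_induct)
  case less
  show ?case
  proof (cases "x = \<one>")
    case True
    then show ?thesis by (simp add: rho_one e_def)
  next
    case False
    obtain xx where xx: "reduced xx" "prd xx = inv x" using reduced_ex[OF W_inv[OF less.prems(1)]] by blast
    have "inv x \<noteq> \<one>" using False less.prems(1) W_carrier by (metis inv_inv inv_one)
    then obtain t r0 where xt: "xx = t # r0" using xx by (cases xx) auto
    have t: "t \<in> S" and r0: "set r0 \<subseteq> S" using xx xt unfolding reduced_def by auto
    have "t \<otimes> inv x = prd r0" using xx(2) xt S_cancel[OF t prd_carrier[OF r0]] by auto
    then have "len (t \<otimes> inv x) < len (inv x)" using xx xt len_le[OF r0] unfolding reduced_def by auto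
    moreover have "inv (t \<otimes> inv x) = x \<otimes> t" using t less.prems(1) W_carrier S_carrier inv_S by (simp add: inv_mult_group)
    ultimately have xtlt: "len (x \<otimes> t) < len x"
      using len_inv[OF less.prems(1)] len_inv[of "t \<otimes> inv x"] W_mult W_inv S_W t less.prems(1) by metis
    have st: "s \<noteq> t" using xtlt less.prems(3) by auto
    have I: "{s, t} \<subseteq> S" using t less.prems by simp
    obtain v y where vy: "v \<in> par {s, t}" "y \<in> W" "x = y \<otimes> v"
      "\<And>b. b \<in> par {s, t} \<Longrightarrow> len (y \<otimes> b) = len y + len b"
      using coset_rep_right[OF I less.prems(1)] by metis
    have vW: "v \<in> W" using par_W[OF I vy(1)] .
    have sp: "s \<in> par {s, t}" "t \<in> par {s, t}" using par_gen[OF I] by auto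
    have lenx: "len x = len y + len v" using vy by simp
    have vs: "v \<otimes> s \<in> par {s, t}" "v \<otimes> t \<in> par {s, t}" using par_mult[OF I vy(1)] sp by auto
    have xs: "x \<otimes> s = y \<otimes> (v \<otimes> s)" "x \<otimes> t = y \<otimes> (v \<otimes> t)"
      using vy(2,3) vW W_carrier S_carrier t less.prems(2) by (simp_all add: m_assoc)
    have lvs: "len (v \<otimes> s) > len v" "len (v \<otimes> t) < len v"
      using less.prems(3) xtlt vy(4)[OF vs(1)] vy(4)[OF vs(2)] lenx xs by auto
    have ylt: "len y < len x" using lenx lvs(2) by simp
    have ys: "0 \<le> rho y (e s) r" "0 \<le> rho y (e t) r" for r
      using less.hyps[OF ylt vy(2) less.prems(2)] less.hyps[OF ylt vy(2) t] vy(4)[OF sp(1)] vy(4)[OF sp(2)]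
        len_S[OF less.prems(2)] len_S[OF t] by auto
    obtain vv where vv: "reduced vv" "prd vv = v" using reduced_ex[OF vW] by blast
    have vvset: "set vv \<subseteq> {s, t}" using reduced_in_par[OF vv(1) I] vv(2) vy(1) by simp
    have vvS: "set vv \<subseteq> S" using vvset I by blast
    have red: "reduced (vv @ [s])"
      using vv lvs(1) len_right[OF vW less.prems(2)] prd_append[OF vvS, of "[s]"] less.prems(2) vvS S_carrier
      unfolding reduced_def by auto
    have r1: "reduced (s # rev vv)" using reduced_rev[OF red] by simp
    have "s # rev vv = alt s t (length (s # rev vv))"
      by (rule reduced_dihedral[OF r1]) (use vvset in auto)
    then have rv: "rev vv = alt t s (length vv)" by simp
    have "reduced (alt s t (Suc (length vv)))" using r1 rv by simp
    then have "length vv < m s t" using reduced_alt_le[OF less.prems(2) t] by fastforce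
    from dihedral_pos[OF less.prems(2) t st this] obtain a b where ab: "a \<ge> 0" "b \<ge> 0"
      "acts vv (e s) = (\<lambda>r. a * e s r + b * e t r)" using rv by (metis rev_rev_ident)
    have "rho x (e s) = rho y (rho v (e s))" using vy(3) rho_mult[OF vy(2) vW] by simp
    also have "rho v (e s) = acts vv (e s)" using rho_reduced[OF vv(1)] vv(2) by simp
    finally have "rho x (e s) r = a * rho y (e s) r + b * rho y (e t) r" unfolding ab(3) rho_lin by simp
    then show ?thesis using ab ys by simp
  qed
qed

lemma rho_neg:
  assumes "x \<in> W" "s \<in> S" "len (x \<otimes> s) < len x"
  shows "rho x (e s) r \<le> 0"
proof -
  have xs: "x \<otimes> s \<in> W" "x \<otimes> s \<otimes> s = x" using W_mult S_W S_cancel' W_carrier assms by auto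
  have "0 \<le> rho (x \<otimes> s) (e s) r" using rho_pos[OF xs(1) assms(2)] xs(2) assms(3) by simp
  also have "rho (x \<otimes> s) (e s) = rho x (\<lambda>r. (-1) * e s r + 0 * e s r)"
    using rho_mult[OF assms(1) S_W[OF assms(2)]] rho_S[OF assms(2)] refl_e[OF assms(2)] by simp
  finally show ?thesis unfolding rho_lin by simp
qed

section \<open>Roots and inversions\<close>

definition nb :: "('a \<Rightarrow> real) \<Rightarrow> real" where "nb v = (\<Sum>x\<in>S. v x * bs x v)"

lemma sum_e: "s \<in> S \<Longrightarrow> (\<Sum>x\<in>S. e s x * h x) = h s"
proof -
  assume s: "s \<in> S"
  have "(\<Sum>x\<in>S. e s x * h x) = (\<Sum>x\<in>S. if x = s then h s else 0)"
    by (rule sum.cong) (auto simp: e_def)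
  then show ?thesis using finite_S s by simp
qed

lemma nb_refl:
  assumes s: "s \<in> S" shows "nb (refl s v) = nb v"
proof -
  have "nb (refl s v) = (\<Sum>x\<in>S. (v x - 2 * bs s v * e s x) * (bs x v - 2 * bs s v * B x s))"
    unfolding nb_def bs_refl[OF s] by (simp add: refl_def)
  also have "\<dots> = nb v - 2 * bs s v * (\<Sum>x\<in>S. e s x * bs x v) - 2 * bs s v * (\<Sum>x\<in>S. v x * B x s)
      + 4 * (bs s v)\<^sup>2 * (\<Sum>x\<in>S. e s x * B x s)"
    unfolding nb_def by (simp add: algebra_simps sum.distrib sum_subtractf sum_distrib_left power2_eq_square)
  also have "(\<Sum>x\<in>S. e s x * bs x v) = bs s v" by (rule sum_e[OF s])
  also have "(\<Sum>x\<in>S. v x * B x s) = bs s v" unfolding bs_def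
    by (rule sum.cong) (use s in \<open>auto simp: B_sym\<close>)
  also have "(\<Sum>x\<in>S. e s x * B x s) = 1" using sum_e[OF s] B_self[OF s] by simp
  finally show ?thesis by (simp add: power2_eq_square)
qed

lemma nb_rho: "x \<in> W \<Longrightarrow> nb (rho x v) = nb v"
proof -
  have "set ss \<subseteq> S \<Longrightarrow> nb (acts ss v) = nb v" for ss
    by (induction ss) (auto simp: nb_refl)
  moreover assume "x \<in> W"
  then obtain ss where "set ss \<subseteq> S" "x = prd ss" using W_gen by blast
  ultimately show ?thesis using acts_rho by metis
qed

lemma nb_e: "s \<in> S \<Longrightarrow> nb (e s) = 1"
  unfolding nb_def by (simp add: sum_e bs_e B_self)

lemma nb_scale: "nb (\<lambda>r. k * v r) = k\<^sup>2 * nb v"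
proof -
  have "bs x (\<lambda>r. k * v r) = k * bs x v" for x using bs_lin[of x k v 0 v] by simp
  then show ?thesis unfolding nb_def by (simp add: sum_distrib_left power2_eq_square algebra_simps)
qed

definition R :: "('a \<Rightarrow> real) set" where "R = {rho x (e s) | x s. x \<in> W \<and> s \<in> S}"

lemma finite_R: "finite R"
proof -
  have "R = (\<lambda>(x, s). rho x (e s)) ` (W \<times> S)" unfolding R_def by auto
  then show ?thesis using finite_W finite_S by simp
qed

lemma e_R: "s \<in> S \<Longrightarrow> e s \<in> R"
  unfolding R_def using rho_one W_one by (metis (mono_tags, lifting) mem_Collect_eq)

lemma rho_R: "v \<in> R \<Longrightarrow> x \<in> W \<Longrightarrow> rho x v \<in> R"
  unfolding R_def using rho_mult W_mult by (smt (verit) mem_Collect_eq)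

lemma R_nb: "v \<in> R \<Longrightarrow> nb v = 1"
  unfolding R_def using nb_rho nb_e by auto

lemma R_cases: "v \<in> R \<Longrightarrow> (\<forall>r. 0 \<le> v r) \<or> (\<forall>r. v r \<le> 0)"
proof -
  assume "v \<in> R"
  then obtain x s where "v = rho x (e s)" "x \<in> W" "s \<in> S" unfolding R_def by blast
  then show ?thesis using rho_pos rho_neg len_right[of x s] by (metis lessI)
qed

lemma R_ne: "v \<in> R \<Longrightarrow> \<exists>r\<in>S. v r \<noteq> 0"
proof (rule ccontr)
  assume v: "v \<in> R" and "\<not> (\<exists>r\<in>S. v r \<noteq> 0)"
  then have "nb v = 0" unfolding nb_def by simp
  then show False using R_nb[OF v] by simp
qed

lemma R_neg: "v \<in> R \<Longrightarrow> (\<lambda>r. - v r) \<in> R"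
proof -
  assume "v \<in> R"
  then obtain x s where v: "v = rho x (e s)" "x \<in> W" "s \<in> S" unfolding R_def by blast
  have "rho (x \<otimes> s) (e s) = rho x (\<lambda>r. (-1) * e s r + 0 * e s r)"
    using rho_mult[OF v(2) S_W[OF v(3)]] rho_S[OF v(3)] refl_e[OF v(3)] by simp
  then have "(\<lambda>r. - v r) = rho (x \<otimes> s) (e s)" unfolding rho_lin v(1) by simp
  then show ?thesis unfolding R_def using v W_mult S_W by blast
qed

lemma R_supp: "v \<in> R \<Longrightarrow> r \<notin> S \<Longrightarrow> v r = 0"
proof -
  assume "v \<in> R" and r: "r \<notin> S"
  then obtain x s where v: "v = rho x (e s)" "x \<in> W" "s \<in> S" unfolding R_def by blast
  obtain ss where ss: "set ss \<subseteq> S" "x = prd ss" using W_gen v by blast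
  have "set ss \<subseteq> S \<Longrightarrow> acts ss (e s) r = 0"
    by (induction ss) (use v(3) r in \<open>auto simp: e_def refl_def\<close>)
  then show ?thesis using ss v acts_rho by metis
qed

text \<open>The quadratic form is invariant and equal to 1 on simple roots, hence on all
  roots.\<close>

lemma R_proportional:
  assumes "v \<in> R" "u \<in> R" "v = (\<lambda>r. k * u r)"
  shows "k = 1 \<or> k = -1"
proof -
  have "k\<^sup>2 = 1" using R_nb[OF assms(1)] R_nb[OF assms(2)] nb_scale[of k u] assms(3) by simp
  then show ?thesis by (simp add: power2_eq_1_iff)
qed

text \<open>A simple reflection changes only the coordinate at \<open>s\<close>. A positive root
  other than \<open>e s\<close> has another nonzero coordinate, which stays positive and determines
  the sign of the image.\<close>

lemma refl_R_pos:
  assumes "s \<in> S" "v \<in> R" "\<And>r. 0 \<le> v r" "v \<noteq> e s"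
  shows "refl s v \<in> R" "\<And>r. 0 \<le> refl s v r" "refl s v \<noteq> e s"
proof -
  show R: "refl s v \<in> R" using rho_R[OF assms(2) S_W[OF assms(1)]] rho_S[OF assms(1)] by simp
  have "\<exists>r. r \<noteq> s \<and> v r \<noteq> 0"
  proof (rule ccontr)
    assume "\<not> ?thesis"
    then have v: "v = (\<lambda>r. v s * e s r)" by (intro ext) (auto simp: e_def)
    have "v s = 1 \<or> v s = -1" by (rule R_proportional[OF assms(2) e_R[OF assms(1)] v])
    then have "v s = 1" using assms(3)[of s] by auto
    then have "v = e s" using \<open>\<not> (\<exists>r. r \<noteq> s \<and> v r \<noteq> 0)\<close> by (intro ext) (auto simp: e_def)
    then show False using assms(4) by simp
  qed
  then obtain r where r: "r \<noteq> s" "v r \<noteq> 0" by blast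
  then have rr: "refl s v r = v r" unfolding refl_def e_def by simp
  then have "0 < refl s v r" using r assms(3)[of r] by simp
  then show "\<And>r. 0 \<le> refl s v r" using R_cases[OF R] by (meson not_less)
  show "refl s v \<noteq> e s" using rr r unfolding e_def by auto
qed

definition N :: "'a \<Rightarrow> ('a \<Rightarrow> real) set" where
  "N u = {v \<in> R. (\<forall>r. 0 \<le> v r) \<and> (\<forall>r. rho (inv u) v r \<le> 0)}"

text \<open>Prepending a letter \<open>s\<close> that lengthens the word adds the inversion
  \<open>e s\<close> and transports the others by the reflection in \<open>s\<close>, which permutes
  the remaining positive roots.\<close>

lemma card_N: "u \<in> W \<Longrightarrow> card (N u) = len u"
proof -
  have "reduced ss \<Longrightarrow> card (N (prd ss)) = length ss" for ss
  proof (induction ss)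
    case Nil
    have "v \<notin> N \<one>" for v using R_ne[of v] unfolding N_def by (auto simp: rho_one) (meson antisym)
    then have "N \<one> = {}" by blast
    then show ?case by simp
  next
    case (Cons s ss)
    have s: "s \<in> S" and ss: "set ss \<subseteq> S" using Cons.prems unfolding reduced_def by auto
    define u where "u = prd ss"
    have uW: "u \<in> W" unfolding u_def using prd_W[OF ss] .
    have red: "reduced ss" using reduced_Cons[OF Cons.prems] .
    have su: "s \<otimes> u \<in> W" using W_mult S_W s uW by blast
    have invsu: "inv (s \<otimes> u) = inv u \<otimes> s" using s uW W_carrier S_carrier inv_S by (simp add: inv_mult_group)
    have lt: "len (inv u \<otimes> s) > len (inv u)"
    proof -
      have "len (s \<otimes> u) > len u" using Cons.prems red unfolding reduced_def u_def by simp
      then show ?thesis using len_inv[OF su] len_inv[OF uW] invsu by simp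
    qed
    have rs: "rho (inv (s \<otimes> u)) v = rho (inv u) (refl s v)" for v
      unfolding invsu using rho_mult[OF W_inv[OF uW] S_W[OF s]] rho_S[OF s] by simp
    have es: "0 \<le> rho (inv u) (e s) r" for r using rho_pos[OF W_inv[OF uW] s lt] .
    have esN: "e s \<notin> N u"
    proof
      assume "e s \<in> N u"
      then have "rho (inv u) (e s) r = 0" for r using es unfolding N_def by (simp add: antisym)
      then show False using R_ne[OF rho_R[OF e_R[OF s] W_inv[OF uW]]] by simp
    qed
    have esN': "e s \<in> N (s \<otimes> u)"
    proof -
      have "rho (inv (s \<otimes> u)) (e s) = (\<lambda>r. - rho (inv u) (e s) r)"
        unfolding rs refl_e[OF s] using rho_lin[of "inv u" "-1" "e s" 0 "e s"] by simp
      then show ?thesis unfolding N_def using es e_R[OF s] by (auto simp: e_def)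
    qed
    have "bij_betw (refl s) (N (s \<otimes> u) - {e s}) (N u)"
    proof (rule bij_betw_byWitness[where f' = "refl s"])
      show "refl s ` (N (s \<otimes> u) - {e s}) \<subseteq> N u"
        unfolding N_def rs using refl_R_pos[OF s] by auto
      show "refl s ` N u \<subseteq> N (s \<otimes> u) - {e s}"
      proof
        fix v assume "v \<in> refl s ` N u"
        then obtain v' where v': "v = refl s v'" "v' \<in> N u" by blast
        then have "v' \<noteq> e s" using esN by blast
        then show "v \<in> N (s \<otimes> u) - {e s}"
          using v' refl_R_pos[OF s, of v'] unfolding N_def rs by (auto simp: refl_invol[OF s])
      qed
    qed (auto simp: refl_invol[OF s])
    then have "card (N (s \<otimes> u) - {e s}) = card (N u)" by (rule bij_betw_same_card)
    moreover have "finite (N (s \<otimes> u))" unfolding N_def using finite_R by simp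
    ultimately have "card (N (s \<otimes> u)) = Suc (card (N u))" using esN' by (metis card_Suc_Diff1)
    then show ?case using Cons.IH[OF red] unfolding u_def by simp
  qed
  moreover assume "u \<in> W"
  ultimately show ?thesis using reduced_ex[of u] unfolding reduced_def by metis
qed

text \<open>Recording all translates of \<open>v\<close> turns the action of \<open>W\<close> into a permutation of coordinates, so the standard
  inner product becomes invariant.\<close>
definition iota :: "('a \<Rightarrow> real) \<Rightarrow> ('a \<times> 'a) fvec" where
  "iota v = Fvec (\<lambda>(x, t). if x \<in> W \<and> t \<in> S then rho x v t else 0)"

lemma coord_iota: "coord (iota v) (x, t) = (if x \<in> W \<and> t \<in> S then rho x v t else 0)"
  unfolding iota_def by (subst coord_Fvec[of "W \<times> S"]) (auto simp: finite_W finite_S split: if_splits)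

lemma iota_lin: "iota (\<lambda>r. a * v r + b * q r) = a *\<^sub>R iota v + b *\<^sub>R iota q"
proof (rule fvec_eqI)
  fix i show "coord (iota (\<lambda>r. a * v r + b * q r)) i = coord (a *\<^sub>R iota v + b *\<^sub>R iota q) i"
    by (cases i) (simp add: coord_iota coord_simps rho_lin)
qed

lemma iota_neg: "iota (\<lambda>r. - v r) = - iota v"
  using iota_lin[of "-1" v 0 v] by simp

lemma iota_inj: "inj_on iota R"
proof
  fix v q assume vq: "v \<in> R" "q \<in> R" "iota v = iota q"
  show "v = q"
  proof
    fix r
    show "v r = q r"
    proof (cases "r \<in> S")
      case True
      then show ?thesis using coord_iota[of v \<one> r] coord_iota[of q \<one> r] vq(3) W_one rho_one by simp
    next
      case False
      then show ?thesis using R_supp[OF vq(1)] R_supp[OF vq(2)] by simp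
    qed
  qed
qed

definition Phi :: "('a \<times> 'a) fvec set" where "Phi = iota ` R"

section \<open>Chambers of the root arrangement\<close>

lemma linear_functional_expand:
  fixes F :: "('a \<Rightarrow> real) \<Rightarrow> real"
  assumes F: "\<And>a b v q. F (\<lambda>r. a * v r + b * q r) = a * F v + b * F q"
    and q: "\<And>r. r \<notin> S \<Longrightarrow> q r = 0"
  shows "F q = (\<Sum>t\<in>S. q t * F (e t))"
proof -
  have F0: "F (\<lambda>r. 0) = 0" using F[of 0 "\<lambda>r. 0" 0 "\<lambda>r. 0"] by simp
  have "F (\<lambda>r. \<Sum>t\<in>A. q t * e t r) = (\<Sum>t\<in>A. q t * F (e t))" if "finite A" for A
    using that
  proof (induction rule: finite_induct)
    case (insert t A)
    then show ?case using F[of "q t" "e t" 1 "\<lambda>r. \<Sum>t\<in>A. q t * e t r"] by simp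
  qed (simp add: F0)
  moreover have "q = (\<lambda>r. \<Sum>t\<in>S. q t * e t r)"
  proof
    fix r
    have "(\<Sum>t\<in>S. q t * e t r) = (\<Sum>t\<in>S. if t = r then q r else 0)"
      by (rule sum.cong) (auto simp: e_def)
    then show "q r = (\<Sum>t\<in>S. q t * e t r)" using finite_S q by simp
  qed
  ultimately show ?thesis using finite_S by metis
qed

lemma iota_functional:
  "c \<bullet> iota (rho y (\<lambda>r. a * v r + b * q r)) = a * (c \<bullet> iota (rho y v)) + b * (c \<bullet> iota (rho y q))"
  unfolding rho_lin iota_lin by (simp add: inner_add_right)

text \<open>Choose \<open>y\<close> with the fewest positive roots on which the translated
  functional is negative. If a simple root were among them, replacing \<open>y\<close> by
  \<open>y s\<close> would remove exactly that one, as \<open>s\<close> permutes the other positive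
  roots.\<close>

lemma dominant_translate:
  shows "\<exists>y\<in>W. \<forall>s\<in>S. 0 \<le> c \<bullet> iota (rho y (e s))"
proof -
  define E where "E y = {q \<in> R. (\<forall>r. 0 \<le> q r) \<and> c \<bullet> iota (rho y q) < 0}" for y
  define y where "y = arg_min (\<lambda>y. card (E y)) (\<lambda>y. y \<in> W)"
  have y: "y \<in> W" and ymin: "\<And>z. z \<in> W \<Longrightarrow> card (E y) \<le> card (E z)"
    using arg_min_nat_lemma[of "\<lambda>y. y \<in> W" \<one> "\<lambda>y. card (E y)"] W_one unfolding y_def by auto
  have "0 \<le> c \<bullet> iota (rho y (e s))" if s: "s \<in> S" for s
  proof (rule ccontr)
    assume neg: "\<not> 0 \<le> c \<bullet> iota (rho y (e s))"
    have ys: "y \<otimes> s \<in> W" using W_mult S_W y s by blast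
    have rys: "rho (y \<otimes> s) v = rho y (refl s v)" for v using rho_mult[OF y S_W[OF s]] rho_S[OF s] by simp
    have esE: "e s \<in> E y" unfolding E_def using e_R[OF s] neg by (auto simp: e_def)
    have finE: "finite (E z)" for z unfolding E_def using finite_R by simp
    have "rho (y \<otimes> s) (e s) = rho y (\<lambda>r. (-1) * e s r + 0 * e s r)" unfolding rys refl_e[OF s] by simp
    then have "c \<bullet> iota (rho (y \<otimes> s) (e s)) = (-1) * (c \<bullet> iota (rho y (e s))) + 0 * (c \<bullet> iota (rho y (e s)))"
      by (simp only: iota_functional)
    then have esE': "e s \<notin> E (y \<otimes> s)" using neg unfolding E_def by auto
    have "bij_betw (refl s) (E (y \<otimes> s)) (E y - {e s})"
    proof (rule bij_betw_byWitness[where f' = "refl s"])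
      show "refl s ` E (y \<otimes> s) \<subseteq> E y - {e s}"
      proof
        fix q assume "q \<in> refl s ` E (y \<otimes> s)"
        then obtain q' where q': "q = refl s q'" "q' \<in> E (y \<otimes> s)" by blast
        then have "q' \<noteq> e s" using esE' by blast
        then show "q \<in> E y - {e s}" using q' refl_R_pos[OF s, of q'] unfolding E_def rys by auto
      qed
      show "refl s ` (E y - {e s}) \<subseteq> E (y \<otimes> s)"
        unfolding E_def rys using refl_R_pos[OF s] by (auto simp: refl_invol[OF s])
    qed (auto simp: refl_invol[OF s])
    then have "card (E (y \<otimes> s)) = card (E y - {e s})" by (rule bij_betw_same_card)
    also have "\<dots> < card (E y)" using finE esE by (rule card_Diff1_less)
    finally show False using ymin[OF ys] by simp
  qed
  then show ?thesis using y by blast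
qed

text \<open>A point of the chamber of \<open>y\<close>: it pairs with \<open>iota v\<close> to the coordinate sum of the root \<open>y\<inverse> v\<close>, whose
  coordinates all have the same sign.\<close>
definition chamber_pt :: "'a \<Rightarrow> ('a \<times> 'a) fvec" where
  "chamber_pt y = Fvec (\<lambda>(x, t). if x = inv y \<and> t \<in> S then 1 else 0)"

lemma chamber_pt_inner: "y \<in> W \<Longrightarrow> chamber_pt y \<bullet> iota v = (\<Sum>t\<in>S. rho (inv y) v t)"
proof -
  assume y: "y \<in> W"
  have co: "coord (chamber_pt y) (x, t) = (if x = inv y \<and> t \<in> S then 1 else 0)" for x t
    unfolding chamber_pt_def by (subst coord_Fvec[of "{inv y} \<times> S"]) (auto simp: finite_S split: if_splits)
  have "chamber_pt y \<bullet> iota v = (\<Sum>i\<in>{inv y} \<times> S. coord (chamber_pt y) i * coord (iota v) i)"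
    by (rule inner_fvec) (auto simp: co finite_S split: if_splits)
  also have "\<dots> = (\<Sum>t\<in>S. coord (chamber_pt y) (inv y, t) * coord (iota v) (inv y, t))"
    by (rule sum.reindex_bij_witness[of _ "\<lambda>t. (inv y, t)" snd]) auto
  also have "\<dots> = (\<Sum>t\<in>S. rho (inv y) v t)"
    by (rule sum.cong) (auto simp: co coord_iota W_inv[OF y])
  finally show ?thesis .
qed

lemma R_sum_pos:
  assumes "q \<in> R"
  shows "0 < (\<Sum>t\<in>S. q t) \<longleftrightarrow> (\<forall>r. 0 \<le> q r)" "(\<Sum>t\<in>S. q t) < 0 \<longleftrightarrow> (\<forall>r. q r \<le> 0)"
proof -
  obtain r where r: "r \<in> S" "q r \<noteq> 0" using R_ne[OF assms] by blast
  have p: "0 < (\<Sum>t\<in>S. q t)" if "\<forall>r. 0 \<le> q r"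
    using that r finite_S by (intro sum_pos2[of S r]) (auto simp: less_le)
  have n: "(\<Sum>t\<in>S. q t) < 0" if "\<forall>r. q r \<le> 0"
  proof -
    have "0 < (\<Sum>t\<in>S. - q t)" using that r finite_S by (intro sum_pos2[of S r]) (auto simp: less_le)
    then show ?thesis by (simp add: sum_negf)
  qed
  show "0 < (\<Sum>t\<in>S. q t) \<longleftrightarrow> (\<forall>r. 0 \<le> q r)" "(\<Sum>t\<in>S. q t) < 0 \<longleftrightarrow> (\<forall>r. q r \<le> 0)"
    using p n R_cases[OF assms] by fastforce+
qed

lemma chamber_pt_sign:
  assumes "y \<in> W" "v \<in> R"
  shows "0 < chamber_pt y \<bullet> iota v \<longleftrightarrow> (\<forall>r. 0 \<le> rho (inv y) v r)"
    "chamber_pt y \<bullet> iota v < 0 \<longleftrightarrow> (\<forall>r. rho (inv y) v r \<le> 0)"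
  unfolding chamber_pt_inner[OF assms(1)] using R_sum_pos[OF rho_R[OF assms(2) W_inv[OF assms(1)]]] by auto

lemma chamber_pt_regular: "y \<in> W \<Longrightarrow> regular Phi (chamber_pt y)"
  unfolding regular_def Phi_def
proof
  fix \<alpha> assume y: "y \<in> W" and "\<alpha> \<in> iota ` R"
  then obtain v where v: "\<alpha> = iota v" "v \<in> R" by blast
  then show "chamber_pt y \<bullet> \<alpha> \<noteq> 0" using chamber_pt_sign[OF y v(2)] R_cases[OF rho_R[OF v(2) W_inv[OF y]]] by auto
qed

text \<open>A translate of \<open>c\<close> that is nonnegative on simple roots is nonnegative on
  positive roots, and by regularity strictly positive; this is the sign pattern of a chamber of
  \<open>W\<close>.\<close>

lemma chamber_ex:
  assumes "regular Phi c"
  shows "\<exists>y\<in>W. same_side Phi c (chamber_pt y)"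
proof -
  obtain y where y: "y \<in> W" "\<And>s. s \<in> S \<Longrightarrow> 0 \<le> c \<bullet> iota (rho y (e s))" using dominant_translate[of c] by blast
  have pos: "0 < c \<bullet> iota (rho y q)" if q: "q \<in> R" "\<forall>r. 0 \<le> q r" for q
  proof -
    have "c \<bullet> iota (rho y q) = (\<Sum>t\<in>S. q t * (c \<bullet> iota (rho y (e t))))"
      by (rule linear_functional_expand) (auto simp: iota_functional R_supp[OF q(1)])
    also have "\<dots> \<ge> 0" using q y(2) by (intro sum_nonneg) auto
    finally have "0 \<le> c \<bullet> iota (rho y q)" .
    moreover have "c \<bullet> iota (rho y q) \<noteq> 0" using assms rho_R[OF q(1) y(1)] unfolding regular_def Phi_def by blast
    ultimately show ?thesis by simp
  qed
  have "0 < c \<bullet> iota v \<longleftrightarrow> 0 < chamber_pt y \<bullet> iota v" if v: "v \<in> R" for v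
  proof -
    define q where "q = rho (inv y) v"
    have q: "q \<in> R" "rho y q = v" unfolding q_def using rho_R[OF v W_inv[OF y(1)]] rho_inv(2)[OF y(1)] by auto
    show ?thesis
    proof (cases "\<forall>r. 0 \<le> q r")
      case True
      then show ?thesis using pos[OF q(1)] q(2) chamber_pt_sign[OF y(1) v] unfolding q_def by auto
    next
      case False
      then have neg: "\<forall>r. q r \<le> 0" using R_cases[OF q(1)] by blast
      then have "0 < c \<bullet> iota (rho y (\<lambda>r. (-1) * q r + 0 * q r))" using pos[of "\<lambda>r. - q r"] R_neg[OF q(1)] by simp
      then have "0 < - (c \<bullet> iota v)" unfolding iota_functional q(2) by simp
      then show ?thesis using chamber_pt_sign[OF y(1) v] False unfolding q_def by auto
    qed
  qed
  then show ?thesis using y(1) unfolding same_side_def Phi_def by blast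
qed

text \<open>After translating by \<open>z\<close> inverse the separating roots become the inversions
  of \<open>inv z \<otimes> y\<close>. Hence adjacent chambers belong to elements differing by one
  letter on the right.\<close>

lemma card_sep_chamber_pt:
  assumes y: "y \<in> W" and z: "z \<in> W"
  shows "card (sep Phi (chamber_pt y) (chamber_pt z)) = len (inv y \<otimes> z)"
proof -
  define g where "g = inv z \<otimes> y"
  have gW: "g \<in> W" unfolding g_def using W_mult W_inv y z by blast
  have invg: "inv g = inv y \<otimes> z" unfolding g_def using y z W_carrier by (simp add: inv_mult_group)
  have rg: "rho (inv g) (rho (inv z) v) = rho (inv y) v" for v
  proof -
    have "inv g \<otimes> inv z = inv y" unfolding invg using y z W_carrier by (simp add: m_assoc)
    then show ?thesis using rho_mult[OF W_inv[OF gW] W_inv[OF z]] by simp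
  qed
  have "sep Phi (chamber_pt y) (chamber_pt z) = iota ` {v \<in> R. rho (inv z) v \<in> N g}"
  proof (intro equalityI subsetI)
    fix \<alpha> assume "\<alpha> \<in> sep Phi (chamber_pt y) (chamber_pt z)"
    then obtain v where v: "\<alpha> = iota v" "v \<in> R" "chamber_pt y \<bullet> iota v < 0" "0 < chamber_pt z \<bullet> iota v"
      unfolding sep_def Phi_def by blast
    then show "\<alpha> \<in> iota ` {v \<in> R. rho (inv z) v \<in> N g}"
      using chamber_pt_sign[OF y v(2)] chamber_pt_sign[OF z v(2)] rho_R[OF v(2) W_inv[OF z]] unfolding N_def by (auto simp: rg)
  next
    fix \<alpha> assume "\<alpha> \<in> iota ` {v \<in> R. rho (inv z) v \<in> N g}"
    then obtain v where v: "\<alpha> = iota v" "v \<in> R" "rho (inv z) v \<in> N g" by blast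
    then show "\<alpha> \<in> sep Phi (chamber_pt y) (chamber_pt z)"
      using chamber_pt_sign[OF y v(2)] chamber_pt_sign[OF z v(2)] unfolding N_def sep_def Phi_def by (auto simp: rg)
  qed
  then have "card (sep Phi (chamber_pt y) (chamber_pt z)) = card {v \<in> R. rho (inv z) v \<in> N g}"
    using iota_inj by (metis (no_types, lifting) card_image inj_on_subset mem_Collect_eq subsetI)
  also have "\<dots> = card (N g)"
  proof (rule bij_betw_same_card[of "rho (inv z)"], rule bij_betw_byWitness[where f' = "rho z"])
    show "rho z ` N g \<subseteq> {v \<in> R. rho (inv z) v \<in> N g}"
      using rho_R[OF _ z] unfolding N_def by (auto simp: rho_inv[OF z])
  qed (auto simp: rho_inv[OF z])
  also have "\<dots> = len (inv y \<otimes> z)" using card_N[OF gW] len_inv[OF gW] invg by simp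
  finally show ?thesis .
qed

lemma symmetric_arrangement_Phi: "symmetric_arrangement Phi"
  unfolding symmetric_arrangement_def
proof (intro conjI ballI allI impI)
  show "finite Phi" unfolding Phi_def using finite_R by simp
  show "0 \<notin> Phi" using chamber_pt_regular[OF W_one] unfolding regular_def by force
  show "- \<alpha> \<in> Phi" if "\<alpha> \<in> Phi" for \<alpha>
    using that R_neg iota_neg unfolding Phi_def by (metis (no_types, lifting) image_iff)
  fix \<alpha> \<beta> k assume "\<alpha> \<in> Phi" "\<beta> \<in> Phi" and eq: "\<alpha> = k *\<^sub>R \<beta>"
  then obtain v q where vq: "\<alpha> = iota v" "v \<in> R" "\<beta> = iota q" "q \<in> R" unfolding Phi_def by blast
  have "v = (\<lambda>r. k * q r)"
  proof
    fix r
    show "v r = k * q r"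
    proof (cases "r \<in> S")
      case True
      have "coord (iota v) (\<one>, r) = k * coord (iota q) (\<one>, r)" using eq vq by (simp add: coord_scale)
      then show ?thesis using True W_one by (simp add: coord_iota rho_one)
    next
      case False
      then show ?thesis using R_supp[OF vq(2)] R_supp[OF vq(4)] by simp
    qed
  qed
  then have "k = 1 \<or> k = -1" using R_proportional vq by blast
  then show "\<alpha> = \<beta> \<or> \<alpha> = - \<beta>" using eq by auto
qed

text \<open>Let \<open>s\<close> be the first letter of a reduced word of \<open>g\<close>. Then
  \<open>rho (inv g) (e s)\<close> is a negative root, so nonnegativity of \<open>F\<close> after
  \<open>g\<close> on simple roots forces \<open>F (e s) \<le> 0\<close>. Dominance gives
  \<open>F (e s) = 0\<close>, so \<open>F\<close> is invariant under \<open>s\<close> and the letter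
  can be removed.\<close>

lemma dominant_stabilizer:
  fixes F :: "('a \<Rightarrow> real) \<Rightarrow> real"
  assumes F: "\<And>a b v q. F (\<lambda>r. a * v r + b * q r) = a * F v + b * F q"
    and dom: "\<And>s. s \<in> S \<Longrightarrow> 0 \<le> F (e s)"
    and "g \<in> W" and "\<And>s. s \<in> S \<Longrightarrow> 0 \<le> F (rho g (e s))"
  shows "g \<in> par {s\<in>S. F (e s) = 0} \<and> (\<forall>v. F (rho g v) = F v)"
proof -
  have "reduced ss \<Longrightarrow> (\<And>s. s \<in> S \<Longrightarrow> 0 \<le> F (rho (prd ss) (e s))) \<Longrightarrow>
    prd ss \<in> par {s\<in>S. F (e s) = 0} \<and> (\<forall>v. F (rho (prd ss) v) = F v)" for ss
  proof (induction ss)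
    case Nil
    then show ?case using par_one by (simp add: rho_one)
  next
    case (Cons s ss)
    have s: "s \<in> S" and ss: "set ss \<subseteq> S" using Cons.prems(1) unfolding reduced_def by auto
    have red: "reduced ss" using reduced_Cons[OF Cons.prems(1)] .
    define g where "g = s \<otimes> prd ss"
    have gW: "g \<in> W" unfolding g_def using W_mult S_W s prd_W[OF ss] by blast
    have "inv g \<otimes> s = inv (prd ss)"
      unfolding g_def using s prd_carrier[OF ss] S_carrier inv_S by (simp add: inv_mult_group m_assoc S_sq)
    then have lt: "len (inv g \<otimes> s) < len (inv g)"
      using len_inv[OF gW] len_inv[OF prd_W[OF ss]] len_le[OF ss] Cons.prems(1) unfolding reduced_def g_def by simp
    define q where "q = rho (inv g) (e s)"
    have q: "q \<in> R" "\<And>r. q r \<le> 0" "rho g q = e s"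
      unfolding q_def using rho_R[OF e_R[OF s] W_inv[OF gW]] rho_neg[OF W_inv[OF gW] s lt] rho_inv(2)[OF gW] by auto
    have "F (e s) = F (rho g q)" using q(3) by simp
    also have "\<dots> = (\<Sum>t\<in>S. q t * F (rho g (e t)))"
      by (rule linear_functional_expand) (auto simp: rho_lin F R_supp[OF q(1)])
    also have "\<dots> \<le> 0" using Cons.prems(2) q(2) unfolding g_def by (intro sum_nonpos) (auto simp: mult_nonpos_nonneg)
    finally have Fs: "F (e s) = 0" using dom[OF s] by simp
    have "F (refl s v) = F v" for v
      using F[of 1 v "- 2 * bs s v" "e s"] Fs unfolding refl_def by simp
    then have Fg: "F (rho g v) = F (rho (prd ss) v)" for v
      unfolding g_def using rho_mult[OF S_W[OF s] prd_W[OF ss]] rho_S[OF s] by simp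
    have "0 \<le> F (rho (prd ss) (e t))" if "t \<in> S" for t
      using Cons.prems(2)[OF that] Fg[of "e t"] unfolding g_def by simp
    then have IH: "prd ss \<in> par {s\<in>S. F (e s) = 0} \<and> (\<forall>v. F (rho (prd ss) v) = F v)"
      by (rule Cons.IH[OF red])
    have "g \<in> par {s\<in>S. F (e s) = 0}" unfolding g_def
      using par_mult[of "{s\<in>S. F (e s) = 0}" s "prd ss"] par_gen[of "{s\<in>S. F (e s) = 0}" s] IH s Fs by auto
    then show ?case using IH Fg unfolding g_def by simp
  qed
  moreover obtain ss where "reduced ss" "prd ss = g" using reduced_ex[OF assms(3)] by blast
  ultimately show ?thesis using assms(4) by blast
qed

text \<open>An element of maximal length has every letter as a descent, so its inverse makes all
  positive roots negative. The inversions of \<open>x \<otimes> \<omega>\<close> are then the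
  positive roots that are not inversions of \<open>x\<close>.\<close>

lemma longest_element:
  obtains \<omega> where "\<omega> \<in> W" "\<And>s. s \<in> S \<Longrightarrow> len (s \<otimes> \<omega>) < len \<omega>" "\<And>x. x \<in> W \<Longrightarrow> len (x \<otimes> \<omega>) + len x = len \<omega>"
proof -
  have "Max (len ` W) \<in> len ` W" using finite_W W_one by (intro Max_in) auto
  then obtain \<omega> where w: "\<omega> \<in> W" "len \<omega> = Max (len ` W)" by auto
  have max: "len x \<le> len \<omega>" if "x \<in> W" for x using w(2) that finite_W by simp
  have desc: "len (s \<otimes> \<omega>) < len \<omega>" if "s \<in> S" for s
    using max[OF W_mult[OF S_W[OF that] w(1)]] len_left[OF w(1) that] by auto
  have desc': "len (inv \<omega> \<otimes> s) < len (inv \<omega>)" if s: "s \<in> S" for s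
  proof -
    have "inv (s \<otimes> \<omega>) = inv \<omega> \<otimes> s" using w(1) W_carrier S_carrier inv_S s by (simp add: inv_mult_group)
    then show ?thesis using desc[OF s] len_inv[OF w(1)] len_inv[OF W_mult[OF S_W[OF s] w(1)]] by simp
  qed
  have neg: "rho (inv \<omega>) q r \<le> 0" if q: "q \<in> R" "\<forall>r. 0 \<le> q r" for q r
  proof -
    have "rho (inv \<omega>) q r = (\<Sum>t\<in>S. q t * rho (inv \<omega>) (e t) r)"
      by (rule linear_functional_expand[of "\<lambda>v. rho (inv \<omega>) v r", OF _ R_supp[OF q(1)]]) (simp_all add: rho_lin)
    also have "\<dots> \<le> 0"
      using q(2) rho_neg[OF W_inv[OF w(1)] _ desc'] by (intro sum_nonpos) (simp add: mult_nonneg_nonpos)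
    finally show ?thesis .
  qed
  have pos: "0 \<le> rho (inv \<omega>) q r" if q: "q \<in> R" "\<forall>r. q r \<le> 0" for q r
  proof -
    have "rho (inv \<omega>) (\<lambda>r. - q r) r \<le> 0" using neg[OF R_neg[OF q(1)]] q(2) by simp
    moreover have "rho (inv \<omega>) (\<lambda>r. - q r) r = - rho (inv \<omega>) q r"
      using rho_lin[of "inv \<omega>" "-1" q 0 q] by simp
    ultimately show ?thesis by simp
  qed
  define Rp where "Rp = {q \<in> R. \<forall>r. 0 \<le> q r}"
  have finRp: "finite Rp" unfolding Rp_def using finite_R by simp
  have N: "N (x \<otimes> \<omega>) = Rp - N x" if x: "x \<in> W" for x
  proof -
    have rx: "rho (inv (x \<otimes> \<omega>)) v = rho (inv \<omega>) (rho (inv x) v)" for v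
      using x w(1) W_carrier rho_mult[OF W_inv[OF w(1)] W_inv[OF x]] by (simp add: inv_mult_group)
    have "(\<forall>r. rho (inv \<omega>) q r \<le> 0) \<longleftrightarrow> \<not> (\<forall>r. q r \<le> 0)" if q: "q \<in> R" for q
    proof
      assume 1: "\<forall>r. rho (inv \<omega>) q r \<le> 0"
      show "\<not> (\<forall>r. q r \<le> 0)"
      proof
        assume "\<forall>r. q r \<le> 0"
        then have "rho (inv \<omega>) q r = 0" for r using pos[OF q] 1 by (simp add: antisym)
        then show False using R_ne[OF rho_R[OF q W_inv[OF w(1)]]] by simp
      qed
    next
      assume "\<not> (\<forall>r. q r \<le> 0)"
      then show "\<forall>r. rho (inv \<omega>) q r \<le> 0" using R_cases[OF q] neg[OF q] by blast
    qed
    then show ?thesis unfolding N_def Rp_def rx using rho_R[OF _ W_inv[OF x]] by blast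
  qed
  have N1: "N \<one> = {}" using card_N[OF W_one] finite_subset[OF _ finite_R, of "N \<one>"] by (auto simp: N_def)
  have lenw: "len \<omega> = card Rp"
    using N[OF W_one] N1 card_N[OF w(1)] w(1) W_carrier by simp
  have "len (x \<otimes> \<omega>) + len x = len \<omega>" if x: "x \<in> W" for x
  proof -
    have sub: "N x \<subseteq> Rp" unfolding N_def Rp_def by blast
    have "card (Rp - N x) = card Rp - card (N x)" using sub finRp finite_subset by (intro card_Diff_subset) auto
    moreover have "card (N x) \<le> card Rp" using sub finRp by (rule card_mono[rotated])
    ultimately show ?thesis using N[OF x] card_N[OF x] card_N[OF W_mult[OF x w(1)]] lenw by simp
  qed
  then show ?thesis using that w(1) desc by blast
qed

section \<open>Letters outside a parabolic subgroup\<close>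

lemma len_up_outside:
  assumes "J \<subseteq> S" "v \<in> par J" "s \<in> S" "s \<notin> J"
  shows "len (s \<otimes> v) = Suc (len v)"
proof (rule ccontr)
  assume "len (s \<otimes> v) \<noteq> Suc (len v)"
  moreover have vW: "v \<in> W" using par_W[OF assms(1,2)] .
  ultimately have "len (s \<otimes> v) < len v" using len_left[OF vW assms(3)] by auto
  then obtain rr where "reduced (s # rr)" "prd (s # rr) = v" using descent_word[OF vW assms(3)] by metis
  then have "s \<in> J" using reduced_in_par[of "s # rr" J] assms(1,2) by simp
  then show False using assms(4) by blast
qed

text \<open>The element \<open>s v = v s\<close> has both \<open>s\<close> and the first letter
  \<open>r\<close> of \<open>v\<close> as descents, so it has a reduced word that begins by
  alternating \<open>s\<close> and \<open>r\<close>. What follows its first letter multiplies to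
  \<open>v\<close> and contains no \<open>s\<close>, so the alternation stops after
  \<open>s r\<close>; the corresponding braid relation is \<open>s r = r s\<close>.\<close>

lemma commute_word:
  assumes "J \<subseteq> S" "s \<in> S" "s \<notin> J"
  shows "reduced vv \<Longrightarrow> set vv \<subseteq> J \<Longrightarrow> s \<otimes> prd vv = prd vv \<otimes> s \<Longrightarrow> \<forall>r\<in>set vv. s \<otimes> r = r \<otimes> s"
proof (induction vv)
  case (Cons r vv)
  have r: "r \<in> J" "r \<in> S" and vJ: "set vv \<subseteq> J" and vS: "set vv \<subseteq> S" using Cons.prems assms(1) by auto
  define v where "v = prd (r # vv)"
  have vW: "v \<in> W" unfolding v_def using prd_W[of "r # vv"] r vS by simp
  have vpar: "v \<in> par J" unfolding v_def par_def using Cons.prems(2) by blast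
  define x where "x = s \<otimes> v"
  have xW: "x \<in> W" unfolding x_def using W_mult S_W assms(2) vW by blast
  have lx: "len x = Suc (len v)" unfolding x_def using len_up_outside[OF assms(1) vpar assms(2,3)] .
  have sx: "s \<otimes> x = v" unfolding x_def using S_cancel assms(2) vW W_carrier by simp
  have xs: "x = v \<otimes> s" unfolding x_def using Cons.prems(3) v_def by simp
  have rx: "r \<otimes> x = prd vv \<otimes> s" unfolding xs v_def
    using S_cancel[OF r(2), of "prd vv \<otimes> s"] r(2) S_carrier assms(2) prd_carrier[OF vS] by (simp add: m_assoc)
  have lenv: "len v = Suc (length vv)" using Cons.prems(1) unfolding reduced_def v_def by simp
  have desc: "len (s \<otimes> x) < len x" "len (r \<otimes> x) < len x"
  proof -
    show "len (s \<otimes> x) < len x" using lx sx by simp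
    have "len (r \<otimes> x) \<le> length vv + 1"
      unfolding rx using len_mult[OF prd_W[OF vS] S_W[OF assms(2)]] len_le[OF vS] len_S[OF assms(2)] by simp
    then show "len (r \<otimes> x) < len x" using lx lenv by simp
  qed
  obtain k yy where k: "reduced (alt s r (Suc k) @ yy)" "prd (alt s r (Suc k)) = prd (alt r s (Suc k))"
    "prd (alt s r (Suc k) @ yy) = x"
    using two_descents[OF assms(2) r(2) xW desc] by metis
  have rs: "r \<noteq> s" using r assms by blast
  have redx: "reduced (s # alt r s k @ yy)" and px: "prd (s # alt r s k @ yy) = x" using k by simp_all
  have S2: "set (alt r s k @ yy) \<subseteq> S" using redx unfolding reduced_def by simp
  have "s \<otimes> x = prd (alt r s k @ yy)"
    using px S_cancel[OF assms(2) prd_carrier[OF S2]] by auto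
  then have "prd (alt r s k @ yy) \<in> par J" using sx vpar by simp
  then have sub: "set (alt r s k @ yy) \<subseteq> J" using reduced_in_par[OF reduced_Cons[OF redx] assms(1)] by blast
  have k1: "k < 2"
  proof (rule ccontr)
    assume "\<not> k < 2"
    then obtain j where "k = Suc (Suc j)" by (metis add_2_eq_Suc le_Suc_ex not_less)
    then show False using sub assms(3) by simp
  qed
  have k0: "k \<noteq> 0"
  proof
    assume "k = 0"
    then have "s = r" using k(2) S_carrier r(2) assms(2) by simp
    then show False using rs by simp
  qed
  have comm: "s \<otimes> r = r \<otimes> s"
  proof -
    have "k = 1" using k0 k1 by simp
    then show ?thesis using k(2) S_carrier r(2) assms(2) by simp
  qed
  have c: "prd vv \<in> carrier G" "r \<in> carrier G" "s \<in> carrier G" using prd_carrier[OF vS] r(2) assms(2) S_carrier by auto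
  have "r \<otimes> (s \<otimes> prd vv) = r \<otimes> (prd vv \<otimes> s)"
    using Cons.prems(3) comm c by (simp add: m_assoc[symmetric])
  then have "s \<otimes> prd vv = prd vv \<otimes> s" using c by simp
  then show ?case using Cons.IH[OF reduced_Cons[OF Cons.prems(1)] vJ] comm by simp
qed simp

text \<open>Comparing the letters of \<open>s v\<close> and \<open>v t\<close> gives
  \<open>s = t\<close>, because \<open>s\<close> does not occur in \<open>v\<close>.\<close>

lemma twisted_commute:
  assumes J: "J \<subseteq> S" "v \<in> par J" and s: "s \<in> S" "s \<notin> J" and t: "t \<in> S" "t \<notin> J"
    and eq: "s \<otimes> v = v \<otimes> t"
  shows "s = t" "v \<in> par {r\<in>J. s \<otimes> r = r \<otimes> s}"
proof -
  have vW: "v \<in> W" using par_W[OF J] .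
  obtain vv where vv: "reduced vv" "prd vv = v" using reduced_ex[OF vW] by blast
  have vJ: "set vv \<subseteq> J" using reduced_in_par[OF vv(1) J(1)] vv(2) J(2) by simp
  have vS: "set vv \<subseteq> S" using vJ J(1) by blast
  have red: "reduced (s # vv)" using len_up_outside[OF J s] vv s(1) unfolding reduced_def by simp
  have "prd (s # vv) = prd (vv @ [t])" using eq vv prd_append[OF vS, of "[t]"] t(1) S_carrier by simp
  then have "prd (s # vv) \<in> par (set vv \<union> {t})" unfolding par_def by auto
  then have "set (s # vv) \<subseteq> set vv \<union> {t}" using reduced_in_par[OF red, of "set vv \<union> {t}"] vS t(1) by blast
  then show st: "s = t" using vJ s(2) by auto
  have "\<forall>r\<in>set vv. s \<otimes> r = r \<otimes> s"
    using commute_word[OF J(1) s vv(1) vJ] eq vv(2) st by simp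
  then have "set vv \<subseteq> {r\<in>J. s \<otimes> r = r \<otimes> s}" using vJ by blast
  then show "v \<in> par {r\<in>J. s \<otimes> r = r \<otimes> s}" unfolding par_def using vv(2) by blast
qed

text \<open>As \<open>s\<close> lengthens \<open>v\<close>, multiplying \<open>s v\<close> by
  \<open>t\<close> must shorten it again. Apply exchange to the inverse word: deleting the letter
  \<open>s\<close> gives \<open>s v t = v\<close>, and deleting a letter of \<open>v\<close> would
  put \<open>t\<close> into \<open>par J\<close>.\<close>

lemma no_increase_commute:
  assumes J: "J \<subseteq> S" "v \<in> par J" and s: "s \<in> S" "s \<notin> J" and t: "t \<in> S" "t \<notin> J"
    and le: "len (s \<otimes> v \<otimes> t) \<le> len v"
  shows "s \<otimes> v = v \<otimes> t"
proof -
  have vW: "v \<in> W" using par_W[OF J] .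
  obtain vv where vv: "reduced vv" "prd vv = v" using reduced_ex[OF vW] by blast
  have vJ: "set vv \<subseteq> J" using reduced_in_par[OF vv(1) J(1)] vv(2) J(2) by simp
  have vS: "set vv \<subseteq> S" using vJ J(1) by blast
  have up: "len (s \<otimes> v) = Suc (len v)" using len_up_outside[OF J s] .
  have red: "reduced (rev vv @ [s])"
    using reduced_rev[of "s # vv"] up vv s(1) unfolding reduced_def by simp
  define x where "x = s \<otimes> v"
  have xW: "x \<in> W" unfolding x_def using W_mult S_W s vW by blast
  have c: "s \<in> carrier G" "t \<in> carrier G" "v \<in> carrier G" "x \<in> carrier G" using S_carrier s t vW xW W_carrier by auto
  have px: "prd (rev vv @ [s]) = inv x"
    using prd_rev[of "s # vv"] vS s(1) vv(2) unfolding x_def by simp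
  have "inv (x \<otimes> t) = t \<otimes> inv x" using c t inv_S by (simp add: inv_mult_group)
  then have "len (t \<otimes> inv x) = len (x \<otimes> t)" using len_inv[OF W_mult[OF xW S_W[OF t(1)]]] by simp
  then have "len (t \<otimes> prd (rev vv @ [s])) \<le> len (prd (rev vv @ [s]))"
    unfolding px using le up len_inv[OF xW] unfolding x_def by simp
  then obtain a r b where arb: "rev vv @ [s] = a @ r # b" "t \<otimes> prd (rev vv @ [s]) = prd (a @ b)"
    using exchange[OF red t(1)] by metis
  show ?thesis
  proof (cases b rule: rev_cases)
    case Nil
    then have "a = rev vv" using arb(1) by simp
    then have "t \<otimes> inv x = inv v" using arb(2) px Nil prd_rev[OF vS] vv(2) by simp
    then have "inv (x \<otimes> t) = inv v" using c t inv_S by (simp add: inv_mult_group)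
    then have "x \<otimes> t = v" using c by (metis inv_inv m_closed)
    then have "x \<otimes> t \<otimes> t = v \<otimes> t" by simp
    then show ?thesis using S_cancel'[OF t(1) c(4)] unfolding x_def by simp
  next
    case (snoc b' q)
    then have q: "q = s" "rev vv = a @ r # b'" using arb(1) by auto
    have S3: "set a \<subseteq> J" "set b' \<subseteq> J" using q(2) vJ by (metis le_sup_iff set_append set_rev set_subset_Cons subset_trans)+
    have S4: "set (a @ b') \<subseteq> S" using S3 J(1) by auto
    have "t \<otimes> prd (rev vv) \<otimes> s = prd (a @ b') \<otimes> s"
      using arb(2) prd_append[of "rev vv" "[s]"] prd_append[OF S4, of "[s]"] snoc q(1) vS s(1) c prd_carrier[of "rev vv"]
      by (simp add: m_assoc)
    then have "t \<otimes> inv v = prd (a @ b')" using c prd_rev[OF vS] vv(2) prd_carrier[OF S4] by simp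
    then have "t = prd (a @ b') \<otimes> v" using c by (metis inv_solve_right' inv_closed m_closed prd_carrier[OF S4] inv_inv inv_solve_right)
    moreover have "prd (a @ b') \<in> par J" unfolding par_def using S3 by (auto intro!: exI[of _ "a @ b'"])
    ultimately have "t \<in> par J" using par_mult[OF J(1) _ J(2)] by simp
    then show ?thesis using S_in_par[OF J(1) t(1)] t(2) by blast
  qed
qed

lemma coxeter_system_par:
  assumes J: "J \<subseteq> S"
  shows "coxeter_system G (par J) J" "x \<in> par J \<Longrightarrow> cox_lenW G J x = len x"
proof -
  have lenJ: "cox_lenW G J x = len x" if x: "x \<in> par J" for x
    unfolding cox_lenW_def[of G J]
  proof (rule Least_equality)
    obtain ss where ss: "reduced ss" "prd ss = x" using reduced_ex[OF par_W[OF J x]] by blast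
    have "set ss \<subseteq> J" using reduced_in_par[OF ss(1) J] ss(2) x by simp
    then show "\<exists>ss. set ss \<subseteq> J \<and> length ss = len x \<and> x = prd ss" using ss unfolding reduced_def by blast
    fix n assume "\<exists>ss. set ss \<subseteq> J \<and> length ss = n \<and> x = prd ss"
    then show "len x \<le> n" using len_le J by blast
  qed
  show "coxeter_system G (par J) J"
    unfolding coxeter_system_def
  proof (intro conjI ballI allI impI)
    show "subgroup (par J) G" using par_subgroup[OF J] .
    show "J \<subseteq> par J" using par_gen[OF J] by blast
    show "s \<noteq> \<one>" "s \<otimes> s = \<one>" if "s \<in> J" for s using that J S_ne S_sq by auto
    show "\<exists>ss. set ss \<subseteq> J \<and> x = prd ss" if "x \<in> par J" for x using that unfolding par_def by blast
    fix s ss assume s: "s \<in> J" and ss: "set ss \<subseteq> J" "length ss = cox_lenW G J (prd ss)"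
      "cox_lenW G J (s \<otimes> prd ss) \<le> cox_lenW G J (prd ss)"
    have p: "prd ss \<in> par J" unfolding par_def using ss(1) by blast
    have sp: "s \<otimes> prd ss \<in> par J" using par_mult[OF J par_gen[OF J s] p] .
    have "set ss \<subseteq> S" "length ss = len (prd ss)" "len (s \<otimes> prd ss) \<le> len (prd ss)" "s \<in> S"
      using ss s J lenJ[OF p] lenJ[OF sp] by auto
    then show "\<exists>i<length ss. s \<otimes> prd ss = prd (take i ss @ drop (Suc i) ss)"
      using cs unfolding coxeter_system_def by blast
  qed
  show "x \<in> par J \<Longrightarrow> cox_lenW G J x = len x" using lenJ .
qed

end

subsection \<open>Twisted conjugacy\<close>

locale twisted_coxeter = finite_coxeter +
  fixes \<sigma> u
  assumes sig: "\<sigma> \<in> carrier G" and sig_S: "s \<in> S \<Longrightarrow> \<sigma> \<otimes> s \<otimes> inv \<sigma> \<in> S" and u: "u \<in> W"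
begin

definition cj where "cj x = \<sigma> \<otimes> x \<otimes> inv \<sigma>"
definition cji where "cji x = inv \<sigma> \<otimes> x \<otimes> \<sigma>"

lemma cj_carrier: "x \<in> carrier G \<Longrightarrow> cj x \<in> carrier G" "x \<in> carrier G \<Longrightarrow> cji x \<in> carrier G"
  unfolding cj_def cji_def using sig by auto

lemma cj_cancel: "x \<in> carrier G \<Longrightarrow> inv \<sigma> \<otimes> (\<sigma> \<otimes> x) = x" "x \<in> carrier G \<Longrightarrow> \<sigma> \<otimes> (inv \<sigma> \<otimes> x) = x"
  using sig by (simp_all add: m_assoc[symmetric])

lemma cj_cji: "x \<in> carrier G \<Longrightarrow> cj (cji x) = x" "x \<in> carrier G \<Longrightarrow> cji (cj x) = x"
  unfolding cj_def cji_def using sig by (simp_all add: m_assoc cj_cancel)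

lemma cj_mult: "x \<in> carrier G \<Longrightarrow> y \<in> carrier G \<Longrightarrow> cj (x \<otimes> y) = cj x \<otimes> cj y"
  "x \<in> carrier G \<Longrightarrow> y \<in> carrier G \<Longrightarrow> cji (x \<otimes> y) = cji x \<otimes> cji y"
  unfolding cj_def cji_def using sig by (simp_all add: m_assoc cj_cancel)

lemma cj_one: "cj \<one> = \<one>" "cji \<one> = \<one>"
  unfolding cj_def cji_def using sig by simp_all

lemma cj_inv: "x \<in> carrier G \<Longrightarrow> cj (inv x) = inv (cj x)"
proof -
  assume x: "x \<in> carrier G"
  have "cj (inv x) \<otimes> cj x = \<one>" using cj_mult(1)[of "inv x" x] x cj_one by simp
  then show ?thesis using inv_equality[of "cj (inv x)" "cj x"] cj_carrier x by simp
qed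

lemma cj_S: "s \<in> S \<Longrightarrow> cj s \<in> S" unfolding cj_def using sig_S .

lemma cji_S: "s \<in> S \<Longrightarrow> cji s \<in> S"
proof -
  have "inj_on cj S" by (rule inj_onI) (metis cj_cji(2) S_carrier)
  then have "cj ` S = S" using endo_inj_surj[OF finite_S] cj_S by blast
  moreover assume "s \<in> S"
  ultimately obtain t where "t \<in> S" "s = cj t" by blast
  then show ?thesis using cj_cji(2) S_carrier by simp
qed

lemma prd_cj: "set ss \<subseteq> S \<Longrightarrow> prd (map cj ss) = cj (prd ss)" "set ss \<subseteq> S \<Longrightarrow> prd (map cji ss) = cji (prd ss)"
  by (induction ss) (auto simp: cj_one cj_mult S_carrier prd_carrier)

lemma cj_W: "x \<in> W \<Longrightarrow> cj x \<in> W" "x \<in> W \<Longrightarrow> cji x \<in> W"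
proof -
  assume "x \<in> W"
  then obtain ss where ss: "set ss \<subseteq> S" "x = prd ss" using W_gen by blast
  have "set (map cj ss) \<subseteq> S" "set (map cji ss) \<subseteq> S" using ss cj_S cji_S by auto
  then show "cj x \<in> W" "cji x \<in> W" using prd_W prd_cj[OF ss(1)] ss(2) by metis+
qed

lemma m_cji: "s \<in> S \<Longrightarrow> t \<in> S \<Longrightarrow> m (cji s) (cji t) = m s t"
proof -
  assume st: "s \<in> S" "t \<in> S"
  have c: "s \<otimes> t \<in> carrier G" using st S_carrier by simp
  have pow: "(cji s \<otimes> cji t) [^] n = cji ((s \<otimes> t) [^] n)" for n :: nat
    by (induction n) (use st S_carrier c in \<open>auto simp: cj_one cj_mult\<close>)
  have "(cji s \<otimes> cji t) [^] n = \<one> \<longleftrightarrow> (s \<otimes> t) [^] n = \<one>" for n :: nat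
    unfolding pow using cj_cji(1)[of "(s \<otimes> t) [^] n"] c cj_one by (metis nat_pow_closed)
  then have "m (cji s) (cji t) dvd n \<longleftrightarrow> m s t dvd n" for n
    using m_pow[OF st] m_pow[OF cji_S[OF st(1)] cji_S[OF st(2)]] by simp
  from this[of "m s t"] this[of "m (cji s) (cji t)"] show ?thesis by (simp add: dvd_antisym)
qed

definition P :: "('a \<Rightarrow> real) \<Rightarrow> 'a \<Rightarrow> real" where "P v = (\<lambda>t. if t \<in> S then v (cji t) else 0)"

lemma bij_cji: "bij_betw cji S S"
  by (rule bij_betw_byWitness[where f' = cj]) (auto simp: cj_cji S_carrier cj_S cji_S)

lemma bs_P: "s \<in> S \<Longrightarrow> bs s (P v) = bs (cji s) v"
proof -
  assume s: "s \<in> S"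
  have "bs (cji s) v = (\<Sum>t\<in>S. B (cji s) (cji t) * v (cji t))"
    unfolding bs_def by (rule sum.reindex_bij_betw[OF bij_cji, symmetric])
  also have "\<dots> = bs s (P v)" unfolding bs_def
    by (rule sum.cong) (auto simp: B_def m_cji s P_def)
  finally show ?thesis by simp
qed

lemma e_cji: "s \<in> S \<Longrightarrow> t \<in> S \<Longrightarrow> e (cji s) (cji t) = e s t"
  unfolding e_def by (metis cj_cji(1) S_carrier)

lemma refl_P: "s \<in> S \<Longrightarrow> refl s (P v) = P (refl (cji s) v)"
proof
  fix t assume s: "s \<in> S"
  have l: "refl s (P v) t = P v t - 2 * bs (cji s) v * e s t" by (simp add: refl_def bs_P[OF s])
  show "refl s (P v) t = P (refl (cji s) v) t"
  proof (cases "t \<in> S")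
    case True
    then show ?thesis unfolding l using e_cji[OF s True] by (simp add: P_def refl_def)
  next
    case False
    then have "t \<noteq> s" using s by blast
    then show ?thesis unfolding l using False by (simp add: P_def e_def)
  qed
qed

lemma acts_P: "set ss \<subseteq> S \<Longrightarrow> acts ss (P v) = P (acts (map cji ss) v)"
  by (induction ss) (auto simp: refl_P)

lemma rho_P: "x \<in> W \<Longrightarrow> rho x (P v) = P (rho (cji x) v)"
proof -
  assume "x \<in> W"
  then obtain ss where ss: "set ss \<subseteq> S" "x = prd ss" using W_gen by blast
  have "set (map cji ss) \<subseteq> S" using ss cji_S by auto
  then show ?thesis using acts_P[OF ss(1)] acts_rho[OF ss(1)] acts_rho[of "map cji ss"] prd_cj(2)[OF ss(1)] ss(2) by metis
qed

lemma P_rho: "x \<in> W \<Longrightarrow> P (rho x v) = rho (cj x) (P v)"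
  using rho_P[OF cj_W(1), of x v] cj_cji(2) W_carrier by simp

lemma P_e: "s \<in> S \<Longrightarrow> P (e s) = e (cj s)"
  unfolding P_def e_def by (auto simp: fun_eq_iff cj_S cj_cji S_carrier)

lemma P_R: "v \<in> R \<Longrightarrow> P v \<in> R"
proof -
  assume "v \<in> R"
  then obtain x s where v: "v = rho x (e s)" "x \<in> W" "s \<in> S" unfolding R_def by blast
  then have "P v = rho (cj x) (e (cj s))" using P_rho P_e by simp
  then show ?thesis unfolding R_def using cj_W v cj_S by blast
qed

lemma P_inj: "inj_on P R"
proof
  fix v q assume vq: "v \<in> R" "q \<in> R" "P v = P q"
  show "v = q"
  proof
    fix r
    show "v r = q r"
    proof (cases "r \<in> S")
      case True
      have "P v (cj r) = P q (cj r)" using vq by simp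
      then show ?thesis using True cj_S cj_cji S_carrier unfolding P_def by simp
    next
      case False
      then show ?thesis using R_supp[OF vq(1)] R_supp[OF vq(2)] by simp
    qed
  qed
qed

lemma P_image: "P ` R = R"
  using endo_inj_surj[OF finite_R _ P_inj] P_R by blast

lemma P_nonpos: "v \<in> R \<Longrightarrow> (\<forall>r. P v r \<le> 0) \<longleftrightarrow> (\<forall>r. v r \<le> 0)"
proof
  assume v: "v \<in> R" and P: "\<forall>r. P v r \<le> 0"
  show "\<forall>r. v r \<le> 0"
  proof
    fix r
    show "v r \<le> 0"
    proof (cases "r \<in> S")
      case True
      then show ?thesis using P[rule_format, of "cj r"] cj_S cj_cji S_carrier unfolding P_def by simp
    next
      case False
      then show ?thesis using R_supp[OF v] by simp
    qed
  qed
qed (simp add: P_def)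

section \<open>The isometry attached to \<open>u \<sigma>\<close>\<close>

definition tperm :: "'a \<times> 'a \<Rightarrow> 'a \<times> 'a" where
  "tperm = (\<lambda>(x, t). if x \<in> W \<and> t \<in> S then (cji (x \<otimes> u), cji t) else (x, t))"

lemma bij_tperm: "bij tperm"
proof -
  define k where "k = (\<lambda>(x, t). if x \<in> W \<and> t \<in> S then (cj x \<otimes> inv u, cj t) else (x, t))"
  have uc: "u \<in> carrier G" "inv u \<in> W" using u W_carrier W_inv by auto
  have 1: "k (tperm (x, t)) = (x, t)" for x t
  proof (cases "x \<in> W \<and> t \<in> S")
    case True
    have xu: "x \<otimes> u \<in> W" "x \<in> carrier G" using True W_mult u W_carrier by auto
    have "cji (x \<otimes> u) \<in> W" "cji t \<in> S" using cj_W(2)[OF xu(1)] cji_S True by auto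
    then have "k (tperm (x, t)) = (cj (cji (x \<otimes> u)) \<otimes> inv u, cj (cji t))" unfolding tperm_def k_def using True by simp
    then show ?thesis using True xu uc cj_cji(1)[OF W_carrier[OF xu(1)]] cj_cji(1)[OF S_carrier] by (simp add: m_assoc)
  qed (auto simp: tperm_def k_def)
  have 2: "tperm (k (x, t)) = (x, t)" for x t
  proof (cases "x \<in> W \<and> t \<in> S")
    case True
    have cx: "cj x \<otimes> inv u \<in> W" "cj x \<in> carrier G" "x \<in> carrier G"
      using W_mult[OF cj_W(1) uc(2)] cj_W(1)[THEN W_carrier] W_carrier True by blast+
    have "cj t \<in> S" using cj_S True by auto
    then have "tperm (k (x, t)) = (cji (cj x \<otimes> inv u \<otimes> u), cji (cj t))" unfolding tperm_def k_def using True cx by simp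
    then show ?thesis using True cx uc cj_cji(2)[OF cx(3)] cj_cji(2)[OF S_carrier] by (simp add: m_assoc)
  qed (auto simp: tperm_def k_def)
  show ?thesis
    by (rule bij_betw_byWitness[where f' = k]) (auto simp: 1 2)
qed

definition tact where "tact = pull tperm"
definition tact' where "tact' = pull (inv_into UNIV tperm)"

sublocale tact: isometry_pair tact tact'
proof (rule isometry_pair.intro)
  show "linear tact" unfolding tact_def by (rule linear_pull[OF bij_tperm])
  show "linear tact'" unfolding tact'_def by (rule linear_pull[OF bij_imp_bij_inv[OF bij_tperm]])
  show "tact (tact' x) = x" for x unfolding tact_def tact'_def by (rule pull_inv(1)[OF bij_tperm])
  show "tact' (tact x) = x" for x unfolding tact_def tact'_def by (rule pull_inv(2)[OF bij_tperm])
  show "tact x \<bullet> tact y = x \<bullet> y" for x y unfolding tact_def by (rule inner_pull[OF bij_tperm])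
qed

text \<open>This explains \<open>tperm\<close>: the coordinate of the image at \<open>(x, t)\<close>
  is the \<open>t\<close>-coordinate of \<open>x u \<sigma>\<close> applied to \<open>v\<close>, and
  moving \<open>\<sigma>\<close> to the left turns it into the coordinate of \<open>v\<close> at
  \<open>(cji (x \<otimes> u), cji t)\<close>.\<close>

lemma tact_iota: "tact (iota v) = iota (rho u (P v))"
proof (rule fvec_eqI)
  fix i :: "'a \<times> 'a"
  obtain x t where i: "i = (x, t)" by (cases i)
  have "rho (cji (x \<otimes> u)) v (cji t) = rho x (rho u (P v)) t" if "x \<in> W" "t \<in> S"
  proof -
    have "rho x (rho u (P v)) = P (rho (cji (x \<otimes> u)) v)"
      using rho_mult[OF that(1) u] rho_P[OF W_mult[OF that(1) u]] by simp
    then show ?thesis using that unfolding P_def by simp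
  qed
  moreover have "coord (tact (iota v)) i = coord (iota v) (tperm (x, t))"
    unfolding tact_def coord_pull[OF bij_tperm] i ..
  ultimately show "coord (tact (iota v)) i = coord (iota (rho u (P v))) i"
    using u cj_W(2)[of "x \<otimes> u"] cji_S[of t]
    by (cases "x \<in> W \<and> t \<in> S") (auto simp: i tperm_def coord_iota W_mult)
qed

lemma tact_Phi: "\<alpha> \<in> Phi \<Longrightarrow> tact \<alpha> \<in> Phi"
  unfolding Phi_def using tact_iota P_R rho_R[OF _ u] by auto

lemma arr_Phi: "tact.arr Phi"
proof -
  have fin: "finite Phi" unfolding Phi_def using finite_R by simp
  have inj: "inj tact" by (metis injI tact.inv2)
  have "tact ` Phi = Phi"
    by (rule endo_inj_surj[OF fin]) (use tact_Phi inj_on_subset[OF inj] in auto)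
  then have "tact' \<alpha> \<in> Phi" if "\<alpha> \<in> Phi" for \<alpha> using that by (metis imageE tact.inv2)
  then show ?thesis unfolding tact.arr_def using symmetric_arrangement_Phi tact_Phi by blast
qed

text \<open>Defined so that \<open>y\<inverse> (u \<sigma>) y = tconj y \<sigma>\<close>.\<close>
definition tconj where "tconj y = inv y \<otimes> u \<otimes> cj y"

lemma tconj_W: "y \<in> W \<Longrightarrow> tconj y \<in> W"
  unfolding tconj_def by (simp add: W_mult W_inv u cj_W(1))

text \<open>Write \<open>g\<close> for \<open>tconj y\<close>. A root \<open>iota v\<close> is
  negative on the chamber of \<open>y\<close> while its image under \<open>tact\<close> is positive
  exactly when \<open>rho (inv y \<otimes> u) (P v)\<close> is an inversion of \<open>g\<close>, and
  inversions count length.\<close>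

lemma disp_chamber_pt:
  assumes y: "y \<in> W"
  shows "tact.disp Phi (chamber_pt y) = len (tconj y)"
proof -
  define g where "g = tconj y"
  have gW: "g \<in> W" unfolding g_def using tconj_W[OF y] .
  define k where "k = inv y \<otimes> u"
  have kW: "k \<in> W" unfolding k_def by (simp add: W_mult W_inv y u)
  have key: "rho (inv g) (rho k (P v)) = P (rho (inv y) v)" for v
  proof -
    have "inv g \<otimes> k = inv (cj y)"
      unfolding g_def tconj_def k_def[symmetric]
      using kW cj_W(1)[OF y] W_carrier by (simp add: inv_mult_group m_assoc)
    then have "inv g \<otimes> k = cj (inv y)" using cj_inv W_carrier y by simp
    then show ?thesis using rho_mult[OF W_inv[OF gW] kW] P_rho[OF W_inv[OF y]] by simp
  qed
  have "{\<alpha>\<in>Phi. 0 < chamber_pt y \<bullet> \<alpha> \<and> chamber_pt y \<bullet> tact' \<alpha> < 0}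
      = (\<lambda>v. iota (rho u (P v))) ` {v \<in> R. rho k (P v) \<in> N g}"
  proof -
    have sgn: "0 < chamber_pt y \<bullet> tact (iota v) \<and> chamber_pt y \<bullet> iota v < 0 \<longleftrightarrow> rho k (P v) \<in> N g" if v: "v \<in> R" for v
    proof -
      have "rho (inv y) (rho u (P v)) = rho k (P v)" unfolding k_def using rho_mult[OF W_inv[OF y] u] by simp
      then have "0 < chamber_pt y \<bullet> tact (iota v) \<longleftrightarrow> (\<forall>r. 0 \<le> rho k (P v) r)"
        unfolding tact_iota using chamber_pt_sign(1)[OF y rho_R[OF P_R[OF v] u]] by simp
      moreover have "chamber_pt y \<bullet> iota v < 0 \<longleftrightarrow> (\<forall>r. rho (inv g) (rho k (P v)) r \<le> 0)"
        unfolding key using chamber_pt_sign(2)[OF y v] P_nonpos[OF rho_R[OF v W_inv[OF y]]] by simp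
      ultimately show ?thesis unfolding N_def using rho_R[OF P_R[OF v] kW] by blast
    qed
    show ?thesis
    proof (intro equalityI subsetI)
      fix \<alpha> assume a: "\<alpha> \<in> {\<alpha>\<in>Phi. 0 < chamber_pt y \<bullet> \<alpha> \<and> chamber_pt y \<bullet> tact' \<alpha> < 0}"
      then have "tact' \<alpha> \<in> Phi" using tact.arrD(6)[OF arr_Phi] by blast
      then obtain v where v: "tact' \<alpha> = iota v" "v \<in> R" unfolding Phi_def by blast
      then have "\<alpha> = tact (iota v)" by (metis tact.inv1)
      then show "\<alpha> \<in> (\<lambda>v. iota (rho u (P v))) ` {v \<in> R. rho k (P v) \<in> N g}"
        using a v sgn[OF v(2)] by (auto simp: tact_iota[symmetric])
    next
      fix \<alpha> assume "\<alpha> \<in> (\<lambda>v. iota (rho u (P v))) ` {v \<in> R. rho k (P v) \<in> N g}"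
      then obtain v where v: "\<alpha> = tact (iota v)" "v \<in> R" "rho k (P v) \<in> N g" by (auto simp: tact_iota[symmetric])
      moreover have "\<alpha> \<in> Phi" using v tact_Phi unfolding Phi_def by blast
      ultimately show "\<alpha> \<in> {\<alpha>\<in>Phi. 0 < chamber_pt y \<bullet> \<alpha> \<and> chamber_pt y \<bullet> tact' \<alpha> < 0}" using sgn[OF v(2)] by auto
    qed
  qed
  moreover have "inj_on (\<lambda>v. iota (rho u (P v))) R"
  proof
    fix v q assume vq: "v \<in> R" "q \<in> R" "iota (rho u (P v)) = iota (rho u (P q))"
    then have "rho u (P v) = rho u (P q)" using iota_inj rho_R[OF P_R u] unfolding inj_on_def by blast
    then have "P v = P q" using rho_inv(1)[OF u] by metis
    then show "v = q" using P_inj vq unfolding inj_on_def by blast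
  qed
  then have "inj_on (\<lambda>v. iota (rho u (P v))) {v \<in> R. rho k (P v) \<in> N g}" by (rule inj_on_subset) auto
  ultimately have "tact.disp Phi (chamber_pt y) = card {v \<in> R. rho k (P v) \<in> N g}"
    unfolding tact.disp_def by (simp add: card_image)
  also have "\<dots> = card (N g)"
  proof (rule bij_betw_same_card[of "\<lambda>v. rho k (P v)"], unfold bij_betw_def, intro conjI)
    show "inj_on (\<lambda>v. rho k (P v)) {v \<in> R. rho k (P v) \<in> N g}"
      by (rule inj_onI) (metis (no_types, lifting) P_inj inj_onD mem_Collect_eq rho_inv(1)[OF kW])
    show "(\<lambda>v. rho k (P v)) ` {v \<in> R. rho k (P v) \<in> N g} = N g"
    proof (intro equalityI subsetI)
      fix q assume q: "q \<in> N g"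
      then have "rho (inv k) q \<in> R" using rho_R W_inv[OF kW] unfolding N_def by blast
      then obtain v where v: "v \<in> R" "P v = rho (inv k) q" using P_image by (metis imageE)
      then have "rho k (P v) = q" using rho_inv(2)[OF kW] by simp
      then show "q \<in> (\<lambda>v. rho k (P v)) ` {v \<in> R. rho k (P v) \<in> N g}" using v q by blast
    qed auto
  qed
  also have "\<dots> = len g" by (rule card_N[OF gW])
  finally show ?thesis unfolding g_def .
qed

text \<open>Move a fixed vector \<open>p\<close> to a dominant position by \<open>y\<close>. The
  conjugate \<open>tconj y \<sigma>\<close> fixes the resulting functional, so by
  \<open>dominant_stabilizer\<close> the element \<open>tconj y\<close> lies in the parabolic
  subgroup of the simple roots on which it vanishes. These form a stable set, so by assumption all
  simple roots are among them, and \<open>p\<close> is orthogonal to every root.\<close>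

lemma no_fixed_vector:
  assumes ell: "\<And>x K. x \<in> W \<Longrightarrow> K \<subseteq> S \<Longrightarrow> (\<And>s. s \<in> K \<Longrightarrow> cj s \<in> K) \<Longrightarrow> tconj x \<in> par K \<Longrightarrow> K = S"
    and p: "p \<in> span Phi" "tact p = p"
  shows "p = 0"
proof -
  obtain y where y: "y \<in> W" "\<And>s. s \<in> S \<Longrightarrow> 0 \<le> p \<bullet> iota (rho y (e s))" using dominant_translate[of p] by blast
  define F where "F v = p \<bullet> iota (rho y v)" for v
  have Flin: "F (\<lambda>r. a * v r + b * q r) = a * F v + b * F q" for a b v q
    unfolding F_def by (rule iota_functional)
  define K where "K = {s\<in>S. F (e s) = 0}"
  have ginv: "F (rho (tconj y) (P q)) = F q" for q
  proof -
    have eq: "y \<otimes> tconj y = u \<otimes> cj y"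
      unfolding tconj_def using y(1) u W_carrier cj_W(1)[OF y(1)] by (simp add: m_assoc[symmetric])
    have "F q = p \<bullet> tact (iota (rho y q))" unfolding F_def using tact.iso[of p "iota (rho y q)"] p(2) by simp
    also have "\<dots> = p \<bullet> iota (rho u (rho (cj y) (P q)))" unfolding tact_iota P_rho[OF y(1)] ..
    also have "rho u (rho (cj y) (P q)) = rho y (rho (tconj y) (P q))"
      using rho_mult[OF u cj_W(1)[OF y(1)]] rho_mult[OF y(1) tconj_W[OF y(1)]] eq by simp
    finally show ?thesis unfolding F_def by simp
  qed
  have g: "F (rho (tconj y) (e s)) = F (e (cji s))" if "s \<in> S" for s
    using ginv[of "e (cji s)"] P_e[OF cji_S[OF that]] cj_cji(1)[OF S_carrier[OF that]] by simp
  have dom: "0 \<le> F (e s)" if "s \<in> S" for s using y(2) that unfolding F_def by blast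
  have st: "tconj y \<in> par K" "\<And>v. F (rho (tconj y) v) = F v"
    using dominant_stabilizer[of F "tconj y", OF Flin dom tconj_W[OF y(1)]] g dom cji_S unfolding K_def by auto
  have "cj s \<in> K" if "s \<in> K" for s
  proof -
    have s: "s \<in> S" "F (e s) = 0" using that unfolding K_def by auto
    have "F (e (cj s)) = F (e (cji (cj s)))" using g[OF cj_S[OF s(1)]] st(2) by simp
    then show ?thesis using s cj_S cj_cji(2) S_carrier unfolding K_def by simp
  qed
  then have "K = S" using ell[OF y(1) _ _ st(1)] unfolding K_def by blast
  then have F0: "F (e s) = 0" if "s \<in> S" for s using that unfolding K_def by blast
  have "p \<bullet> \<alpha> = 0" if a: "\<alpha> \<in> Phi" for \<alpha>
  proof -
    obtain v where v: "\<alpha> = iota v" "v \<in> R" using a unfolding Phi_def by blast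
    define q where "q = rho (inv y) v"
    have q: "q \<in> R" "rho y q = v"
      unfolding q_def by (rule rho_R[OF v(2) W_inv[OF y(1)]], rule rho_inv(2)[OF y(1)])
    have "F q = (\<Sum>t\<in>S. q t * F (e t))"
      by (rule linear_functional_expand[of F q, OF Flin R_supp[OF q(1)]])
    then show ?thesis using F0 q(2) v(1) unfolding F_def by simp
  qed
  then show ?thesis using tact.orth_span_zero p(1) by blast
qed

text \<open>Chambers are translated back into elements of \<open>W\<close>: a step across one wall
  multiplies by a letter on the right, and displacement becomes the length of
  \<open>tconj\<close>.\<close>

theorem elliptic_paths:
  assumes ell: "\<And>x K. x \<in> W \<Longrightarrow> K \<subseteq> S \<Longrightarrow> (\<And>s. s \<in> K \<Longrightarrow> cj s \<in> K) \<Longrightarrow> tconj x \<in> par K \<Longrightarrow> K = S"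
    and x: "x \<in> W" "\<And>y. y \<in> W \<Longrightarrow> len (tconj x) \<le> len (tconj y)"
  shows "(\<lambda>y y'. \<exists>s\<in>S. y' = y \<otimes> s \<and> len (tconj y') \<le> len (tconj y))\<^sup>*\<^sup>* \<one> x"
proof -
  define rel where "rel y y' \<longleftrightarrow> (\<exists>s\<in>S. y' = y \<otimes> s \<and> len (tconj y') \<le> len (tconj y))" for y y'
  have disp: "tact.disp Phi c = len (tconj y)" if "regular Phi c" "y \<in> W" "same_side Phi c (chamber_pt y)" for c y
    using tact.disp_cong[OF arr_Phi that(1) chamber_pt_regular[OF that(2)] that(3)] disp_chamber_pt[OF that(2)] by simp
  have sep_eq: "sep Phi c d = sep Phi (chamber_pt y) (chamber_pt z)"
    if "regular Phi c" "regular Phi d" "y \<in> W" "z \<in> W" "same_side Phi c (chamber_pt y)" "same_side Phi d (chamber_pt z)" for c d y z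
  proof -
    have neg: "v \<bullet> \<alpha> < 0 \<longleftrightarrow> \<not> 0 < v \<bullet> \<alpha>" if "regular Phi v" "\<alpha> \<in> Phi" for v \<alpha>
      using that unfolding regular_def by (auto simp: not_less less_le)
    show ?thesis unfolding sep_def
      using that neg[OF that(1)] neg[OF chamber_pt_regular[OF that(3)]] unfolding same_side_def by blast
  qed
  have "(tact.step Phi)\<^sup>*\<^sup>* (chamber_pt \<one>) (chamber_pt x)"
  proof (rule tact.min_disp_connected[OF arr_Phi])
    show "v = 0" if "v \<in> span Phi" "tact v = v" for v by (rule no_fixed_vector[OF ell that])
    show "regular Phi (chamber_pt \<one>)" "regular Phi (chamber_pt x)" using chamber_pt_regular W_one x by auto
    fix c assume c: "regular Phi c"
    obtain y where "y \<in> W" "same_side Phi c (chamber_pt y)" using chamber_ex[OF c] by blast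
    then show "tact.disp Phi (chamber_pt x) \<le> tact.disp Phi c" using disp[OF c] disp_chamber_pt[OF x(1)] x(2) by simp
  qed
  then have "\<exists>y\<in>W. same_side Phi (chamber_pt x) (chamber_pt y) \<and> rel\<^sup>*\<^sup>* \<one> y"
  proof (induction rule: rtranclp_induct)
    case base
    show ?case using W_one by (auto simp: same_side_def)
  next
    case (step c d)
    then obtain y where y: "y \<in> W" "same_side Phi c (chamber_pt y)" "rel\<^sup>*\<^sup>* \<one> y" by blast
    have cd: "regular Phi c" "regular Phi d" "card (sep Phi c d) \<le> 1" "tact.disp Phi d \<le> tact.disp Phi c"
      using step(2) unfolding tact.step_def by auto
    obtain z where z: "z \<in> W" "same_side Phi d (chamber_pt z)" using chamber_ex[OF cd(2)] by blast
    have le: "len (tconj z) \<le> len (tconj y)" using disp[OF cd(1) y(1,2)] disp[OF cd(2) z] cd(4) by simp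
    define s where "s = inv y \<otimes> z"
    have sW: "s \<in> W" unfolding s_def using W_mult W_inv y z by blast
    have zs: "z = y \<otimes> s" unfolding s_def using y(1) z(1) W_carrier by (simp add: m_assoc[symmetric])
    have "len s \<le> 1" using sep_eq[OF cd(1,2) y(1) z(1) y(2) z(2)] card_sep_chamber_pt[OF y(1) z(1)] cd(3) unfolding s_def by simp
    then consider "len s = 0" | "len s = 1" by linarith
    then have "rel\<^sup>*\<^sup>* y z"
    proof cases
      case 1
      then have "z = y" using len_0[OF sW] zs y(1) W_carrier by simp
      then show ?thesis by simp
    next
      case 2
      obtain ss where ss: "reduced ss" "prd ss = s" using reduced_ex[OF sW] by blast
      then have "length ss = 1" using 2 unfolding reduced_def by simp
      then obtain t where "ss = [t]" by (auto simp: length_Suc_conv)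
      then have "s \<in> S" using ss S_carrier unfolding reduced_def by auto
      then have "rel y z" unfolding rel_def using zs le by blast
      then show ?thesis by blast
    qed
    then show ?case using y(3) z by (meson rtranclp_trans)
  qed
  then obtain y where y: "y \<in> W" "same_side Phi (chamber_pt x) (chamber_pt y)" "rel\<^sup>*\<^sup>* \<one> y" by blast
  have "sep Phi (chamber_pt x) (chamber_pt y) = {}" using y(2) unfolding sep_def same_side_def by force
  then have "len (inv x \<otimes> y) = 0" using card_sep_chamber_pt[OF x(1) y(1)] by simp
  then have "inv x \<otimes> y = \<one>" using len_0 W_mult W_inv x(1) y(1) by blast
  then have "y = x" using x(1) y(1) W_carrier by (metis inv_equality inv_inv W_inv)
  then show ?thesis using y(3) unfolding rel_def by simp
qed

section \<open>Stable supports and moves inside the class\<close>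

definition stable :: "'a set \<Rightarrow> bool" where
  "stable I \<longleftrightarrow> I \<subseteq> S \<and> (\<forall>s\<in>I. cj s \<in> I)"

definition tsupp :: "'a \<Rightarrow> 'a set" where
  "tsupp v = {(\<sigma> [^] n) \<otimes> s \<otimes> inv (\<sigma> [^] n) | (n::nat) s. s \<in> cox_suppW G S v}"

text \<open>Paths are recorded on conjugating elements instead of members of the class. Niceness
  asks that every conjugating element be reached, which is more than reaching the conjugates
  themselves.\<close>

definition rel :: "'a \<Rightarrow> 'a \<Rightarrow> bool" where
  "rel y y' \<longleftrightarrow> (\<exists>s\<in>S. y' = y \<otimes> s \<and> len (tconj y') \<le> len (tconj y))"

lemma stable_cji: "stable I \<Longrightarrow> s \<in> I \<Longrightarrow> cji s \<in> I"
proof -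
  assume I: "stable I"
  then have fin: "finite I" using finite_subset[OF _ finite_S] unfolding stable_def by blast
  have "inj_on cj I" by (rule inj_onI) (metis cj_cji(2) S_carrier I stable_def subsetD)
  then have "cj ` I = I" using endo_inj_surj[OF fin] I unfolding stable_def by blast
  moreover assume "s \<in> I"
  ultimately obtain t where "t \<in> I" "s = cj t" by blast
  then show ?thesis using cj_cji(2) S_carrier I unfolding stable_def by auto
qed

lemma stable_S: "stable S" unfolding stable_def using cj_S by blast

lemma cj_par: "stable I \<Longrightarrow> x \<in> par I \<Longrightarrow> cj x \<in> par I"
proof -
  assume I: "stable I" and "x \<in> par I"
  then obtain ss where ss: "set ss \<subseteq> I" "x = prd ss" unfolding par_def by blast
  then have "cj x = prd (map cj ss)" using prd_cj(1)[of ss] I unfolding stable_def by auto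
  moreover have "set (map cj ss) \<subseteq> I" using ss I unfolding stable_def by auto
  ultimately show ?thesis unfolding par_def by blast
qed

lemma len_cj: "x \<in> W \<Longrightarrow> len (cj x) = len x"
proof -
  assume x: "x \<in> W"
  have le: "len (cj x) \<le> len x" if x: "x \<in> W" for x
  proof -
    obtain ss where ss: "reduced ss" "prd ss = x" using reduced_ex[OF x] by blast
    have sS: "set ss \<subseteq> S" using ss unfolding reduced_def by blast
    have "len (prd (map cj ss)) \<le> length (map cj ss)" using sS cj_S by (intro len_le) auto
    then show ?thesis using prd_cj(1)[OF sS] ss unfolding reduced_def by simp
  qed
  have le': "len (cji x) \<le> len x" if x: "x \<in> W" for x
  proof -
    obtain ss where ss: "reduced ss" "prd ss = x" using reduced_ex[OF x] by blast
    have sS: "set ss \<subseteq> S" using ss unfolding reduced_def by blast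
    have "len (prd (map cji ss)) \<le> length (map cji ss)" using sS cji_S by (intro len_le) auto
    then show ?thesis using prd_cj(2)[OF sS] ss unfolding reduced_def by simp
  qed
  show ?thesis using le[OF x] le'[OF cj_W(1)[OF x]] cj_cji(2)[OF W_carrier[OF x]] by simp
qed

lemma suppW_iff:
  assumes "I \<subseteq> S" "v \<in> W"
  shows "cox_suppW G S v \<subseteq> I \<longleftrightarrow> v \<in> par I"
proof
  assume sub: "cox_suppW G S v \<subseteq> I"
  obtain ss where ss: "reduced ss" "prd ss = v" using reduced_ex[OF assms(2)] by blast
  then have "set ss \<subseteq> cox_suppW G S v" unfolding cox_suppW_def reduced_def by blast
  then show "v \<in> par I" unfolding par_def using ss(2) sub by blast
next
  assume v: "v \<in> par I"
  show "cox_suppW G S v \<subseteq> I"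
  proof
    fix s assume "s \<in> cox_suppW G S v"
    then obtain ss where "reduced ss" "prd ss = v" "s \<in> set ss" unfolding cox_suppW_def reduced_def by auto
    then show "s \<in> I" using reduced_in_par[OF _ assms(1)] v by blast
  qed
qed

lemma sig_pow_conj: "s \<in> carrier G \<Longrightarrow> (\<sigma> [^] n) \<otimes> s \<otimes> inv (\<sigma> [^] (n::nat)) = (cj ^^ n) s"
proof (induction n)
  case (Suc n)
  have "(\<sigma> [^] Suc n) \<otimes> s \<otimes> inv (\<sigma> [^] Suc n) = cj ((\<sigma> [^] n) \<otimes> s \<otimes> inv (\<sigma> [^] n))"
    unfolding nat_pow_Suc2[OF sig] cj_def using sig Suc.prems by (simp add: inv_mult_group m_assoc)
  then show ?case using Suc by simp
qed (simp add: sig)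

lemma tsupp_eq: "v \<in> W \<Longrightarrow> tsupp v = {(cj ^^ n) s | n s. s \<in> cox_suppW G S v}"
proof -
  assume v: "v \<in> W"
  have "cox_suppW G S v \<subseteq> carrier G" unfolding cox_suppW_def using S_carrier by blast
  then show ?thesis unfolding tsupp_def using sig_pow_conj by (metis (no_types, opaque_lifting) subsetD)
qed

lemma tsupp_least:
  assumes "stable I" "v \<in> par I"
  shows "tsupp v \<subseteq> I"
proof -
  have IS: "I \<subseteq> S" using assms unfolding stable_def by blast
  have v: "v \<in> W" using par_W[OF IS assms(2)] .
  have "cox_suppW G S v \<subseteq> I" using suppW_iff[OF IS v] assms(2) by blast
  moreover have "(cj ^^ n) s \<in> I" if "s \<in> I" for n s
    by (induction n) (use that assms(1) in \<open>auto simp: stable_def\<close>)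
  ultimately show ?thesis unfolding tsupp_eq[OF v] by blast
qed

lemma tsupp_stable:
  assumes "v \<in> W"
  shows "stable (tsupp v)" "v \<in> par (tsupp v)"
proof -
  have "v \<in> par S" using assms par_S by simp
  then have sub: "tsupp v \<subseteq> S" using tsupp_least[OF stable_S] by blast
  have "cj ((cj ^^ n) s) = (cj ^^ Suc n) s" for n s by simp
  then have "cj t \<in> tsupp v" if "t \<in> tsupp v" for t using that unfolding tsupp_eq[OF assms] by blast
  then show "stable (tsupp v)" unfolding stable_def using sub by blast
  have "cox_suppW G S v \<subseteq> tsupp v"
  proof
    fix s assume "s \<in> cox_suppW G S v"
    then have "(cj ^^ 0) s \<in> tsupp v" unfolding tsupp_eq[OF assms] by blast
    then show "s \<in> tsupp v" by simp
  qed
  then show "v \<in> par (tsupp v)" using suppW_iff[OF sub assms] by blast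
qed

lemma tconj_mult:
  assumes "y \<in> W" "x \<in> W"
  shows "tconj (y \<otimes> x) = inv x \<otimes> tconj y \<otimes> cj x"
  unfolding tconj_def using assms u W_carrier cj_W(1) by (simp add: inv_mult_group m_assoc cj_mult)

text \<open>The pivot of the equivalence: niceness and weak ellipticity are each shown to amount to
  the existence of such a set, a condition that does not mention length.\<close>

definition core :: "'a set \<Rightarrow> bool" where
  "core J \<longleftrightarrow> (\<forall>y\<in>W. tsupp (tconj y) = J) \<and> (\<forall>s\<in>S - J. cj s = s \<and> (\<forall>j\<in>J. s \<otimes> j = j \<otimes> s))"

lemma commute_par:
  assumes J: "J \<subseteq> S" and s: "s \<in> S" "\<And>j. j \<in> J \<Longrightarrow> s \<otimes> j = j \<otimes> s" and v: "v \<in> par J"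
  shows "s \<otimes> v = v \<otimes> s"
proof -
  obtain ss where ss: "set ss \<subseteq> J" "v = prd ss" using v unfolding par_def by blast
  have "set ss \<subseteq> J \<Longrightarrow> s \<otimes> prd ss = prd ss \<otimes> s" for ss
  proof (induction ss)
    case (Cons j ss)
    have c: "s \<in> carrier G" "j \<in> carrier G" "prd ss \<in> carrier G" "j \<in> J"
      using s(1) S_carrier Cons.prems J prd_carrier[of ss] by auto
    have "s \<otimes> (j \<otimes> prd ss) = j \<otimes> (s \<otimes> prd ss)" using c s(2)[OF c(4)] by (simp add: m_assoc[symmetric])
    then show ?case using Cons c by (simp add: m_assoc)
  qed (use s S_carrier in simp)
  then show ?thesis using ss by blast
qed

text \<open>Conjugation by a letter outside \<open>J\<close> is trivial on \<open>par J\<close>.\<close>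
lemma class_in_par:
  assumes J: "stable J" and out: "\<And>s. s \<in> S - J \<Longrightarrow> cj s = s \<and> (\<forall>j\<in>J. s \<otimes> j = j \<otimes> s)"
    and y0: "y0 \<in> W" "tconj y0 \<in> par J" and y: "y \<in> W"
  shows "tconj y \<in> par J"
proof -
  have JS: "J \<subseteq> S" using J unfolding stable_def by blast
  have step: "tconj (z \<otimes> s) \<in> par J" if z: "z \<in> W" "tconj z \<in> par J" and s: "s \<in> S" for z s
  proof -
    have g: "tconj (z \<otimes> s) = s \<otimes> tconj z \<otimes> cj s" using tconj_mult[OF z(1) S_W[OF s]] inv_S[OF s] by simp
    show ?thesis
    proof (cases "s \<in> J")
      case True
      then have "s \<in> par J" "cj s \<in> par J" using par_gen[OF JS] J unfolding stable_def by auto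
      then show ?thesis unfolding g using par_mult[OF JS] z(2) by blast
    next
      case False
      then have "s \<otimes> tconj z = tconj z \<otimes> s" using commute_par[OF JS s _ z(2)] out s by blast
      then have "tconj (z \<otimes> s) = tconj z" unfolding g using out[of s] s False S_cancel'[OF s W_carrier[OF tconj_W[OF z(1)]]] by simp
      then show ?thesis using z(2) by simp
    qed
  qed
  obtain ss where ss: "set ss \<subseteq> S" "inv y0 \<otimes> y = prd ss" using W_gen[OF W_mult[OF W_inv[OF y0(1)] y]] by blast
  have "set ss \<subseteq> S \<Longrightarrow> z \<in> W \<Longrightarrow> tconj z \<in> par J \<Longrightarrow> tconj (z \<otimes> prd ss) \<in> par J" for z ss
  proof (induction ss arbitrary: z)
    case (Cons s ss)
    have "z \<otimes> prd (s # ss) = (z \<otimes> s) \<otimes> prd ss"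
      using Cons.prems W_carrier S_carrier prd_carrier[of ss] by (simp add: m_assoc)
    then show ?case using Cons.IH[of "z \<otimes> s"] step[OF Cons.prems(2,3)] Cons.prems W_mult S_W by simp
  qed (simp add: W_carrier)
  from this[OF ss(1) y0] have "tconj (y0 \<otimes> (inv y0 \<otimes> y)) \<in> par J" using ss(2) by simp
  then show ?thesis using y0(1) y W_carrier by (simp add: m_assoc[symmetric])
qed

text \<open>The support is minimal in cardinality over the whole class. A conjugate in
  \<open>par J\<close> has support inside \<open>J\<close>, hence equal to it.\<close>

lemma min_support:
  obtains y J where "y \<in> W" "J = tsupp (tconj y)" "\<And>z. z \<in> W \<Longrightarrow> tconj z \<in> par J \<Longrightarrow> tsupp (tconj z) = J"
proof -
  define y where "y = arg_min (\<lambda>y. card (tsupp (tconj y))) (\<lambda>y. y \<in> W)"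
  have y: "y \<in> W" and ymin: "\<And>z. z \<in> W \<Longrightarrow> card (tsupp (tconj y)) \<le> card (tsupp (tconj z))"
    using arg_min_nat_lemma[of "\<lambda>y. y \<in> W" \<one> "\<lambda>y. card (tsupp (tconj y))"] W_one unfolding y_def by auto
  have J: "stable (tsupp (tconj y))" using tsupp_stable tconj_W[OF y] by blast
  have fin: "finite (tsupp (tconj y))" using J finite_subset[OF _ finite_S] unfolding stable_def by blast
  show ?thesis
  proof (rule that[OF y refl])
    fix z assume z: "z \<in> W" "tconj z \<in> par (tsupp (tconj y))"
    then show "tsupp (tconj z) = tsupp (tconj y)" using tsupp_least[OF J] ymin fin by (meson card_seteq)
  qed
qed

text \<open>For a letter \<open>s\<close> outside a minimal support \<open>J\<close> also
  \<open>cj s\<close> is outside, so the commutation of \<open>s\<close> with the element, read as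
  \<open>s \<otimes> tconj y = tconj y \<otimes> cj s\<close>, forces \<open>cj s = s\<close> by
  \<open>twisted_commute\<close>.\<close>

lemma weakly_elliptic_core:
  assumes we: "\<And>y. y \<in> W \<Longrightarrow> (\<forall>s\<in>tsupp (tconj y). \<forall>t\<in>S - tsupp (tconj y). s \<otimes> t = t \<otimes> s) \<and>
      (\<forall>s\<in>S - tsupp (tconj y). tconj y \<otimes> cj s = s \<otimes> tconj y)"
  shows "\<exists>J. core J"
proof -
  obtain y J where y: "y \<in> W" "J = tsupp (tconj y)" and min: "\<And>z. z \<in> W \<Longrightarrow> tconj z \<in> par J \<Longrightarrow> tsupp (tconj z) = J"
    using min_support by metis
  have J: "stable J" "tconj y \<in> par J" using tsupp_stable[OF tconj_W[OF y(1)]] y(2) by auto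
  have JS: "J \<subseteq> S" using J unfolding stable_def by blast
  have out: "cj s = s \<and> (\<forall>j\<in>J. s \<otimes> j = j \<otimes> s)" if s: "s \<in> S - J" for s
  proof -
    have "cj s \<notin> J" using stable_cji[OF J(1), of "cj s"] cj_cji(2)[of s] S_carrier s by auto
    moreover have "s \<otimes> tconj y = tconj y \<otimes> cj s" using we[OF y(1)] s y(2) by auto
    ultimately have "s = cj s" using twisted_commute(1)[OF JS J(2)] s cj_S by blast
    moreover have "\<forall>j\<in>J. s \<otimes> j = j \<otimes> s" using we[OF y(1)] s y(2) by auto
    ultimately show ?thesis by simp
  qed
  have "tsupp (tconj z) = J" if "z \<in> W" for z using min[OF that] class_in_par[OF J(1) out y(1) J(2) that] by blast
  then have "core J" unfolding core_def using out by auto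
  then show ?thesis by blast
qed

lemma core_weakly_elliptic:
  assumes "core J" "y \<in> W"
  shows "tsupp (tconj y) = J" "J \<subseteq> S" "\<forall>s\<in>J. \<forall>t\<in>S - J. s \<otimes> t = t \<otimes> s" "\<forall>s\<in>S - J. tconj y \<otimes> cj s = s \<otimes> tconj y"
proof -
  show st: "tsupp (tconj y) = J" using assms unfolding core_def by blast
  have J: "stable J" "tconj y \<in> par J" using tsupp_stable[OF tconj_W[OF assms(2)]] st by auto
  show JS: "J \<subseteq> S" using J unfolding stable_def by blast
  show "\<forall>s\<in>J. \<forall>t\<in>S - J. s \<otimes> t = t \<otimes> s" using assms(1) unfolding core_def by metis
  show "\<forall>s\<in>S - J. tconj y \<otimes> cj s = s \<otimes> tconj y"
  proof
    fix s assume s: "s \<in> S - J"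
    then have "s \<otimes> tconj y = tconj y \<otimes> s" using commute_par[OF JS _ _ J(2)] assms(1) unfolding core_def by blast
    then show "tconj y \<otimes> cj s = s \<otimes> tconj y" using assms(1) s unfolding core_def by simp
  qed
qed

lemma rel_W: "rel\<^sup>*\<^sup>* y z \<Longrightarrow> y \<in> W \<Longrightarrow> z \<in> W"
  by (induction rule: rtranclp_induct) (auto simp: rel_def W_mult S_W)

lemma connected_core:
  assumes y0: "y0 \<in> W" "\<And>y. y \<in> W \<Longrightarrow> len (tconj y0) \<le> len (tconj y)"
    and conn: "\<And>x. x \<in> W \<Longrightarrow> len (tconj x) = len (tconj y0) \<Longrightarrow> rel\<^sup>*\<^sup>* y0 x"
  shows "\<exists>J. core J"
proof -
  obtain y1 J where y1: "y1 \<in> W" "J = tsupp (tconj y1)" and min: "\<And>z. z \<in> W \<Longrightarrow> tconj z \<in> par J \<Longrightarrow> tsupp (tconj z) = J"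
    using min_support by metis
  have J: "stable J" "tconj y1 \<in> par J" using tsupp_stable[OF tconj_W[OF y1(1)]] y1(2) by auto
  have JS: "J \<subseteq> S" using J unfolding stable_def by blast
  \<comment> \<open>The letters outside \<open>J\<close> that a path is able to use; the aim is to
    show that they exhaust the complement of \<open>J\<close>.\<close>
  define K where "K = {s\<in>S - J. cj s = s \<and> (\<forall>j\<in>J. s \<otimes> j = j \<otimes> s)}"
  have KS: "J \<union> K \<subseteq> S" using JS unfolding K_def by blast
  \<comment> \<open>A conjugate that has minimal length in the class and also lies in
    \<open>par J\<close>, so that the path from it is confined by \<open>J\<close>.\<close>
  obtain y2 where y2: "y2 \<in> W" "tconj y2 \<in> par J" "len (tconj y2) = len (tconj y0)"
  proof -
    define x where "x = inv y1 \<otimes> y0"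
    have xW: "x \<in> W" unfolding x_def using W_mult W_inv y1(1) y0(1) by blast
    obtain a b where ab: "a \<in> par J" "b \<in> W" "x = a \<otimes> b" "\<And>c. c \<in> par J \<Longrightarrow> len (c \<otimes> b) = len c + len b"
      using coset_rep[OF JS xW] by metis
    have aW: "a \<in> W" using par_W[OF JS ab(1)] .
    have ya: "y1 \<otimes> a \<in> W" using W_mult y1(1) aW by blast
    define z where "z = tconj (y1 \<otimes> a)"
    have zW: "z \<in> W" unfolding z_def using tconj_W[OF ya] .
    have zJ: "z \<in> par J" unfolding z_def tconj_mult[OF y1(1) aW]
      using par_mult[OF JS] par_inv[OF JS ab(1)] J(2) cj_par[OF J(1) ab(1)] by blast
    have "y0 = (y1 \<otimes> a) \<otimes> b"
    proof -
      have "y0 = y1 \<otimes> x" unfolding x_def using y0(1) y1(1) W_carrier by (simp add: m_assoc[symmetric])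
      then show ?thesis using ab(2,3) y1(1) aW W_carrier by (simp add: m_assoc)
    qed
    then have g0: "tconj y0 = inv b \<otimes> z \<otimes> cj b" unfolding z_def using tconj_mult[OF ya ab(2)] by simp
    have cb: "cj b \<in> W" using cj_W(1)[OF ab(2)] .
    have bz: "inv b \<otimes> z \<in> W" using W_mult W_inv ab(2) zW by blast
    have "inv (inv b \<otimes> z) = inv z \<otimes> b" using ab(2) zW W_carrier by (simp add: inv_mult_group)
    \<comment> \<open>Minimality of the coset representative makes the left factor add its full
      length. Undoing the right factor \<open>cj b\<close>, which is as long as \<open>b\<close>,
      shows that \<open>z\<close> is no longer than \<open>tconj y0\<close>.\<close>
    then have "len (inv b \<otimes> z) = len z + len b"
      using len_inv[OF bz] ab(4)[OF par_inv[OF JS zJ]] len_inv[OF zW] by simp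
    moreover have "inv b \<otimes> z = tconj y0 \<otimes> inv (cj b)" unfolding g0 using bz cb W_carrier by (simp add: m_assoc)
    then have "len (inv b \<otimes> z) \<le> len (tconj y0) + len b"
      using len_mult[OF tconj_W[OF y0(1)] W_inv[OF cb]] len_inv[OF cb] len_cj[OF ab(2)] by simp
    ultimately have "len z \<le> len (tconj y0)" by simp
    then have "len z = len (tconj y0)" using y0(2)[OF ya] unfolding z_def by simp
    then show ?thesis using that[OF ya] zJ unfolding z_def by blast
  qed
  have inv_path: "z \<in> W \<and> tconj z \<in> par J \<and> inv y2 \<otimes> z \<in> par (J \<union> K)" if "rel\<^sup>*\<^sup>* y2 z" for z
    using that
  proof (induction rule: rtranclp_induct)
    case base
    then show ?case using y2 W_carrier par_one by simp
  next
    case (step x z)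
    then obtain s where s: "s \<in> S" "z = x \<otimes> s" "len (tconj z) \<le> len (tconj x)" unfolding rel_def by blast
    have x: "x \<in> W" "tconj x \<in> par J" "inv y2 \<otimes> x \<in> par (J \<union> K)" using step.IH by auto
    have g: "tconj z = s \<otimes> tconj x \<otimes> cj s" using tconj_mult[OF x(1) S_W[OF s(1)]] inv_S[OF s(1)] s(2) by simp
    have zW: "z \<in> W" using s x W_mult S_W by blast
    have "s \<in> J \<union> K \<and> tconj z \<in> par J"
    proof (cases "s \<in> J")
      case True
      then have "s \<in> par J" "cj s \<in> par J" using par_gen[OF JS] J unfolding stable_def by auto
      then show ?thesis unfolding g using par_mult[OF JS] x(2) True by blast
    next
      case False
      have cs: "cj s \<in> S" "cj s \<notin> J"
        using cj_S[OF s(1)] stable_cji[OF J(1), of "cj s"] cj_cji(2)[of s] S_carrier s False by auto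
      have eq: "s \<otimes> tconj x = tconj x \<otimes> cj s"
        using no_increase_commute[OF JS x(2) s(1) False cs] s(3) g by simp
      have scs: "s = cj s" and par: "tconj x \<in> par {r\<in>J. s \<otimes> r = r \<otimes> s}"
        using twisted_commute[OF JS x(2) s(1) False cs eq] by auto
      have "stable {r\<in>J. s \<otimes> r = r \<otimes> s}"
        unfolding stable_def
      proof (intro conjI ballI)
        fix r assume r: "r \<in> {r\<in>J. s \<otimes> r = r \<otimes> s}"
        then have c: "s \<in> carrier G" "r \<in> carrier G" using s(1) JS S_carrier by auto
        have "cj s \<otimes> cj r = cj r \<otimes> cj s" using r cj_mult(1)[OF c] cj_mult(1)[OF c(2,1)] by simp
        then show "cj r \<in> {r\<in>J. s \<otimes> r = r \<otimes> s}" using r J(1) scs unfolding stable_def by auto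
      qed (use JS in auto)
      \<comment> \<open>The letters of \<open>J\<close> commuting with \<open>s\<close> form a
        stable set whose parabolic subgroup contains \<open>tconj x\<close>; by minimality the
        support of this element is all of \<open>J\<close>.\<close>
      then have "J \<subseteq> {r\<in>J. s \<otimes> r = r \<otimes> s}" using tsupp_least[OF _ par] min[OF x(1,2)] by simp
      then have "s \<in> K" unfolding K_def using s(1) False scs by auto
      moreover have "tconj z = tconj x" unfolding g eq using scs S_cancel'[OF s(1) W_carrier[OF tconj_W[OF x(1)]]] by simp
      ultimately show ?thesis using x(2) by simp
    qed
    moreover have "inv y2 \<otimes> z = (inv y2 \<otimes> x) \<otimes> s" using s x y2(1) W_carrier S_carrier by (simp add: m_assoc)
    ultimately show ?case using zW par_mult[OF KS x(3)] par_gen[OF KS, of s] by simp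
  qed
  have rel_sym: "rel z x" if r: "rel x z" "x \<in> W" "len (tconj x) = len (tconj y0)" for x z
  proof -
    obtain s where s: "s \<in> S" "z = x \<otimes> s" using r(1) unfolding rel_def by blast
    then have "x = z \<otimes> s" using S_cancel' r(2) W_carrier by simp
    moreover have "len (tconj x) \<le> len (tconj z)" using y0(2)[of z] r(2,3) s W_mult S_W by simp
    ultimately show ?thesis unfolding rel_def using s by blast
  qed
  have rev: "rel\<^sup>*\<^sup>* z y0 \<and> len (tconj z) = len (tconj y0)" if "rel\<^sup>*\<^sup>* y0 z" for z
    using that
  proof (induction rule: rtranclp_induct)
    case (step x z)
    have xW: "x \<in> W" using rel_W[OF step(1) y0(1)] .
    have zW: "z \<in> W" using rel_W[of y0 z] step(1,2) y0(1) by (meson rtranclp.rtrancl_into_rtrancl)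
    have "rel z x" using rel_sym[OF step(2) xW] step.IH by blast
    moreover have "len (tconj z) = len (tconj y0)" using step.IH step(2) y0(2)[OF zW] unfolding rel_def by auto
    ultimately show ?case using step.IH by (meson converse_rtranclp_into_rtranclp)
  qed simp
  obtain \<omega> where om: "\<omega> \<in> W" "\<And>s. s \<in> S \<Longrightarrow> len (s \<otimes> \<omega>) < len \<omega>" "\<And>x. x \<in> W \<Longrightarrow> len (x \<otimes> \<omega>) + len x = len \<omega>"
    using longest_element by metis
  \<comment> \<open>The longest element is determined by its length, hence is its own inverse and is
    fixed by \<open>cj\<close>.\<close>
  have inv_om: "\<omega>' = inv \<omega>" if "\<omega>' \<in> W" "len \<omega>' = len \<omega>" for \<omega>'
  proof -
    have "len (\<omega>' \<otimes> \<omega>) = 0" using om(3)[OF that(1)] that(2) by simp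
    then have "\<omega>' \<otimes> \<omega> = \<one>" using len_0 W_mult that(1) om(1) by blast
    then show ?thesis using inv_equality that(1) om(1) W_carrier by metis
  qed
  have om2: "inv \<omega> = \<omega>" using inv_om[OF om(1)] by simp
  have cjom: "cj \<omega> = \<omega>" using inv_om[OF cj_W(1)[OF om(1)] len_cj[OF om(1)]] om2 by simp
  \<comment> \<open>Multiplication by the longest element replaces a length by its complement. Doing
    so on both sides restores the original length.\<close>
  have "len (tconj (y2 \<otimes> \<omega>)) = len (tconj y2)"
  proof -
    define v where "v = tconj y2"
    have v: "v \<in> W" unfolding v_def using tconj_W[OF y2(1)] .
    have vo: "v \<otimes> \<omega> \<in> W" using W_mult v om(1) by blast
    have "tconj (y2 \<otimes> \<omega>) = \<omega> \<otimes> (v \<otimes> \<omega>)"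
      using tconj_mult[OF y2(1) om(1)] om2 cjom v om(1) W_carrier unfolding v_def by (simp add: m_assoc)
    moreover have "inv (\<omega> \<otimes> (v \<otimes> \<omega>)) = inv (v \<otimes> \<omega>) \<otimes> \<omega>" using om2 vo om(1) W_carrier by (simp add: inv_mult_group)
    ultimately have "len (tconj (y2 \<otimes> \<omega>)) = len (inv (v \<otimes> \<omega>) \<otimes> \<omega>)" using len_inv[OF W_mult[OF om(1) vo]] by simp
    then show ?thesis using om(3)[OF W_inv[OF vo]] om(3)[OF v] len_inv[OF vo] unfolding v_def by simp
  qed
  then have "rel\<^sup>*\<^sup>* y0 (y2 \<otimes> \<omega>)" using conn W_mult y2 om(1) by simp
  moreover have "rel\<^sup>*\<^sup>* y2 y0" using rev[OF conn[OF y2(1,3)]] by blast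
  ultimately have "rel\<^sup>*\<^sup>* y2 (y2 \<otimes> \<omega>)" by simp
  then have "inv y2 \<otimes> (y2 \<otimes> \<omega>) \<in> par (J \<union> K)" using inv_path by blast
  then have omJK: "\<omega> \<in> par (J \<union> K)" using y2(1) om(1) W_carrier by (simp add: m_assoc[symmetric])
  \<comment> \<open>Every letter begins some reduced word of the longest element, so it belongs to
    any parabolic subgroup containing that element.\<close>
  have SJK: "s \<in> J \<union> K" if s: "s \<in> S" for s
  proof -
    obtain rr where rr: "reduced (s # rr)" "prd (s # rr) = \<omega>" using descent_word[OF om(1) s om(2)[OF s]] by metis
    then show ?thesis using reduced_in_par[OF rr(1) KS] omJK by simp
  qed
  then have out: "cj s = s \<and> (\<forall>j\<in>J. s \<otimes> j = j \<otimes> s)" if "s \<in> S - J" for s using that unfolding K_def by blast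
  have "tsupp (tconj z) = J" if "z \<in> W" for z using min[OF that] class_in_par[OF J(1) out y2(1,2) that] by blast
  then have "core J" unfolding core_def using out by auto
  then show ?thesis by blast
qed

end

text \<open>Apply the elliptic case to the Coxeter group \<open>par J\<close>. There a stable
  \<open>K\<close> whose parabolic subgroup contains some conjugate must contain its support, which
  is \<open>J\<close>. The difference between \<open>y0\<close> and \<open>x\<close> factors into an
  element of \<open>par J\<close> and letters outside \<open>J\<close>, which commute with
  everything in \<open>par J\<close>.\<close>

lemma (in twisted_coxeter) core_connected:
  assumes core: "core J" and y0: "y0 \<in> W" "\<And>y. y \<in> W \<Longrightarrow> len (tconj y0) \<le> len (tconj y)"
    and x: "x \<in> W" "len (tconj x) = len (tconj y0)"
  shows "rel\<^sup>*\<^sup>* y0 x"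
proof -
  have st: "\<And>y. y \<in> W \<Longrightarrow> tsupp (tconj y) = J" using core unfolding core_def by blast
  have J: "stable J" using tsupp_stable(1)[OF tconj_W[OF y0(1)]] st[OF y0(1)] by simp
  have gJ: "tconj y \<in> par J" if "y \<in> W" for y using tsupp_stable(2)[OF tconj_W[OF that]] st[OF that] by simp
  have JS: "J \<subseteq> S" using J unfolding stable_def by blast
  have out: "cj s = s" "\<And>j. j \<in> J \<Longrightarrow> s \<otimes> j = j \<otimes> s" if "s \<in> S - J" for s using core that unfolding core_def by blast+
  note sysJ = coxeter_system_par[OF JS]
  \<comment> \<open>Twisted conjugation is based at \<open>tconj y0\<close> instead of
    \<open>u\<close>, which shifts conjugating elements by \<open>y0\<close> on the left.\<close>
  interpret P: twisted_coxeter G "par J" J \<sigma> "tconj y0"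
  proof unfold_locales
    show "coxeter_system G (par J) J" using sysJ(1) .
    show "finite (par J)" using finite_subset[OF _ finite_W] par_W[OF JS] by blast
    show "\<sigma> \<in> carrier G" using sig .
    show "\<sigma> \<otimes> s \<otimes> inv \<sigma> \<in> J" if "s \<in> J" for s using J that unfolding stable_def cj_def by blast
    show "tconj y0 \<in> par J" using gJ[OF y0(1)] .
  qed
  have Pgg: "P.tconj a = tconj (y0 \<otimes> a)" if "a \<in> par J" for a
    unfolding P.tconj_def P.cj_def tconj_mult[OF y0(1) par_W[OF JS that]] cj_def ..
  have Plen: "cox_lenW G J (P.tconj a) = len (tconj (y0 \<otimes> a))" if a: "a \<in> par J" for a
    using sysJ(2)[of "P.tconj a"] Pgg[OF a] gJ W_mult[OF y0(1) par_W[OF JS a]] by simp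
  have decomp: "\<exists>a\<in>par J. \<exists>bb. set bb \<subseteq> S - J \<and> z = a \<otimes> prd bb" if zW: "z \<in> W" for z
  proof -
    obtain ss where ss: "set ss \<subseteq> S" "z = prd ss" using W_gen[OF zW] by blast
    have "set ss \<subseteq> S \<Longrightarrow> \<exists>a\<in>par J. \<exists>bb. set bb \<subseteq> S - J \<and> prd ss = a \<otimes> prd bb" for ss
    proof (induction ss)
      case Nil
      show ?case using par_one by (intro bexI[of _ \<one>] exI[of _ "[]"]) auto
    next
      case (Cons s ss)
      then obtain a bb where ab: "a \<in> par J" "set bb \<subseteq> S - J" "prd ss = a \<otimes> prd bb" by auto
      have s: "s \<in> S" using Cons.prems by simp
      have c: "s \<in> carrier G" "a \<in> carrier G" "prd bb \<in> carrier G"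
        using S_carrier[OF s] par_W[OF JS ab(1)] W_carrier prd_carrier[of bb] ab(2) by auto
      show ?case
      proof (cases "s \<in> J")
        case True
        then have "s \<otimes> a \<in> par J" using par_mult[OF JS par_gen[OF JS] ab(1)] by blast
        moreover have "prd (s # ss) = (s \<otimes> a) \<otimes> prd bb" using ab(3) c by (simp add: m_assoc)
        ultimately show ?thesis using ab(2) by blast
      next
        case False
        then have "s \<otimes> a = a \<otimes> s" using commute_par[OF JS s _ ab(1)] out(2) s by blast
        then have "prd (s # ss) = a \<otimes> prd (s # bb)" using ab(3) c by (simp add: m_assoc[symmetric])
        moreover have "set (s # bb) \<subseteq> S - J" using ab(2) s False by simp
        ultimately show ?thesis using ab(1) by blast
      qed
    qed
    then show ?thesis using ss by blast
  qed
  \<comment> \<open>A letter outside \<open>J\<close> commutes with each conjugate and with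
    \<open>\<sigma>\<close>, so it moves the conjugating element without changing the
    conjugate.\<close>
  have tail: "set bb \<subseteq> S - J \<Longrightarrow> z \<in> W \<Longrightarrow> tconj (z \<otimes> prd bb) = tconj z \<and> rel\<^sup>*\<^sup>* z (z \<otimes> prd bb)" for z bb
  proof (induction bb arbitrary: z)
    case (Cons s bb)
    have s: "s \<in> S - J" "s \<in> S" using Cons.prems by auto
    have zs: "z \<otimes> s \<in> W" using W_mult S_W Cons.prems(2) s by blast
    have "s \<otimes> tconj z = tconj z \<otimes> s" using commute_par[OF JS s(2) out(2)[OF s(1)] gJ[OF Cons.prems(2)]] by blast
    then have eq: "tconj (z \<otimes> s) = tconj z"
      using tconj_mult[OF Cons.prems(2) S_W[OF s(2)]] inv_S[OF s(2)] out(1)[OF s(1)]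
        S_cancel'[OF s(2) W_carrier[OF tconj_W[OF Cons.prems(2)]]] by simp
    then have "rel z (z \<otimes> s)" unfolding rel_def using s(2) by auto
    moreover have "z \<otimes> prd (s # bb) = (z \<otimes> s) \<otimes> prd bb"
      using W_carrier[OF Cons.prems(2)] S_carrier[OF s(2)] prd_carrier[of bb] Cons.prems(1) by (simp add: m_assoc subset_iff)
    ultimately show ?case using Cons.IH[OF _ zs] Cons.prems(1) eq by (auto intro: converse_rtranclp_into_rtranclp)
  qed (simp add: W_carrier)
  obtain a bb where ab: "a \<in> par J" "set bb \<subseteq> S - J" "inv y0 \<otimes> x = a \<otimes> prd bb"
    using decomp[OF W_mult[OF W_inv[OF y0(1)] x(1)]] by blast
  have aW: "a \<in> W" using par_W[OF JS ab(1)] .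
  have ya: "y0 \<otimes> a \<in> W" using W_mult y0(1) aW by blast
  have bS: "set bb \<subseteq> S" using ab(2) by blast
  have xab: "x = (y0 \<otimes> a) \<otimes> prd bb"
  proof -
    have "x = y0 \<otimes> (inv y0 \<otimes> x)" using y0(1) x(1) W_carrier by (simp add: m_assoc[symmetric])
    then show ?thesis unfolding ab(3) using y0(1) aW W_carrier prd_carrier[OF bS] by (simp add: m_assoc)
  qed
  have gx: "tconj x = tconj (y0 \<otimes> a)" "rel\<^sup>*\<^sup>* (y0 \<otimes> a) x" using tail[OF ab(2) ya] unfolding xab by auto
  have "(\<lambda>y y'. \<exists>s\<in>J. y' = y \<otimes> s \<and> cox_lenW G J (P.tconj y') \<le> cox_lenW G J (P.tconj y))\<^sup>*\<^sup>* \<one> a"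
  proof (rule P.elliptic_paths)
    fix z K assume z: "z \<in> par J" and K: "K \<subseteq> J" "\<And>s. s \<in> K \<Longrightarrow> P.cj s \<in> K" "P.tconj z \<in> P.par K"
    have "tconj (y0 \<otimes> z) \<in> par K" using K(3) Pgg[OF z] unfolding P.par_def par_def by simp
    moreover have "stable K" unfolding stable_def using K(1,2) JS unfolding P.cj_def cj_def by blast
    ultimately have "J \<subseteq> K" using tsupp_least st[OF W_mult[OF y0(1) par_W[OF JS z]]] by blast
    then show "K = J" using K(1) by blast
  next
    show "a \<in> par J" by (rule ab(1))
    fix y assume y: "y \<in> par J"
    show "cox_lenW G J (P.tconj a) \<le> cox_lenW G J (P.tconj y)"
      unfolding Plen[OF ab(1)] Plen[OF y] using gx(1) x(2) y0(2)[OF W_mult[OF y0(1) par_W[OF JS y]]] by simp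
  qed
  then have "a \<in> par J \<and> rel\<^sup>*\<^sup>* y0 (y0 \<otimes> a)"
  proof (induction rule: rtranclp_induct)
    case base
    show ?case using par_one y0(1) W_carrier by simp
  next
    case (step c d)
    then obtain s where s: "s \<in> J" "d = c \<otimes> s" "cox_lenW G J (P.tconj d) \<le> cox_lenW G J (P.tconj c)" by blast
    have c: "c \<in> par J" "rel\<^sup>*\<^sup>* y0 (y0 \<otimes> c)" using step.IH by auto
    have d: "d \<in> par J" unfolding s(2) using par_mult[OF JS c(1) par_gen[OF JS s(1)]] .
    have "y0 \<otimes> d = (y0 \<otimes> c) \<otimes> s"
      unfolding s(2) using y0(1) par_W[OF JS c(1)] W_carrier S_carrier s(1) JS by (auto simp: m_assoc)
    then have "rel (y0 \<otimes> c) (y0 \<otimes> d)" unfolding rel_def using s(1,3) JS Plen[OF c(1)] Plen[OF d] by auto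
    then show ?case using c(2) d by simp
  qed
  then show ?thesis using gx(2) by (meson rtranclp_trans)
qed

section \<open>Translation to the definitions in the ambient group\<close>

locale extended_coxeter = twisted_coxeter +
  fixes Om
  assumes Om: "subgroup Om G" "\<sigma> \<in> Om" and disj: "W \<inter> Om = {\<one>}"
begin

lemma factor_unique:
  assumes "v \<in> W" "v' \<in> W" "\<tau> \<in> Om" "v \<otimes> \<sigma> = v' \<otimes> \<tau>"
  shows "v = v' \<and> \<sigma> = \<tau>"
proof -
  have c: "v \<in> carrier G" "v' \<in> carrier G" "\<tau> \<in> carrier G"
    using assms W_carrier subgroup.mem_carrier[OF Om(1)] by auto
  have "inv v' \<otimes> v \<otimes> \<sigma> = inv v' \<otimes> (v' \<otimes> \<tau>)" using assms(4) c sig by (simp add: m_assoc)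
  then have "inv v' \<otimes> v \<otimes> \<sigma> = \<tau>" using c by (simp add: m_assoc[symmetric])
  then have "inv v' \<otimes> v \<otimes> \<sigma> \<otimes> inv \<sigma> = \<tau> \<otimes> inv \<sigma>" by simp
  then have eq: "inv v' \<otimes> v = \<tau> \<otimes> inv \<sigma>" using c sig by (simp add: m_assoc)
  have "inv v' \<otimes> v \<in> W" using assms(1,2) W_mult W_inv by blast
  moreover have "\<tau> \<otimes> inv \<sigma> \<in> Om" using assms(3) Om by (simp add: subgroup.m_closed subgroup.m_inv_closed)
  ultimately have one: "inv v' \<otimes> v = \<one>" "\<tau> \<otimes> inv \<sigma> = \<one>" using eq disj by auto
  have "inv v = inv v'" using inv_equality[OF one(1)] c by simp
  then have "v = v'" using c by (metis inv_inv)
  moreover have "\<sigma> \<otimes> inv \<sigma> = \<tau> \<otimes> inv \<sigma>" unfolding one using sig by simp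
  then have "\<sigma> = \<tau>" using c sig by (simp only: right_cancel inv_closed)
  ultimately show ?thesis by blast
qed

lemma len_ext: "v \<in> W \<Longrightarrow> cox_len G S Om (v \<otimes> \<sigma>) = len v"
proof -
  assume v: "v \<in> W"
  have "(\<exists>ss \<tau>. set ss \<subseteq> S \<and> \<tau> \<in> Om \<and> length ss = n \<and> v \<otimes> \<sigma> = prd ss \<otimes> \<tau>)
    \<longleftrightarrow> (\<exists>ss. set ss \<subseteq> S \<and> length ss = n \<and> v = prd ss)" for n
    using factor_unique[OF v prd_W] Om(2) by blast
  then show ?thesis unfolding cox_len_def cox_lenW_def by simp
qed

lemma supp_ext: "v \<in> W \<Longrightarrow> cox_supp G W S Om (v \<otimes> \<sigma>) = tsupp v"
proof -
  assume v: "v \<in> W"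
  show ?thesis
  proof (intro equalityI subsetI)
    fix t assume "t \<in> cox_supp G W S Om (v \<otimes> \<sigma>)"
    then obtain w \<tau> s and n :: nat where *: "w \<in> W" "\<tau> \<in> Om" "v \<otimes> \<sigma> = w \<otimes> \<tau>" "s \<in> cox_suppW G S w"
      "t = (\<tau> [^] n) \<otimes> s \<otimes> inv (\<tau> [^] n)" unfolding cox_supp_def by blast
    then show "t \<in> tsupp v" using factor_unique[OF v *(1-3)] unfolding tsupp_def by blast
  qed (use v Om(2) in \<open>unfold cox_supp_def tsupp_def, blast\<close>)
qed

lemma tconj_one: "tconj \<one> = u"
  unfolding tconj_def using cj_one u W_carrier by simp

lemma conj_tconj:
  assumes "y \<in> W" "x \<in> W"
  shows "inv x \<otimes> (tconj y \<otimes> \<sigma>) \<otimes> x = tconj (y \<otimes> x) \<otimes> \<sigma>"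
  unfolding tconj_mult[OF assms] cj_def
  using assms tconj_W[OF assms(1)] W_carrier sig by (simp add: m_assoc)

lemma class_tconj: "cox_conj_class G W (tconj y \<otimes> \<sigma>) = {tconj z \<otimes> \<sigma> | z. z \<in> W}" if y: "y \<in> W"
proof (intro equalityI subsetI)
  fix c assume "c \<in> cox_conj_class G W (tconj y \<otimes> \<sigma>)"
  then obtain x where x: "x \<in> W" "c = x \<otimes> (tconj y \<otimes> \<sigma>) \<otimes> inv x" unfolding cox_conj_class_def by blast
  then have "c = tconj (y \<otimes> inv x) \<otimes> \<sigma>" using conj_tconj[OF y W_inv[OF x(1)]] W_carrier by simp
  then show "c \<in> {tconj z \<otimes> \<sigma> | z. z \<in> W}" using W_mult W_inv y x(1) by blast
next
  fix c assume "c \<in> {tconj z \<otimes> \<sigma> | z. z \<in> W}"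
  then obtain z where z: "z \<in> W" "c = tconj z \<otimes> \<sigma>" by blast
  define x where "x = inv z \<otimes> y"
  have x: "x \<in> W" unfolding x_def using W_mult W_inv y z by blast
  have "y \<otimes> inv x = z" unfolding x_def using y z W_carrier by (simp add: inv_mult_group m_assoc[symmetric])
  then have "c = x \<otimes> (tconj y \<otimes> \<sigma>) \<otimes> inv x" using conj_tconj[OF y W_inv[OF x]] z(2) W_carrier[OF x] by simp
  then show "c \<in> cox_conj_class G W (tconj y \<otimes> \<sigma>)" unfolding cox_conj_class_def using x by blast
qed

lemma min_length_tconj:
  assumes "y \<in> W"
  shows "cox_min_length G W S Om (tconj y \<otimes> \<sigma>) \<longleftrightarrow> (\<forall>z\<in>W. len (tconj y) \<le> len (tconj z))"
  unfolding cox_min_length_def class_tconj[OF assms] using len_ext tconj_W assms by auto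

lemma Wstab_tconj:
  assumes "y \<in> W"
  shows "cox_Wstab G W S Om (tconj y \<otimes> \<sigma>) = {x \<in> W. len (tconj (y \<otimes> x)) = len (tconj y)}"
  unfolding cox_Wstab_def using conj_tconj[OF assms] len_ext tconj_W assms W_mult by auto

lemma conj_S:
  assumes "y \<in> W" "s \<in> S"
  shows "s \<otimes> (tconj y \<otimes> \<sigma>) \<otimes> s = tconj (y \<otimes> s) \<otimes> \<sigma>"
  using conj_tconj[OF assms(1) S_W[OF assms(2)]] inv_S[OF assms(2)] by simp

lemma path_rel:
  assumes "y \<in> W" "cox_path G S Om (tconj y \<otimes> \<sigma>) ss"
  shows "set ss \<subseteq> S \<and> rel\<^sup>*\<^sup>* y (y \<otimes> prd ss)"
  using assms
proof (induction ss arbitrary: y)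
  case (Cons s ss)
  have s: "s \<in> S" using Cons.prems by simp
  have ys: "y \<otimes> s \<in> W" using W_mult S_W Cons.prems(1) s by blast
  have "cox_path G S Om (tconj (y \<otimes> s) \<otimes> \<sigma>) ss" using Cons.prems conj_S[OF Cons.prems(1) s] by simp
  then have IH: "set ss \<subseteq> S" "rel\<^sup>*\<^sup>* (y \<otimes> s) (y \<otimes> s \<otimes> prd ss)" using Cons.IH[OF ys] by auto
  have "rel y (y \<otimes> s)" unfolding rel_def
    using Cons.prems conj_S[OF Cons.prems(1) s] len_ext tconj_W ys s by auto
  moreover have "y \<otimes> prd (s # ss) = y \<otimes> s \<otimes> prd ss"
    using Cons.prems(1) s IH(1) W_carrier S_carrier prd_carrier by (simp add: m_assoc)
  ultimately show ?case using IH s by (auto intro: converse_rtranclp_into_rtranclp)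
qed (simp add: W_carrier)

lemma rel_path:
  assumes "rel\<^sup>*\<^sup>* y z" "z \<in> W" "y \<in> W"
  shows "\<exists>ss. set ss \<subseteq> S \<and> cox_path G S Om (tconj y \<otimes> \<sigma>) ss \<and> z = y \<otimes> prd ss"
  using assms(1,3)
proof (induction rule: converse_rtranclp_induct)
  case base
  show ?case using assms(2) W_carrier by (intro exI[of _ "[]"]) simp
next
  case (step y y')
  then obtain s where s: "s \<in> S" "y' = y \<otimes> s" "len (tconj y') \<le> len (tconj y)" unfolding rel_def by blast
  have y'W: "y' \<in> W" using W_mult S_W step.prems s by blast
  then obtain ss where ss: "set ss \<subseteq> S" "cox_path G S Om (tconj y' \<otimes> \<sigma>) ss" "z = y' \<otimes> prd ss" using step.IH by blast
  have "cox_path G S Om (tconj y \<otimes> \<sigma>) (s # ss)"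
    using conj_S[OF step.prems s(1)] s ss(2) len_ext tconj_W y'W step.prems by simp
  moreover have "z = y \<otimes> prd (s # ss)"
    using ss(3) s step.prems W_carrier S_carrier prd_carrier[OF ss(1)] by (simp add: m_assoc)
  ultimately show ?case using ss(1) s(1) by (intro exI[of _ "s # ss"]) simp
qed

text \<open>The two directions use the definition differently: from niceness only the minimal
  element it provides is available, whereas a core gives the paths for whichever minimal element is
  chosen.\<close>

lemma nice_iff_core: "cox_nice G W S Om {tconj z \<otimes> \<sigma> | z. z \<in> W} \<longleftrightarrow> (\<exists>J. core J)"
proof
  assume "cox_nice G W S Om {tconj z \<otimes> \<sigma> | z. z \<in> W}"
  then obtain y0 where y0: "y0 \<in> W" "cox_min_length G W S Om (tconj y0 \<otimes> \<sigma>)"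
    and path: "\<And>x. x \<in> cox_Wstab G W S Om (tconj y0 \<otimes> \<sigma>) \<Longrightarrow> \<exists>ss. cox_path G S Om (tconj y0 \<otimes> \<sigma>) ss \<and> x = prd ss"
    unfolding cox_nice_def by blast
  show "\<exists>J. core J"
  proof (rule connected_core[OF y0(1)])
    show "len (tconj y0) \<le> len (tconj y)" if "y \<in> W" for y using y0(2) that unfolding min_length_tconj[OF y0(1)] by blast
    fix x assume x: "x \<in> W" "len (tconj x) = len (tconj y0)"
    define z where "z = inv y0 \<otimes> x"
    have z: "z \<in> W" "y0 \<otimes> z = x"
      unfolding z_def using W_mult W_inv y0(1) x(1) W_carrier by (simp_all add: m_assoc[symmetric])
    then have "z \<in> cox_Wstab G W S Om (tconj y0 \<otimes> \<sigma>)" unfolding Wstab_tconj[OF y0(1)] using x(2) by simp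
    then obtain ss where "cox_path G S Om (tconj y0 \<otimes> \<sigma>) ss" "z = prd ss" using path by blast
    then show "rel\<^sup>*\<^sup>* y0 x" using path_rel[OF y0(1)] z(2) by blast
  qed
next
  assume "\<exists>J. core J"
  then obtain J where core: "core J" by blast
  define y0 where "y0 = arg_min (\<lambda>y. len (tconj y)) (\<lambda>y. y \<in> W)"
  have y0: "y0 \<in> W" and min: "\<And>z. z \<in> W \<Longrightarrow> len (tconj y0) \<le> len (tconj z)"
    using arg_min_nat_lemma[of "\<lambda>y. y \<in> W" \<one> "\<lambda>y. len (tconj y)"] W_one unfolding y0_def by auto
  have "\<exists>ss. cox_path G S Om (tconj y0 \<otimes> \<sigma>) ss \<and> x = prd ss" if x: "x \<in> cox_Wstab G W S Om (tconj y0 \<otimes> \<sigma>)" for x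
  proof -
    have xW: "x \<in> W" "len (tconj (y0 \<otimes> x)) = len (tconj y0)" using x unfolding Wstab_tconj[OF y0] by auto
    have yx: "y0 \<otimes> x \<in> W" using W_mult y0 xW(1) by blast
    obtain ss where ss: "set ss \<subseteq> S" "cox_path G S Om (tconj y0 \<otimes> \<sigma>) ss" "y0 \<otimes> x = y0 \<otimes> prd ss"
      using rel_path[OF core_connected[OF core y0 min yx xW(2)] yx y0] by blast
    then have "x = prd ss" using y0 xW(1) W_carrier prd_carrier by simp
    then show ?thesis using ss(2) by blast
  qed
  then show "cox_nice G W S Om {tconj z \<otimes> \<sigma> | z. z \<in> W}"
    unfolding cox_nice_def using y0 min min_length_tconj[OF y0] by blast
qed

lemma weakly_elliptic_iff_core: "cox_weakly_elliptic G W S Om {tconj z \<otimes> \<sigma> | z. z \<in> W} \<longleftrightarrow> (\<exists>J. core J)"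
proof -
  have comm: "tconj y \<otimes> \<sigma> \<otimes> s = s \<otimes> (tconj y \<otimes> \<sigma>) \<longleftrightarrow> tconj y \<otimes> cj s = s \<otimes> tconj y" if "y \<in> W" "s \<in> S" for y s
  proof -
    have c: "tconj y \<in> carrier G" "s \<in> carrier G" using tconj_W W_carrier S_carrier that by auto
    have "tconj y \<otimes> \<sigma> \<otimes> s = tconj y \<otimes> cj s \<otimes> \<sigma>" "s \<otimes> (tconj y \<otimes> \<sigma>) = s \<otimes> tconj y \<otimes> \<sigma>"
      unfolding cj_def using c sig by (simp_all add: m_assoc)
    then show ?thesis using c sig cj_carrier(1)[OF c(2)] by simp
  qed
  have "cox_weakly_elliptic G W S Om {tconj z \<otimes> \<sigma> | z. z \<in> W} \<longleftrightarrow>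
    (\<forall>y\<in>W. tsupp (tconj y) \<subseteq> S \<and> (\<forall>s\<in>tsupp (tconj y). \<forall>t\<in>S - tsupp (tconj y). s \<otimes> t = t \<otimes> s) \<and>
      (\<forall>s\<in>S - tsupp (tconj y). tconj y \<otimes> cj s = s \<otimes> tconj y))"
  proof -
    have "cox_union_components G S (cox_supp G W S Om (tconj y \<otimes> \<sigma>)) \<and>
        (\<forall>s\<in>S - cox_supp G W S Om (tconj y \<otimes> \<sigma>). tconj y \<otimes> \<sigma> \<otimes> s = s \<otimes> (tconj y \<otimes> \<sigma>)) \<longleftrightarrow>
      tsupp (tconj y) \<subseteq> S \<and> (\<forall>s\<in>tsupp (tconj y). \<forall>t\<in>S - tsupp (tconj y). s \<otimes> t = t \<otimes> s) \<and>
        (\<forall>s\<in>S - tsupp (tconj y). tconj y \<otimes> cj s = s \<otimes> tconj y)" if y: "y \<in> W" for y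
      unfolding supp_ext[OF tconj_W[OF y]] cox_union_components_def using comm[OF y] by auto
    then show ?thesis unfolding cox_weakly_elliptic_def by blast
  qed
  also have "\<dots> \<longleftrightarrow> (\<exists>J. core J)"
  proof
    assume "\<exists>J. core J"
    then obtain J where "core J" by blast
    show "\<forall>y\<in>W. tsupp (tconj y) \<subseteq> S \<and> (\<forall>s\<in>tsupp (tconj y). \<forall>t\<in>S - tsupp (tconj y). s \<otimes> t = t \<otimes> s) \<and>
      (\<forall>s\<in>S - tsupp (tconj y). tconj y \<otimes> cj s = s \<otimes> tconj y)"
    proof
      fix y assume "y \<in> W"
      note c = core_weakly_elliptic[OF \<open>core J\<close> this]
      show "tsupp (tconj y) \<subseteq> S \<and> (\<forall>s\<in>tsupp (tconj y). \<forall>t\<in>S - tsupp (tconj y). s \<otimes> t = t \<otimes> s) \<and>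
        (\<forall>s\<in>S - tsupp (tconj y). tconj y \<otimes> cj s = s \<otimes> tconj y)"
        unfolding c(1) using c(2-4) by blast
    qed
  next
    assume a: "\<forall>y\<in>W. tsupp (tconj y) \<subseteq> S \<and> (\<forall>s\<in>tsupp (tconj y). \<forall>t\<in>S - tsupp (tconj y). s \<otimes> t = t \<otimes> s) \<and>
      (\<forall>s\<in>S - tsupp (tconj y). tconj y \<otimes> cj s = s \<otimes> tconj y)"
    show "\<exists>J. core J"
      by (rule weakly_elliptic_core) (use a in blast)
  qed
  finally show ?thesis .
qed

end

theorem theorem4p7:
  fixes G :: "('g, 'b) monoid_scheme" and W S Om Cl :: "'g set" and w0 :: 'g
  assumes "cox_setting G W S Om"
    and "w0 \<in> carrier G"
    and "Cl = cox_conj_class G W w0"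
  shows "cox_nice G W S Om Cl \<longleftrightarrow> cox_weakly_elliptic G W S Om Cl"
proof -
  have set: "group G" "coxeter_system G W S" "finite W" "subgroup Om G"
    "\<And>\<sigma> s. \<sigma> \<in> Om \<Longrightarrow> s \<in> S \<Longrightarrow> \<sigma> \<otimes>\<^bsub>G\<^esub> s \<otimes>\<^bsub>G\<^esub> inv\<^bsub>G\<^esub> \<sigma> \<in> S" "W \<inter> Om = {\<one>\<^bsub>G\<^esub>}"
    using assms(1) unfolding cox_setting_def by blast+
  obtain u \<sigma> where us: "u \<in> W" "\<sigma> \<in> Om" "w0 = u \<otimes>\<^bsub>G\<^esub> \<sigma>"
    using assms(1,2) unfolding cox_setting_def by blast
  \<comment> \<open>Conjugation by \<open>W\<close> does not change the component
    \<open>\<sigma>\<close>, so one \<open>\<sigma>\<close> serves the whole class.\<close>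
  interpret extended_coxeter G W S \<sigma> u Om
    using set us subgroup.mem_carrier[OF set(4)]
    unfolding extended_coxeter_def extended_coxeter_axioms_def twisted_coxeter_def twisted_coxeter_axioms_def
      finite_coxeter_def finite_coxeter_axioms_def coxeter_def coxeter_axioms_def by blast
  have "Cl = {tconj z \<otimes>\<^bsub>G\<^esub> \<sigma> | z. z \<in> W}"
    using class_tconj[OF W_one] assms(3) us(3) tconj_one by simp
  then show ?thesis using nice_iff_core weakly_elliptic_iff_core by simp
qed

end
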